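(* Let $n$ be an odd number, $h_n:=(n-1)/2$, and let $\ell$ be an integer with $0\le\ell\le h_n-1$. Let $T\in\mathcal{BC}^{0,1}(V_n)$ be such that its components $T_i$, $i=0,1,\dots,n-1$, have real spectra and $T_n=0$. Then the polyanalytic functional calculus based on the $S$-spectrum is well defined: for every left (resp. right) slice hyperholomorphic function $f$ and every bounded slice Cauchy domain $U$ with $\sigma_S(T)\subset U$ and $\overline U\subset\mathrm{dom}(f)$, the integral $$\breve f^\circ(T):=\frac1{2\pi}\int_{\partial(U\cap\mathbb C_I)}\mathcal P_\ell^L(s,T)\,ds_I\,f(s)\qquad\Big(\text{resp. }\ \breve f^\circ(T):=\frac1{2\pi}\int_{\partial(U\cap\mathbb C_I)}f(s)\,ds_I\,\mathcal P_\ell^R(s,T)\Big)$$ depends neither on the imaginary unit $I\in\mathbb S$ nor on the choice of such a slice Cauchy domain $U$.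
   Context: $\mathbb R_n$ is the real Clifford algebra generated by $e_1,\dots,e_n$ with $e_ie_j+e_je_i=-2\delta_{ij}$. A point $(x_0,\dots,x_n)\in\mathbb R^{n+1}$ is identified with the paravector $x=x_0+\underline x$, $\underline x=\sum_{j=1}^n x_je_j$ (with $e_0=1$). $\mathbb S$ is the set of $\underline x$ with $|\underline x|=1$; for $I\in\mathbb S$, $\mathbb C_I=\mathbb R+I\mathbb R$. $[x]=\{x_0+I|\underline x|: I\in\mathbb S\}$. An open $U\subset\mathbb R^{n+1}$ is axially symmetric if $[x]\subset U$ for all $x\in U$; it is a slice Cauchy domain if it is axially symmetric and, for every $I\in\mathbb S$, $\partial(U\cap\mathbb C_I)$ is a finite union of non-intersecting piecewise continuously differentiable Jordan curves in $\mathbb C_I$ (positively oriented). $ds_I=ds(-I)$. For $U$ axially symmetric open let $\mathcal U=\{(u,v)\in\mathbb R^2: u+\mathbb S v\subset U\}$. $f:U\to\mathbb R_n$ is left (resp. right) slice hyperholomorphic if $f(u+Iv)=\alpha(u,v)+I\beta(u,v)$ (resp. $\alpha(u,v)+\beta(u,v)I$) for all $I\in\mathbb S$, $(u,v)\in\mathcal U$, with differentiable $\alpha,\beta:\mathcal U\to\mathbb R_n$ satisfying $\alpha(u,-v)=\alpha(u,v)$, $\beta(u,-v)=-\beta(u,v)$ and $\partial_u\alpha=\partial_v\beta$, $\partial_v\alpha=-\partial_u\beta$. The domain $\mathrm{dom}(f)$ is an axially symmetric open set. $V$ is a real Banach space, $\mathcal B(V)$ its bounded linear operators, $V_n=V\otimes\mathbb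 R_n$ the two-sided Banach $\mathbb R_n$-module, $\mathcal B(V_n)$ the set of $\sum_A T_Ae_A$, $T_A\in\mathcal B(V)$, with $(\sum_AT_Ae_A)(\sum_Bv_Be_B)=\sum_{A,B}T_A(v_B)e_Ae_B$ and norm $\sum_A\|T_A\|$; $\mathbb R_n$ is embedded via $a\mapsto\mathcal I a$. $\mathcal{BC}^{0,1}(V_n)$ is the set of $T=\sum_{\mu=0}^ne_\mu T_\mu$ with pairwise commuting $T_\mu\in\mathcal B(V)$. $\overline T=T_0-\sum_{\mu\ge1}e_\mu T_\mu$. $\sigma_S(T)$ is the set of $s\in\mathbb R^{n+1}$ such that $T^2-2s_0T+|s|^2\mathcal I$ is not invertible in $\mathcal B(V_n)$ (equivalently, for commuting components, $\mathcal Q_{c,s}(T):=s^2\mathcal I-s(T+\overline T)+T\overline T$ is not invertible in $\mathcal B(V_n)$); $\rho_S(T)=\mathbb R^{n+1}\setminus\sigma_S(T)$. The spectrum of $T_i$ is the usual one (in the complexification of $V$). For $s\in\rho_S(T)$: $F_n^L(s,T)=\gamma_n(s\mathcal I-\overline T)\mathcal Q_{c,s}(T)^{-\frac{n+1}2}$, $F_n^R(s,T)=\gamma_n\mathcal Q_{c,s}(T)^{-\frac{n+1}2}(s\mathcal I-\overline T)$, $\gamma_n=[\Gamma(\frac{n+1}2)]^22^{n-1}(-1)^{\frac{n-1}2}$, and $$\mathcal P_\ell^L(s,T)=\frac{(-1)^{h_n-\ell}}{(h_n-\ell)!}F_n^L(s,T)(s\mathcal I-T_0)^{h_n-\ell},\qquad\mathcal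 P_\ell^R(s,T)=\frac{(-1)^{h_n-\ell}}{(h_n-\ell)!}(s\mathcal I-T_0)^{h_n-\ell}F_n^R(s,T).$$ *)

theory Defs
  imports "HOL-Complex_Analysis.Complex_Analysis"
begin

section \<open>Clifford coefficients\<close>

text \<open>
  The generators \<open>e\<^sub>1, \<dots>, e\<^sub>n\<close> are indexed by a finite linearly ordered type \<open>'n\<close>, so that
  \<open>n = CARD('n)\<close> and \<open>e\<^sub>n\<close> belongs to \<open>Max UNIV\<close>. For \<open>A = {a\<^sub>1 < \<dots> < a\<^sub>k}\<close> put
  \<open>e\<^sub>A = e\<^bsub>a\<^sub>1\<^esub> \<cdots> e\<^bsub>a\<^sub>k\<^esub>\<close>. A finite sum \<open>\<Sum>\<^sub>A c\<^sub>A e\<^sub>A\<close> is the vector of its coefficients, indexed by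
  the subsets of \<open>'n\<close>: \<open>real ^ 'n set\<close> is \<open>\<real>\<^sub>n\<close>, and \<open>('v \<Rightarrow>\<^sub>L 'v) ^ 'n set\<close> is \<open>\<B>(V\<^sub>n)\<close>. The norm of
  the latter type is \<open>(\<Sum>\<^sub>A \<parallel>T\<^sub>A\<parallel>\<^sup>2)\<^bsup>1/2\<^esup>\<close>, which is equivalent to \<open>\<Sum>\<^sub>A \<parallel>T\<^sub>A\<parallel>\<close>; only the topology is used.
  The term \<open>axis A c\<close> is \<open>c e\<^sub>A\<close>.

  From \<open>e\<^sub>i e\<^sub>j + e\<^sub>j e\<^sub>i = -2 \<delta>\<^sub>i\<^sub>j\<close> one gets \<open>e\<^sub>A e\<^sub>B = \<plusminus> e\<^bsub>A \<triangle> B\<^esub>\<close>, with a factor \<open>-1\<close> for each pair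
  \<open>a \<in> A\<close>, \<open>b \<in> B\<close> with \<open>b < a\<close> (interchange) or \<open>b = a\<close> (square).
\<close>

definition cl_sign :: "'n::linorder set \<Rightarrow> 'n set \<Rightarrow> real" where
  "cl_sign A B = (- 1) ^ card {(a, b). a \<in> A \<and> b \<in> B \<and> b \<le> a}"

definition cl_prod ::
  "('a \<Rightarrow> 'b \<Rightarrow> 'c::real_vector) \<Rightarrow> 'a ^ 'n::{finite,linorder} set \<Rightarrow> 'b ^ 'n set \<Rightarrow> 'c ^ 'n set" where
  "cl_prod m x y =
     (\<Sum>A\<in>UNIV. \<Sum>B\<in>UNIV. axis ((A - B) \<union> (B - A)) (cl_sign A B *\<^sub>R m (x $ A) (y $ B)))"

definition cl_mult ::
  "real ^ 'n::{finite,linorder} set \<Rightarrow> real ^ 'n set \<Rightarrow> real ^ 'n set" (infixl "\<star>" 70) where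
  "x \<star> y = cl_prod (*) x y"

lemma cl_prod_axis:
  fixes A B :: "'n::{finite,linorder} set"
  assumes "\<And>y. m 0 y = 0" "\<And>x. m x 0 = 0"
  shows "cl_prod m (axis A a) (axis B b)
       = axis ((A - B) \<union> (B - A)) (cl_sign A B *\<^sub>R m a b)"
proof -
  have ax0: "axis k 0 = 0" for k :: "'n set"
    by (simp add: axis_def vec_eq_iff)
  have "cl_prod m (axis A a) (axis B b) =
     (\<Sum>A'\<in>UNIV. \<Sum>B'\<in>UNIV. if B' = B then (if A' = A then
        axis ((A - B) \<union> (B - A)) (cl_sign A B *\<^sub>R m a b) else 0) else 0)"
    unfolding cl_prod_def
    by (intro sum.cong refl) (simp add: axis_def assms vec_eq_iff)
  then show ?thesis by simp
qed

text \<open>The generators satisfy the Clifford relations, and \<open>e\<^sub>A\<close> is the ordered product.\<close>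

lemma cl_generators:
  fixes i j :: "'n::{finite,linorder}"
  shows "axis {i} 1 \<star> axis {j} 1 + axis {j} 1 \<star> axis {i} 1
       = (if i = j then - 2 else 0) *\<^sub>R axis {} 1"
proof -
  have 1: "{(a, b). a = i \<and> b = j \<and> b \<le> a} = (if j \<le> i then {(i, j)} else {})" for i j :: 'n
    by auto
  have "axis {i} 1 \<star> axis {j} 1 = axis (({i} - {j}) \<union> ({j} - {i})) (if j \<le> i then - 1 else 1)"
    for i j :: 'n
    by (simp add: cl_mult_def cl_prod_axis cl_sign_def 1)
  then show ?thesis
    by (cases i j rule: linorder_cases) (auto simp: axis_def vec_eq_iff insert_Diff_if insert_commute)
qed

lemma cl_blade:
  fixes i :: "'n::{finite,linorder}"
  assumes "\<And>a. a \<in> A \<Longrightarrow> i < a"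
  shows "axis {i} 1 \<star> axis A 1 = axis (insert i A) 1"
proof -
  have "i \<notin> A" using assms by auto
  moreover have "{(a, b). a \<in> {i} \<and> b \<in> A \<and> b \<le> a} = {}"
    using assms by fastforce
  then have "cl_sign {i} A = 1"
    unfolding cl_sign_def by (metis card.empty power_0)
  ultimately show ?thesis
    by (simp add: cl_mult_def cl_prod_axis)
qed

section \<open>Paravectors and axially symmetric sets\<close>

text \<open>
  The point \<open>(x\<^sub>0, \<dots>, x\<^sub>n)\<close> of \<open>\<real>\<^bsup>n+1\<^esup>\<close> is the pair of \<open>x\<^sub>0\<close> and \<open>(x\<^sub>1, \<dots>, x\<^sub>n)\<close>; the norm of the product
  type is the Euclidean one. \<open>\<S>\<close> is the unit sphere of the second factor.
\<close>

type_synonym 'n pvec = "real \<times> (real ^ 'n)"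

definition paravector :: "'n::{finite,linorder} pvec \<Rightarrow> real ^ 'n set" where
  "paravector x = axis {} (fst x) + (\<Sum>j\<in>UNIV. axis {j} (snd x $ j))"

definition unit_sphere :: "(real ^ 'n::finite) set" where
  "unit_sphere = {I. norm I = 1}"

definition axially_symmetric :: "'n::finite pvec set \<Rightarrow> bool" where
  "axially_symmetric U \<longleftrightarrow>
     (\<forall>x\<in>U. \<forall>I\<in>unit_sphere. (fst x, norm (snd x) *\<^sub>R I) \<in> U)"

text \<open>\<open>slice_point I\<close> is the isomorphism \<open>u + \<i>v \<mapsto> u + Iv\<close> from \<open>\<complex>\<close> onto \<open>\<complex>\<^sub>I\<close>.\<close>

definition slice_point :: "real ^ 'n::finite \<Rightarrow> complex \<Rightarrow> 'n pvec" where
  "slice_point I z = (Re z, Im z *\<^sub>R I)"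

definition slice_of :: "real ^ 'n::finite \<Rightarrow> 'n pvec set \<Rightarrow> complex set" where
  "slice_of I U = {z. slice_point I z \<in> U}"

text \<open>
  \<open>\<Gamma>\<close> parametrizes the boundary of the bounded open set \<open>W\<close> by finitely many disjoint piecewise
  continuously differentiable Jordan curves, oriented such that \<open>W\<close> lies to their left, i.e. such
  that the total winding number is 1 inside and 0 outside.
\<close>

definition pos_oriented_boundary :: "complex set \<Rightarrow> (real \<Rightarrow> complex) set \<Rightarrow> bool" where
  "pos_oriented_boundary W \<Gamma> \<longleftrightarrow>
     finite \<Gamma> \<and>
     (\<forall>\<gamma>\<in>\<Gamma>. simple_path \<gamma> \<and> pathfinish \<gamma> = pathstart \<gamma> \<and> \<gamma> piecewise_C1_differentiable_on {0..1}) \<and>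
     (\<forall>\<gamma>\<in>\<Gamma>. \<forall>\<delta>\<in>\<Gamma>. \<gamma> \<noteq> \<delta> \<longrightarrow> path_image \<gamma> \<inter> path_image \<delta> = {}) \<and>
     (\<Union>\<gamma>\<in>\<Gamma>. path_image \<gamma>) = frontier W \<and>
     (\<forall>z\<in>W. (\<Sum>\<gamma>\<in>\<Gamma>. winding_number \<gamma> z) = 1) \<and>
     (\<forall>z. z \<notin> closure W \<longrightarrow> (\<Sum>\<gamma>\<in>\<Gamma>. winding_number \<gamma> z) = 0)"

definition bounded_slice_cauchy_domain :: "'n::finite pvec set \<Rightarrow> bool" where
  "bounded_slice_cauchy_domain U \<longleftrightarrow>
     open U \<and> bounded U \<and> axially_symmetric U \<and>
     (\<forall>I\<in>unit_sphere. \<exists>\<Gamma>. pos_oriented_boundary (slice_of I U) \<Gamma>)"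

section \<open>Slice hyperholomorphic functions\<close>

definition slice_params :: "'n::finite pvec set \<Rightarrow> (real \<times> real) set" where
  "slice_params U = {(u, v). \<forall>I\<in>unit_sphere. (u, v *\<^sub>R I) \<in> U}"

definition stem_pair ::
  "(real \<times> real) set \<Rightarrow> (real \<times> real \<Rightarrow> 'a::real_normed_vector) \<Rightarrow> (real \<times> real \<Rightarrow> 'a) \<Rightarrow> bool" where
  "stem_pair W \<alpha> \<beta> \<longleftrightarrow>
     (\<forall>(u, v)\<in>W. \<alpha> (u, - v) = \<alpha> (u, v) \<and> \<beta> (u, - v) = - \<beta> (u, v)) \<and>
     (\<forall>p\<in>W. \<exists>D\<alpha> D\<beta>. (\<alpha> has_derivative D\<alpha>) (at p) \<and> (\<beta> has_derivative D\<beta>) (at p) \<and>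
        D\<alpha> (1, 0) = D\<beta> (0, 1) \<and> D\<alpha> (0, 1) = - D\<beta> (1, 0))"

definition left_slice_hyperholomorphic ::
  "'n::{finite,linorder} pvec set \<Rightarrow> ('n pvec \<Rightarrow> real ^ 'n set) \<Rightarrow> bool" where
  "left_slice_hyperholomorphic U f \<longleftrightarrow>
     open U \<and> axially_symmetric U \<and>
     (\<exists>\<alpha> \<beta>. stem_pair (slice_params U) \<alpha> \<beta> \<and>
       (\<forall>I\<in>unit_sphere. \<forall>(u, v)\<in>slice_params U.
          f (u, v *\<^sub>R I) = \<alpha> (u, v) + paravector (0, I) \<star> \<beta> (u, v)))"

definition right_slice_hyperholomorphic ::
  "'n::{finite,linorder} pvec set \<Rightarrow> ('n pvec \<Rightarrow> real ^ 'n set) \<Rightarrow> bool" where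
  "right_slice_hyperholomorphic U f \<longleftrightarrow>
     open U \<and> axially_symmetric U \<and>
     (\<exists>\<alpha> \<beta>. stem_pair (slice_params U) \<alpha> \<beta> \<and>
       (\<forall>I\<in>unit_sphere. \<forall>(u, v)\<in>slice_params U.
          f (u, v *\<^sub>R I) = \<alpha> (u, v) + \<beta> (u, v) \<star> paravector (0, I)))"

section \<open>Operators on the Banach module\<close>

type_synonym ('v, 'n) clop = "('v \<Rightarrow>\<^sub>L 'v) ^ 'n set"

definition op_mult ::
  "('v::real_normed_vector, 'n::{finite,linorder}) clop \<Rightarrow> ('v, 'n) clop \<Rightarrow> ('v, 'n) clop"
  (infixl "\<odot>" 70) where
  "S \<odot> T = cl_prod (o\<^sub>L) S T"

definition op_one :: "('v::real_normed_vector, 'n::{finite,linorder}) clop" where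
  "op_one = axis {} id_blinfun"

definition op_of :: "real ^ 'n::{finite,linorder} set \<Rightarrow> ('v::real_normed_vector, 'n) clop" where
  "op_of a = (\<chi> A. (a $ A) *\<^sub>R id_blinfun)"

definition op_inverse_of ::
  "('v::real_normed_vector, 'n::{finite,linorder}) clop \<Rightarrow> ('v, 'n) clop \<Rightarrow> bool" where
  "op_inverse_of S T \<longleftrightarrow> S \<odot> T = op_one \<and> T \<odot> S = op_one"

definition op_invertible :: "('v::real_normed_vector, 'n::{finite,linorder}) clop \<Rightarrow> bool" where
  "op_invertible T \<longleftrightarrow> (\<exists>S. op_inverse_of S T)"

definition op_inv ::
  "('v::real_normed_vector, 'n::{finite,linorder}) clop \<Rightarrow> ('v, 'n) clop" where
  "op_inv T = (THE S. op_inverse_of S T)"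

primrec op_pow ::
  "('v::real_normed_vector, 'n::{finite,linorder}) clop \<Rightarrow> nat \<Rightarrow> ('v, 'n) clop" where
  "op_pow T 0 = op_one"
| "op_pow T (Suc k) = T \<odot> op_pow T k"

text \<open>
  For a paravector operator \<open>T = \<Sum>\<^sub>\<mu> e\<^sub>\<mu> T\<^sub>\<mu>\<close> the components are \<open>T\<^sub>0 = T $ {}\<close> and \<open>T\<^sub>j = T $ {j}\<close>.
\<close>

definition op_paravector ::
  "('v::real_normed_vector \<Rightarrow>\<^sub>L 'v) \<Rightarrow> ('n::{finite,linorder} \<Rightarrow> 'v \<Rightarrow>\<^sub>L 'v) \<Rightarrow> ('v, 'n) clop" where
  "op_paravector T0 T' = axis {} T0 + (\<Sum>j\<in>UNIV. axis {j} (T' j))"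

definition BC01 :: "('v::real_normed_vector, 'n::{finite,linorder}) clop set" where
  "BC01 = {op_paravector T0 T' | T0 T'.
     (\<forall>j. T0 o\<^sub>L T' j = T' j o\<^sub>L T0) \<and> (\<forall>i j. T' i o\<^sub>L T' j = T' j o\<^sub>L T' i)}"

definition op_conj ::
  "('v::real_normed_vector, 'n::{finite,linorder}) clop \<Rightarrow> ('v, 'n) clop" where
  "op_conj T = op_paravector (T $ {}) (\<lambda>j. - (T $ {j}))"

definition S_spectrum ::
  "('v::real_normed_vector, 'n::{finite,linorder}) clop \<Rightarrow> 'n pvec set" where
  "S_spectrum T =
     {s. \<not> op_invertible (T \<odot> T - (2 * fst s) *\<^sub>R T + (norm s)\<^sup>2 *\<^sub>R op_one)}"

text \<open>
  The spectrum of \<open>T \<in> \<B>(V)\<close> in the complexification \<open>V \<times> V\<close> of \<open>V\<close>, where \<open>(x, y)\<close> stands for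
  \<open>x + \<i>y\<close>. An inverse of the complex linear map \<open>z - T\<close> is complex linear.
\<close>

definition cx_shift :: "complex \<Rightarrow> ('v::real_normed_vector \<Rightarrow>\<^sub>L 'v) \<Rightarrow> 'v \<times> 'v \<Rightarrow> 'v \<times> 'v" where
  "cx_shift z T = (\<lambda>(x, y).
     (Re z *\<^sub>R x - Im z *\<^sub>R y - blinfun_apply T x, Im z *\<^sub>R x + Re z *\<^sub>R y - blinfun_apply T y))"

definition cx_spectrum :: "('v::real_normed_vector \<Rightarrow>\<^sub>L 'v) \<Rightarrow> complex set" where
  "cx_spectrum T =
     {z. \<not> (\<exists>S. bounded_linear S \<and> S \<circ> cx_shift z T = id \<and> cx_shift z T \<circ> S = id)}"

section \<open>Kernels and the functional calculus\<close>

definition h_of :: "nat \<Rightarrow> nat" where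
  "h_of n = (n - 1) div 2"

definition gamma_const :: "nat \<Rightarrow> real" where
  "gamma_const n = (Gamma ((real n + 1) / 2))\<^sup>2 * 2 ^ (n - 1) * (- 1) ^ ((n - 1) div 2)"

definition Qc ::
  "'n::{finite,linorder} pvec \<Rightarrow> ('v::real_normed_vector, 'n) clop \<Rightarrow> ('v, 'n) clop" where
  "Qc s T = op_of (paravector s \<star> paravector s)
     - op_of (paravector s) \<odot> (T + op_conj T) + T \<odot> op_conj T"

text \<open>For odd \<open>n\<close> the exponent \<open>-(n+1)/2\<close> is an integer.\<close>

definition F_left ::
  "'n::{finite,linorder} pvec \<Rightarrow> ('v::real_normed_vector, 'n) clop \<Rightarrow> ('v, 'n) clop" where
  "F_left s T = gamma_const CARD('n) *\<^sub>R
     ((op_of (paravector s) - op_conj T) \<odot> op_pow (op_inv (Qc s T)) ((CARD('n) + 1) div 2))"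

definition F_right ::
  "'n::{finite,linorder} pvec \<Rightarrow> ('v::real_normed_vector, 'n) clop \<Rightarrow> ('v, 'n) clop" where
  "F_right s T = gamma_const CARD('n) *\<^sub>R
     (op_pow (op_inv (Qc s T)) ((CARD('n) + 1) div 2) \<odot> (op_of (paravector s) - op_conj T))"

definition P_left ::
  "nat \<Rightarrow> 'n::{finite,linorder} pvec \<Rightarrow> ('v::real_normed_vector, 'n) clop \<Rightarrow> ('v, 'n) clop" where
  "P_left l s T = (let k = h_of CARD('n) - l in
     ((- 1) ^ k / fact k) *\<^sub>R
       (F_left s T \<odot> op_pow (op_of (paravector s) - axis {} (T $ {})) k))"

definition P_right ::
  "nat \<Rightarrow> 'n::{finite,linorder} pvec \<Rightarrow> ('v::real_normed_vector, 'n) clop \<Rightarrow> ('v, 'n) clop" where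
  "P_right l s T = (let k = h_of CARD('n) - l in
     ((- 1) ^ k / fact k) *\<^sub>R
       (op_pow (op_of (paravector s) - axis {} (T $ {})) k \<odot> F_right s T))"

text \<open>\<open>ds_I = ds (-I)\<close> along \<open>s = slice_point I (\<gamma> t)\<close>, \<open>0 \<le> t \<le> 1\<close>.\<close>

definition ds_slice ::
  "(real, 'n::{finite,linorder}) vec \<Rightarrow> (real \<Rightarrow> complex) \<Rightarrow> real \<Rightarrow> real ^ 'n set" where
  "ds_slice I \<gamma> t =
     paravector (slice_point I (vector_derivative \<gamma> (at t within {0..1}))) \<star> (- paravector (0, I))"

definition left_integrand ::
  "nat \<Rightarrow> ('n::{finite,linorder} pvec \<Rightarrow> real ^ 'n set) \<Rightarrow> ('v::real_normed_vector, 'n) clop \<Rightarrow>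
   (real, 'n) vec \<Rightarrow> (real \<Rightarrow> complex) \<Rightarrow> real \<Rightarrow> ('v, 'n) clop" where
  "left_integrand l f T I \<gamma> t =
     P_left l (slice_point I (\<gamma> t)) T \<odot> op_of (ds_slice I \<gamma> t) \<odot> op_of (f (slice_point I (\<gamma> t)))"

definition right_integrand ::
  "nat \<Rightarrow> ('n::{finite,linorder} pvec \<Rightarrow> real ^ 'n set) \<Rightarrow> ('v::real_normed_vector, 'n) clop \<Rightarrow>
   (real, 'n) vec \<Rightarrow> (real \<Rightarrow> complex) \<Rightarrow> real \<Rightarrow> ('v, 'n) clop" where
  "right_integrand l f T I \<gamma> t =
     op_of (f (slice_point I (\<gamma> t))) \<odot> op_of (ds_slice I \<gamma> t) \<odot> P_right l (slice_point I (\<gamma> t)) T"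

definition left_calculus ::
  "nat \<Rightarrow> ('n::{finite,linorder} pvec \<Rightarrow> real ^ 'n set) \<Rightarrow> ('v::real_normed_vector, 'n) clop \<Rightarrow>
   (real, 'n) vec \<Rightarrow> (real \<Rightarrow> complex) set \<Rightarrow> ('v, 'n) clop" where
  "left_calculus l f T I \<Gamma> =
     (1 / (2 * pi)) *\<^sub>R (\<Sum>\<gamma>\<in>\<Gamma>. integral {0..1} (left_integrand l f T I \<gamma>))"

definition right_calculus ::
  "nat \<Rightarrow> ('n::{finite,linorder} pvec \<Rightarrow> real ^ 'n set) \<Rightarrow> ('v::real_normed_vector, 'n) clop \<Rightarrow>
   (real, 'n) vec \<Rightarrow> (real \<Rightarrow> complex) set \<Rightarrow> ('v, 'n) clop" where
  "right_calculus l f T I \<Gamma> =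
     (1 / (2 * pi)) *\<^sub>R (\<Sum>\<gamma>\<in>\<Gamma>. integral {0..1} (right_integrand l f T I \<gamma>))"

text \<open>
  The data on which the integral depends: a bounded slice Cauchy domain \<open>U\<close> with \<open>\<sigma>\<^sub>S(T) \<subset> U\<close> and closure
  in the domain \<open>D\<close> of the function, an imaginary unit \<open>I\<close>, and a parametrization \<open>\<Gamma>\<close> of
  \<open>\<partial>(U \<inter> \<complex>\<^sub>I)\<close>.
\<close>

definition admissible_contour ::
  "'n::{finite,linorder} pvec set \<Rightarrow> ('v::real_normed_vector, 'n) clop \<Rightarrow>
   'n pvec set \<Rightarrow> (real, 'n) vec \<Rightarrow> (real \<Rightarrow> complex) set \<Rightarrow> bool" where
  "admissible_contour D T U I \<Gamma> \<longleftrightarrow>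
     bounded_slice_cauchy_domain U \<and> S_spectrum T \<subseteq> U \<and> closure U \<subseteq> D \<and>
     I \<in> unit_sphere \<and> pos_oriented_boundary (slice_of I U) \<Gamma>"

end

theory Submission
  imports Defs
begin

text \<open>
  Write the kernel on \<open>\<complex>\<^sub>I\<close> as \<open>a(z) + b(z) I\<close> and the function as \<open>\<alpha>(z) + I \<beta>(z)\<close>, where \<open>a, b, \<alpha>, \<beta>\<close>
  do not depend on \<open>I\<close>. The integrand is then the imaginary part of \<open>(a + \<i>b)(\<alpha> + \<i>\<beta>) dz\<close> minus the real
  part of the same expression with \<open>I\<close> inserted between the factors; the latter integrates to zero
  because the domain is symmetric under conjugation. What remains is the integral of a function that is
  independent of \<open>I\<close>, takes values in a complexified Banach space, and is holomorphic on the domain of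
  the given function outside the spectrum. Two contours of the same integral are homologous
  there, so the claim follows from Cauchy's theorem for cycles, applied to the compositions with
  bounded functionals. The kernel is holomorphic off the S-spectrum because
  \<open>\<Q>\<^sub>c(s, T)\<close> and \<open>T\<^sup>2 - 2 s\<^sub>0 T + |s|\<^sup>2\<close> divide the same real operator.
\<close>

section \<open>Cauchy's theorem for null-homologous cycles\<close>

text \<open>Both T + conj T and T conj T are real operators. Hence s - T_0, Q_c(s, T) and its
  inverse lie in the image of the complexification of B(V) under i |-> I, and their dependence on I
  is confined to this homomorphism. Two objects stay outside the image: conj T, which is kept as an
  outer factor, and the values of f. Cauchy's theorem is needed in its homology form because two
  admissible domains may be disconnected, multiply connected and otherwise unrelated. All that their
  contours share is total winding number 1 about the points where Q(z) is singular and 0 about the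
  points outside the domain of f. Vector-valued holomorphy is taken with a continuous derivative.
  This gives local primitives by differentiation under the integral sign, and the primitives in turn
  give integrability along paths whose derivative is unbounded.\<close>

lemma loop_homotopic_avoiding_point:
  fixes g :: "real \<Rightarrow> complex"
  assumes "open S" "path g" "path_image g \<subseteq> S" "pathfinish g = pathstart g"
  obtains p where "polynomial_function p" "pathfinish p = pathstart p" "path_image p \<subseteq> S"
    "w \<notin> path_image p" "homotopic_loops S g p"
proof -
  obtain e where e: "e > 0" "(\<Union>x\<in>path_image g. ball x e) \<subseteq> S"
    using compact_subset_open_imp_ball_epsilon_subset[OF compact_path_image assms(1,3)] assms(2)
    by metis
  \<comment> \<open>One half of \<open>e\<close> is spent on the approximation, the other on the
    translation below.\<close>
  obtain q where q: "polynomial_function q" "pathstart q = pathstart g" "pathfinish q = pathfinish g"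
    "\<And>t. t \<in> {0..1} \<Longrightarrow> norm (q t - g t) < e / 2"
    using path_approx_polynomial_function[OF assms(2), of "e / 2"] e(1) by auto
  \<comment> \<open>A smooth curve in the plane has measure zero, so some \<open>v\<close> within
    \<open>e / 2\<close> of \<open>w\<close> is missed by \<open>q\<close>. Translating by
    \<open>w - v\<close> moves the missed point to \<open>w\<close>.\<close>
  have "negligible (path_image q)"
    unfolding path_image_def
    by (rule negligible_differentiable_image_lowdim)
       (auto intro: differentiable_at_imp_differentiable_on differentiable_at_polynomial_function q(1))
  moreover have "\<not> negligible (ball w (e / 2))"
    using e(1) by (intro open_not_negligible) auto
  ultimately obtain v where v: "v \<in> ball w (e / 2)" "v \<notin> path_image q"
    using negligible_subset by blast
  define p where "p = (\<lambda>t. q t + (w - v))"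
  have near: "norm (p t - g t) < e" if "t \<in> {0..1}" for t
  proof -
    have "p t - g t = (q t - g t) + (w - v)" by (simp add: p_def)
    also have "norm \<dots> \<le> norm (q t - g t) + norm (w - v)" by (rule norm_triangle_ineq)
    also have "\<dots> < e" using q(4)[OF that] v(1) by (simp add: dist_norm)
    finally show ?thesis .
  qed
  have poly: "polynomial_function p"
    unfolding p_def using q(1) by (intro polynomial_function_add) auto
  have seg: "closed_segment (g t) (p t) \<subseteq> S" if "t \<in> {0..1}" for t
  proof -
    have "closed_segment (g t) (p t) \<subseteq> ball (g t) e"
      using near[OF that] e(1) by (intro closed_segment_subset) (auto simp: dist_norm norm_minus_commute)
    also have "\<dots> \<subseteq> S" using e(2) that by (force simp: path_image_def)
    finally show ?thesis .
  qed
  have loop: "pathfinish p = pathstart p"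
    using q(2,3) assms(4) by (auto simp: p_def pathfinish_def pathstart_def)
  show ?thesis
  proof
    show "path_image p \<subseteq> S"
      using seg ends_in_segment(2) by (fastforce simp: path_image_def)
    show "w \<notin> path_image p"
      using v(2) by (auto simp: path_image_def p_def image_iff algebra_simps)
    show "homotopic_loops S g p"
      using poly loop assms(2,4) seg
      by (intro homotopic_loops_linear) (auto simp: path_polynomial_function)
  qed (use poly loop in auto)
qed

lemma polynomial_function_derivative_bounded:
  fixes p :: "real \<Rightarrow> complex"
  assumes "polynomial_function p"
  obtains B where "\<And>t. t \<in> {0..1} \<Longrightarrow> norm (vector_derivative p (at t)) \<le> B"
proof -
  obtain p' where p': "polynomial_function p'" "\<And>x. (p has_vector_derivative p' x) (at x)"
    using has_vector_derivative_polynomial_function[OF assms] by metis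
  have "bounded (p' ` {0..1})"
    by (intro compact_imp_bounded compact_continuous_image continuous_on_polymonial_function p') auto
  then obtain B where "\<And>t. t \<in> {0..1} \<Longrightarrow> norm (p' t) \<le> B"
    unfolding bounded_iff by blast
  then show thesis
    using that[of B] vector_derivative_at[OF p'(2)] by simp
qed

text \<open>Differentiation under the integral sign uses a bound on the derivative of the path. A
  polynomial path has one, whereas a piecewise continuously differentiable path may not.\<close>

lemma polynomial_Cauchy_integral_holomorphic:
  assumes "open S" "f holomorphic_on S" "polynomial_function p" "path_image p \<subseteq> S"
  shows "(\<lambda>w. contour_integral p (\<lambda>z. f z / (z - w))) holomorphic_on - path_image p"
proof -
  obtain B where B: "\<And>t. t \<in> {0..1} \<Longrightarrow> norm (vector_derivative p (at t)) \<le> B"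
    using polynomial_function_derivative_bounded[OF assms(3)] by metis
  have vp: "valid_path p" using assms(3) by (rule valid_path_polynomial_function)
  show ?thesis
  proof (rule holomorphic_onI)
    fix w assume w: "w \<in> - path_image p"
    have "((\<lambda>w. contour_integral p (\<lambda>z. f z / (z - w))) has_field_derivative
        (of_nat 1 * contour_integral p (\<lambda>u. f u / (u - w) ^ Suc 1))) (at w)"
    proof (rule Cauchy_next_derivative(2)[where S = UNIV and \<gamma> = p and f' = f and k = 1])
      show "continuous_on (path_image p) f"
        using assms(2,4) holomorphic_on_imp_continuous_on continuous_on_subset by blast
      fix w assume w: "w \<in> UNIV - path_image p"
      have "(\<lambda>z. f z / (z - w)) contour_integrable_on p"
        using w assms
        by (intro contour_integrable_holomorphic_simple[where S = "S - {w}"] vp)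
           (auto intro!: holomorphic_intros intro: holomorphic_on_subset)
      then show "((\<lambda>u. f u / (u - w) ^ 1) has_contour_integral
          contour_integral p (\<lambda>z. f z / (z - w))) p"
        by (simp add: has_contour_integral_integral)
    qed (use B vp w in auto)
    then show "(\<lambda>w. contour_integral p (\<lambda>z. f z / (z - w))) field_differentiable
        at w within - path_image p"
      by (meson field_differentiable_at_within field_differentiable_def)
  qed
qed

text \<open>One polynomial loop has to serve all \<open>v\<close> near \<open>w\<close>. The
  homotopy therefore runs in \<open>S\<close> with a closed disc around \<open>w\<close> removed,
  where every integrand with its pole in that disc is holomorphic.\<close>

lemma loop_Cauchy_integral_holomorphic:
  assumes "open S" "f holomorphic_on S" "valid_path g" "path_image g \<subseteq> S"
    "pathfinish g = pathstart g"
  shows "(\<lambda>w. contour_integral g (\<lambda>z. f z / (z - w))) holomorphic_on - path_image g"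
proof -
  have "(\<lambda>w. contour_integral g (\<lambda>z. f z / (z - w))) field_differentiable at w"
    if w: "w \<notin> path_image g" for w
  proof -
    have "open (- path_image g)"
      using assms(3) by (simp add: closed_valid_path_image open_Compl)
    then obtain r where r: "r > 0" "cball w r \<subseteq> - path_image g"
      using w by (meson ComplI open_contains_cball)
    define S' where "S' = S - cball w r"
    have S': "open S'" "path_image g \<subseteq> S'"
      using assms r by (auto simp: S'_def open_Diff)
    obtain p where p: "polynomial_function p" "path_image p \<subseteq> S'" "homotopic_loops S' g p"
      using loop_homotopic_avoiding_point[OF S'(1) _ S'(2) assms(5)] valid_path_imp_path[OF assms(3)]
      by metis
    have "(\<lambda>w. contour_integral p (\<lambda>z. f z / (z - w))) holomorphic_on ball w r"
      by (rule holomorphic_on_subset[OF polynomial_Cauchy_integral_holomorphic[OF S'(1) _ p(1,2)]])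
         (use assms(2) p(2) in \<open>auto simp: S'_def intro: holomorphic_on_subset\<close>)
    moreover have "contour_integral p (\<lambda>z. f z / (z - v)) = contour_integral g (\<lambda>z. f z / (z - v))"
      if "v \<in> ball w r" for v
      using that assms(2)
      by (intro Cauchy_theorem_homotopic_loops[symmetric, OF p(3) S'(1) _ assms(3)]
            valid_path_polynomial_function p(1))
         (auto intro!: holomorphic_intros intro: holomorphic_on_subset simp: S'_def)
    ultimately have "(\<lambda>w. contour_integral g (\<lambda>z. f z / (z - w))) holomorphic_on ball w r"
      by (rule holomorphic_transform)
    then show ?thesis
      using r(1) holomorphic_on_imp_differentiable_at by (metis centre_in_ball open_ball)
  qed
  then show ?thesis
    by (auto intro!: holomorphic_onI intro: field_differentiable_at_within)
qed

text \<open>For \<open>norm w > R\<close> the integrand is holomorphic on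
  \<open>S \<inter> ball 0 R\<close>. A single polynomial loop in this set replaces \<open>g\<close>
  for all such \<open>w\<close>, and its bounded derivative gives decay like
  \<open>1 / (norm w - R)\<close>.\<close>

lemma loop_Cauchy_integral_tendsto_0:
  assumes "open S" "f holomorphic_on S" "valid_path g" "path_image g \<subseteq> S"
    "pathfinish g = pathstart g"
  shows "((\<lambda>w. contour_integral g (\<lambda>z. f z / (z - w))) \<longlongrightarrow> 0) at_infinity"
proof -
  have "bounded (path_image g)"
    using assms(3) by (simp add: bounded_path_image valid_path_imp_path)
  then obtain R where R: "path_image g \<subseteq> ball 0 R"
    by (metis bounded_subset_ballD)
  define S' where "S' = S \<inter> ball 0 R"
  have S': "open S'" "path_image g \<subseteq> S'"
    using assms R by (auto simp: S'_def)
  obtain p where p: "polynomial_function p" "path_image p \<subseteq> S'" "homotopic_loops S' g p"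
    using loop_homotopic_avoiding_point[OF S'(1) _ S'(2) assms(5)] valid_path_imp_path[OF assms(3)]
    by metis
  obtain B where B: "\<And>t. t \<in> {0..1} \<Longrightarrow> norm (vector_derivative p (at t)) \<le> B"
    using polynomial_function_derivative_bounded[OF p(1)] by metis
  have "B \<ge> 0" using order_trans[OF norm_ge_zero B[of 0]] by simp
  have vp: "valid_path p" using p(1) by (rule valid_path_polynomial_function)
  have "bounded (f ` path_image p)"
    using assms(2) p(2) vp
    by (intro compact_imp_bounded compact_continuous_image)
       (auto simp: S'_def compact_valid_path_image
          intro: holomorphic_on_imp_continuous_on holomorphic_on_subset)
  then obtain M where M: "\<And>z. z \<in> path_image p \<Longrightarrow> norm (f z) \<le> M" "M > 0"
    unfolding bounded_pos by auto
  have bound: "norm (contour_integral g (\<lambda>z. f z / (z - w))) \<le> M * B / (norm w - R)"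
    if w: "norm w > R" for w
  proof -
    have holo: "(\<lambda>z. f z / (z - w)) holomorphic_on S'"
      using assms(2) w by (auto intro!: holomorphic_intros intro: holomorphic_on_subset simp: S'_def)
    then have "(\<lambda>z. f z / (z - w)) contour_integrable_on p"
      using S'(1) p(2) vp by (intro contour_integrable_holomorphic_simple)
    then have int: "((\<lambda>t. f (p t) / (p t - w) * vector_derivative p (at t)) has_integral
        contour_integral p (\<lambda>z. f z / (z - w))) (cbox 0 1)"
      using has_contour_integral_integral unfolding has_contour_integral cbox_interval by blast
    have "norm (contour_integral p (\<lambda>z. f z / (z - w)))
        \<le> (M / (norm w - R) * B) * measure lborel (cbox 0 (1::real))"
    proof (rule has_integral_bound[OF _ int])
      fix t :: real assume t: "t \<in> cbox 0 1"
      then have pt: "p t \<in> path_image p" by (auto simp: path_image_def)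
      then have "norm (p t) < R" using p(2) by (auto simp: S'_def)
      moreover have "norm w - norm (p t) \<le> norm (p t - w)"
        using norm_triangle_ineq2[of w "p t"] by (simp add: norm_minus_commute)
      ultimately have "norm w - R \<le> norm (p t - w)" by linarith
      then have "norm (f (p t)) / norm (p t - w) \<le> M / (norm w - R)"
        using w M(1)[OF pt] M(2) by (intro frac_le) auto
      then show "norm (f (p t) / (p t - w) * vector_derivative p (at t)) \<le> M / (norm w - R) * B"
        using B[of t] t w \<open>M > 0\<close> unfolding norm_mult norm_divide
        by (intro mult_mono) auto
    qed (use w \<open>M > 0\<close> \<open>B \<ge> 0\<close> in auto)
    moreover have "contour_integral g (\<lambda>z. f z / (z - w)) = contour_integral p (\<lambda>z. f z / (z - w))"
      by (rule Cauchy_theorem_homotopic_loops[OF p(3) S'(1) holo assms(3) vp])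
    ultimately show ?thesis by simp
  qed
  have "((\<lambda>w::complex. M * B / (norm w - R)) \<longlongrightarrow> 0) at_infinity"
  proof (rule filterlim_compose[OF _ filterlim_norm_at_top])
    have "filterlim (\<lambda>x. - R + x) at_top (at_top :: real filter)"
      by (rule filterlim_tendsto_add_at_top[OF tendsto_const filterlim_ident])
    then show "((\<lambda>x. M * B / (x - R)) \<longlongrightarrow> 0) at_top"
      by (intro tendsto_divide_0[OF tendsto_const] filterlim_at_top_imp_at_infinity) simp
  qed
  then show ?thesis
  proof (rule Lim_null_comparison[rotated])
    show "\<forall>\<^sub>F w in at_infinity. norm (contour_integral g (\<lambda>z. f z / (z - w))) \<le> M * B / (norm w - R)"
      unfolding eventually_at_infinity using bound by (intro exI[of _ "R + 1"]) auto
  qed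
qed

section \<open>Dixon's proof of the homology form of Cauchy's theorem\<close>

definition diff_quot :: "(complex \<Rightarrow> complex) \<Rightarrow> complex \<Rightarrow> complex \<Rightarrow> complex" where
  "diff_quot f w z = (if z = w then deriv f w else (f z - f w) / (z - w))"

lemma diff_quot_holomorphic:
  "open S \<Longrightarrow> f holomorphic_on S \<Longrightarrow> diff_quot f w holomorphic_on S"
  using pole_lemma_open[of f S w] unfolding diff_quot_def[abs_def] by simp

lemma contour_integral_diff_quot:
  assumes "open S" "f holomorphic_on S" "valid_path g" "path_image g \<subseteq> S" "w \<notin> path_image g"
  shows "contour_integral g (diff_quot f w)
       = contour_integral g (\<lambda>z. f z / (z - w)) - f w * contour_integral g (\<lambda>z. 1 / (z - w))"
proof -
  have "contour_integral g (diff_quot f w) = contour_integral g (\<lambda>z. f z / (z - w) - f w * (1 / (z - w)))"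
    using assms(5) by (intro contour_integral_cong) (auto simp: diff_quot_def diff_divide_distrib)
  also have "\<dots> = contour_integral g (\<lambda>z. f z / (z - w)) - contour_integral g (\<lambda>z. f w * (1 / (z - w)))"
    using assms
    by (intro contour_integral_diff contour_integrable_holomorphic_simple[where S = "S - {w}"])
       (auto intro!: holomorphic_intros intro: holomorphic_on_subset)
  also have "contour_integral g (\<lambda>z. f w * (1 / (z - w))) = f w * contour_integral g (\<lambda>z. 1 / (z - w))"
    using assms
    by (intro contour_integral_lmul contour_integrable_holomorphic_simple[where S = "S - {w}"])
       (auto intro!: holomorphic_intros intro: holomorphic_on_subset)
  finally show ?thesis .
qed

text \<open>The integrand is holomorphic in the integration variable, so near a given \<open>w\<close> the loop may be
  replaced by a homotopic one that avoids \<open>w\<close>.\<close>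

lemma contour_integral_diff_quot_holomorphic:
  assumes "open S" "f holomorphic_on S" "valid_path g" "path_image g \<subseteq> S"
    "pathfinish g = pathstart g"
  shows "(\<lambda>w. contour_integral g (diff_quot f w)) holomorphic_on S"
proof -
  have "(\<lambda>w. contour_integral g (diff_quot f w)) field_differentiable at w" if w: "w \<in> S" for w
  proof -
    obtain p where p: "polynomial_function p" "path_image p \<subseteq> S" "w \<notin> path_image p"
      "homotopic_loops S g p"
      using loop_homotopic_avoiding_point[OF assms(1) _ assms(4,5)] valid_path_imp_path[OF assms(3)]
      by metis
    have vp: "valid_path p" using p(1) by (rule valid_path_polynomial_function)
    have "open (S - path_image p)"
      using assms(1) vp by (simp add: closed_valid_path_image open_Diff)
    then obtain r where r: "r > 0" "ball w r \<subseteq> S - path_image p"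
      using w p(3) by (meson DiffI open_contains_ball)
    \<comment> \<open>Off the chosen polynomial loop the difference quotient splits into two Cauchy
      integrals, each holomorphic in \<open>v\<close>.\<close>
    have "(\<lambda>v. contour_integral p (\<lambda>z. f z / (z - v))
              - f v * contour_integral p (\<lambda>z. 1 / (z - v))) holomorphic_on ball w r"
      using r(2) assms(1,2) p(1,2)
      by (intro holomorphic_intros)
         (auto intro: holomorphic_on_subset
            intro!: holomorphic_on_subset[OF polynomial_Cauchy_integral_holomorphic[of S]])
    moreover have "contour_integral p (\<lambda>z. f z / (z - v)) - f v * contour_integral p (\<lambda>z. 1 / (z - v))
        = contour_integral g (diff_quot f v)" if "v \<in> ball w r" for v
      using that r(2) contour_integral_diff_quot[OF assms(1,2) vp p(2)]
        Cauchy_theorem_homotopic_loops[OF p(4) assms(1) diff_quot_holomorphic[OF assms(1,2)] assms(3) vp]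
      by auto
    ultimately have "(\<lambda>w. contour_integral g (diff_quot f w)) holomorphic_on ball w r"
      by (rule holomorphic_transform)
    then show ?thesis
      using r(1) holomorphic_on_imp_differentiable_at by (metis centre_in_ball open_ball)
  qed
  then show ?thesis
    by (auto intro!: holomorphic_onI intro: field_differentiable_at_within)
qed

text \<open>Dixon's argument: the integral of \<open>diff_quot k w\<close> over the cycle, as a
  function of \<open>w\<close> in \<open>S\<close>, continues to an entire function that vanishes at
  infinity, so it is zero by Liouville. The choice \<open>k z = f z * (z - w)\<close> then gives the
  claim. The weights allow differences of cycles.\<close>

theorem Cauchy_theorem_homology_cycle:
  fixes c :: "'i \<Rightarrow> complex"
  assumes "open S" "f holomorphic_on S" "finite A"
    and g: "\<And>i. i \<in> A \<Longrightarrow> valid_path (g i)" "\<And>i. i \<in> A \<Longrightarrow> path_image (g i) \<subseteq> S"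
      "\<And>i. i \<in> A \<Longrightarrow> pathfinish (g i) = pathstart (g i)"
    and zero: "\<And>w. w \<notin> S \<Longrightarrow> (\<Sum>i\<in>A. c i * winding_number (g i) w) = 0"
  shows "(\<Sum>i\<in>A. c i * contour_integral (g i) f) = 0"
proof (cases "A = {}")
  case False
  define P where "P = (\<Union>i\<in>A. path_image (g i))"
  have "closed P"
    unfolding P_def using assms(3) g(1) by (intro closed_UN) (auto intro: closed_valid_path_image)
  have wind: "(\<Sum>i\<in>A. c i * contour_integral (g i) (\<lambda>z. 1 / (z - w)))
      = 2 * of_real pi * \<i> * (\<Sum>i\<in>A. c i * winding_number (g i) w)" if "w \<notin> P" for w
    unfolding sum_distrib_left using that g(1)
    by (intro sum.cong) (auto simp: P_def winding_number_valid_path)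
  have dixon: "(\<Sum>i\<in>A. c i * contour_integral (g i) (diff_quot k w)) = 0"
    if k: "k holomorphic_on S" and w: "w \<in> S" for k w
  proof -
    define h where "h w = (if w \<in> S then \<Sum>i\<in>A. c i * contour_integral (g i) (diff_quot k w)
        else \<Sum>i\<in>A. c i * contour_integral (g i) (\<lambda>z. k z / (z - w)))" for w
    \<comment> \<open>On \<open>Z\<close> the coefficient of \<open>k w\<close> is zero, so the two
      formulas defining \<open>h\<close> agree on \<open>S \<inter> Z\<close>. Since the paths lie
      in \<open>S\<close>, the assumption on winding numbers makes \<open>S\<close> and
      \<open>Z\<close> cover the plane.\<close>
    define Z where "Z = {w. w \<notin> P \<and> (\<Sum>i\<in>A. c i * winding_number (g i) w) = 0}"
    have hZ: "h w = (\<Sum>i\<in>A. c i * contour_integral (g i) (\<lambda>z. k z / (z - w)))" if "w \<in> Z" for w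
    proof (cases "w \<in> S")
      case True
      have "h w = (\<Sum>i\<in>A. c i * contour_integral (g i) (\<lambda>z. k z / (z - w))
          - k w * (c i * contour_integral (g i) (\<lambda>z. 1 / (z - w))))"
      proof -
        have "contour_integral (g i) (diff_quot k w) = contour_integral (g i) (\<lambda>z. k z / (z - w))
            - k w * contour_integral (g i) (\<lambda>z. 1 / (z - w))" if "i \<in> A" for i
          using that g(1,2) \<open>w \<in> Z\<close>
          by (intro contour_integral_diff_quot[OF assms(1) k]) (auto simp: Z_def P_def)
        then show ?thesis
          unfolding h_def using True by (simp add: right_diff_distrib mult.left_commute)
      qed
      also have "\<dots> = (\<Sum>i\<in>A. c i * contour_integral (g i) (\<lambda>z. k z / (z - w)))
          - k w * (\<Sum>i\<in>A. c i * contour_integral (g i) (\<lambda>z. 1 / (z - w)))"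
        by (simp add: sum_subtractf sum_distrib_left)
      finally show ?thesis using that wind by (simp add: Z_def)
    qed (simp add: h_def)
    have "open Z"
    proof -
      define N where "N w = (\<Inter>i\<in>A. {z. z \<notin> path_image (g i) \<and> winding_number (g i) z = winding_number (g i) w})" for w
      have "open (N w)" for w
        unfolding N_def using assms(3) g
        by (intro open_INT ballI open_winding_number_levelsets) (auto simp: valid_path_imp_path)
      moreover have "w \<in> N w" "N w \<subseteq> Z" if "w \<in> Z" for w
        using that \<open>A \<noteq> {}\<close> by (auto simp: N_def Z_def P_def)
      ultimately show ?thesis by (meson openI open_contains_ball order_trans)
    qed
    have "S \<union> Z = UNIV"
      using g(2) zero by (auto simp: Z_def P_def)
    moreover have "h holomorphic_on S"
    proof -
      have "(\<lambda>w. \<Sum>i\<in>A. c i * contour_integral (g i) (diff_quot k w)) holomorphic_on S"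
        using g by (intro holomorphic_intros contour_integral_diff_quot_holomorphic assms k) auto
      then show ?thesis by (rule holomorphic_transform) (simp add: h_def)
    qed
    moreover have "h holomorphic_on Z"
    proof -
      have "(\<lambda>w. \<Sum>i\<in>A. c i * contour_integral (g i) (\<lambda>z. k z / (z - w))) holomorphic_on Z"
        using g
        by (intro holomorphic_intros holomorphic_on_subset[OF loop_Cauchy_integral_holomorphic[OF assms(1) k]])
           (auto simp: Z_def P_def)
      then show ?thesis by (rule holomorphic_transform) (simp add: hZ)
    qed
    ultimately have "h holomorphic_on UNIV"
      using holomorphic_on_Un[OF _ _ assms(1) \<open>open Z\<close>, of h] by simp
    moreover have "(h \<longlongrightarrow> 0) at_infinity"
    proof -
      \<comment> \<open>Points far out lie off all paths and have winding number zero, hence belong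
        to \<open>Z\<close>, where \<open>h\<close> is a sum of Cauchy integrals.\<close>
      have "\<forall>\<^sub>F w in at_infinity. \<forall>i\<in>A. w \<notin> path_image (g i) \<and> winding_number (g i) w = 0"
        unfolding eventually_ball_finite_distrib[OF assms(3)]
      proof
        fix i assume i: "i \<in> A"
        then obtain B where "\<forall>z. B \<le> norm z \<longrightarrow> winding_number (g i) z = 0"
          using winding_number_zero_at_infinity g valid_path_imp_path by metis
        moreover obtain R where "path_image (g i) \<subseteq> ball 0 R"
          using i g(1) by (metis bounded_subset_ballD bounded_path_image valid_path_imp_path)
        ultimately show "\<forall>\<^sub>F w in at_infinity. w \<notin> path_image (g i) \<and> winding_number (g i) w = 0"
          unfolding eventually_at_infinity by (intro exI[of _ "max B R"]) auto
      qed
      then have "\<forall>\<^sub>F w in at_infinity. (\<Sum>i\<in>A. c i * contour_integral (g i) (\<lambda>z. k z / (z - w))) = h w"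
        by (rule eventually_mono) (subst hZ, auto simp: Z_def P_def)
      moreover have "((\<lambda>w. \<Sum>i\<in>A. c i * contour_integral (g i) (\<lambda>z. k z / (z - w))) \<longlongrightarrow> 0) at_infinity"
        using g by (intro tendsto_null_sum tendsto_mult_right_zero
            loop_Cauchy_integral_tendsto_0[OF assms(1) k]) auto
      ultimately show ?thesis by (rule Lim_transform_eventually[rotated])
    qed
    ultimately have "h w = 0" by (rule Liouville_weak_0)
    then show ?thesis using w by (simp add: h_def)
  qed
  obtain i where i: "i \<in> A" using False by auto
  obtain w where w: "w \<in> S - P"
  proof -
    \<comment> \<open>If the paths filled \<open>S\<close>, their union would be a nonempty subset
      of the plane that is both open and compact.\<close>
    have "P \<noteq> S"
    proof
      assume "P = S"
      then have "open P" "compact P"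
        using assms g(1) by (auto simp: P_def intro!: compact_UN compact_valid_path_image)
      then have "P = {} \<or> P = UNIV" "P \<noteq> UNIV"
        using \<open>closed P\<close> clopen[of P] not_bounded_UNIV compact_imp_bounded[of P] by auto
      then have "P = {}" by blast
      then show False using i by (auto simp: P_def path_image_def)
    qed
    moreover have "P \<subseteq> S" using g(2) by (auto simp: P_def)
    ultimately show thesis using that by blast
  qed
  \<comment> \<open>The numerator vanishes at \<open>w\<close>, so its difference quotient is
    \<open>f\<close> itself on the paths, which avoid \<open>w\<close>.\<close>
  have "(\<Sum>i\<in>A. c i * contour_integral (g i) f)
      = (\<Sum>i\<in>A. c i * contour_integral (g i) (diff_quot (\<lambda>z. f z * (z - w)) w))"
    using w by (intro sum.cong arg_cong2[where f = "(*)"] contour_integral_cong refl)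
      (auto simp: diff_quot_def P_def)
  also have "\<dots> = 0"
    using w assms(2) by (intro dixon holomorphic_intros) auto
  finally show ?thesis .
qed simp

section \<open>Separation of points by bounded functionals\<close>

definition sublinear :: "('a::real_vector \<Rightarrow> real) \<Rightarrow> bool" where
  "sublinear p \<longleftrightarrow> (\<forall>x y. p (x + y) \<le> p x + p y) \<and> (\<forall>x. \<forall>c>0. p (c *\<^sub>R x) = c * p x)"

lemma sublinearD:
  assumes "sublinear p"
  shows "p (x + y) \<le> p x + p y" "c > 0 \<Longrightarrow> p (c *\<^sub>R x) = c * p x" "p 0 = 0" "- p (- x) \<le> p x"
proof -
  show 1: "p (x + y) \<le> p x + p y" and 2: "c > 0 \<Longrightarrow> p (c *\<^sub>R x) = c * p x" for x y c
    using assms by (auto simp: sublinear_def)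
  show 3: "p 0 = 0" using 2[of 2 0] by simp
  show "- p (- x) \<le> p x" using 1[of x "- x"] 3 by simp
qed

text \<open>\<open>p\<close> pushed down in the direction \<open>y\<close>; a minimal \<open>p\<close> cannot be pushed further.\<close>

definition lowered :: "('a::real_vector \<Rightarrow> real) \<Rightarrow> 'a \<Rightarrow> 'a \<Rightarrow> real" where
  "lowered p y x = (INF t\<in>{0..}. p (x + t *\<^sub>R y) - t * p y)"

text \<open>A lower bound that does not depend on \<open>t\<close>, so the infimum in
  \<open>lowered\<close> is finite. It comes from \<open>t * p y = p (t *\<^sub>R y)\<close> and
  from writing \<open>t *\<^sub>R y\<close> as \<open>(x + t *\<^sub>R y) + (- x)\<close>.\<close>

lemma lowered_bound:
  assumes "sublinear p" "0 \<le> t"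
  shows "- p (- x) \<le> p (x + t *\<^sub>R y) - t * p y"
proof -
  have "t * p y \<le> p (t *\<^sub>R y)"
    using sublinearD[OF assms(1)] assms(2) by (cases "t = 0") auto
  also have "\<dots> \<le> p (x + t *\<^sub>R y) + p (- x)"
    using sublinearD(1)[OF assms(1), of "x + t *\<^sub>R y" "- x"] by simp
  finally show ?thesis by simp
qed

lemma lowered_le:
  assumes "sublinear p" "0 \<le> t"
  shows "lowered p y x \<le> p (x + t *\<^sub>R y) - t * p y"
  unfolding lowered_def
proof (rule cINF_lower)
  show "bdd_below ((\<lambda>t. p (x + t *\<^sub>R y) - t * p y) ` {0..})"
    using lowered_bound[OF assms(1), of _ x y] by (intro bdd_belowI2[where m = "- p (- x)"]) simp
qed (use assms in simp)

lemma lowered_greatest: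
  "(\<And>t. 0 \<le> t \<Longrightarrow> c \<le> p (x + t *\<^sub>R y) - t * p y) \<Longrightarrow> c \<le> lowered p y x"
  unfolding lowered_def by (rule cINF_greatest) simp_all

lemma sublinear_lowered:
  assumes p: "sublinear p"
  shows "sublinear (lowered p y)"
  unfolding sublinear_def
proof (intro conjI allI impI)
  fix x x'
  \<comment> \<open>The two parameters are added; the infima over \<open>t\<close> and
    \<open>t'\<close> are then taken one after the other.\<close>
  have "lowered p y (x + x') \<le> (p (x + t *\<^sub>R y) - t * p y) + (p (x' + t' *\<^sub>R y) - t' * p y)"
    if "0 \<le> t" "0 \<le> t'" for t t'
  proof -
    have "lowered p y (x + x') \<le> p ((x + x') + (t + t') *\<^sub>R y) - (t + t') * p y"
      using that by (intro lowered_le p) auto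
    moreover have "p ((x + x') + (t + t') *\<^sub>R y) \<le> p (x + t *\<^sub>R y) + p (x' + t' *\<^sub>R y)"
      using sublinearD(1)[OF p, of "x + t *\<^sub>R y" "x' + t' *\<^sub>R y"] by (simp add: algebra_simps)
    ultimately show ?thesis by (simp add: algebra_simps)
  qed
  then have "lowered p y (x + x') - (p (x' + t' *\<^sub>R y) - t' * p y) \<le> lowered p y x" if "0 \<le> t'" for t'
    using that by (intro lowered_greatest) (simp add: algebra_simps)
  then have "lowered p y (x + x') - lowered p y x \<le> lowered p y x'"
    by (intro lowered_greatest) (simp add: algebra_simps)
  then show "lowered p y (x + x') \<le> lowered p y x + lowered p y x'" by simp
next
  fix x and c :: real
  \<comment> \<open>This is proved for every positive scale, so that \<open>inverse c\<close> yields
    the reverse inequality.\<close>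
  have ge: "c * lowered p y x \<le> lowered p y (c *\<^sub>R x)" if c: "c > 0" for c x
  proof (rule lowered_greatest)
    fix t :: real assume t: "0 \<le> t"
    have "c * lowered p y x \<le> c * (p (x + (t / c) *\<^sub>R y) - (t / c) * p y)"
      using c t by (intro mult_left_mono lowered_le p) auto
    also have "\<dots> = p (c *\<^sub>R (x + (t / c) *\<^sub>R y)) - t * p y"
      using c by (simp add: sublinearD(2)[OF p] right_diff_distrib)
    also have "c *\<^sub>R (x + (t / c) *\<^sub>R y) = c *\<^sub>R x + t *\<^sub>R y"
      using c by (simp add: scaleR_add_right)
    finally show "c * lowered p y x \<le> p (c *\<^sub>R x + t *\<^sub>R y) - t * p y" .
  qed
  assume c: "c > 0"
  have "inverse c * lowered p y (c *\<^sub>R x) \<le> lowered p y (inverse c *\<^sub>R (c *\<^sub>R x))"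
    using c by (intro ge) auto
  then have "lowered p y (c *\<^sub>R x) \<le> c * lowered p y x"
    using c by (simp add: field_simps)
  then show "lowered p y (c *\<^sub>R x) = c * lowered p y x"
    using ge[OF c, of x] by simp
qed

lemma minimal_sublinear_below:
  assumes p: "sublinear p"
  obtains m where "sublinear m" "m \<le> p" "\<And>q. sublinear q \<Longrightarrow> q \<le> m \<Longrightarrow> q = m"
proof -
  define A where "A = {q. sublinear q \<and> q \<le> p}"
  have "\<exists>m\<in>A. \<forall>q\<in>A. q \<le> m \<longrightarrow> q = m"
  \<comment> \<open>The order is reversed: a maximal element in the sense of Zorn is a minimal
    functional.\<close>
  proof (rule predicate_Zorn[where P = "\<lambda>a b. b \<le> a"])
    show "partial_order_on A (relation_of (\<lambda>a b. b \<le> a) A)"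
      by (rule partial_order_on_relation_ofI) auto
    fix C assume "C \<in> Chains (relation_of (\<lambda>a b. b \<le> a) A)"
    then have C: "C \<subseteq> A" "\<And>q r. q \<in> C \<Longrightarrow> r \<in> C \<Longrightarrow> q \<le> r \<or> r \<le> q"
      by (auto simp: Chains_def relation_of_def)
    show "\<exists>u\<in>A. \<forall>a\<in>C. u \<le> a"
    proof (cases "C = {}")
      case True
      then show ?thesis using p by (auto simp: A_def)
    next
      case False
      define u where "u x = (INF q\<in>C. q x)" for x
      \<comment> \<open>An upper bound for a sublinear functional at \<open>- x\<close> is a lower
        bound at \<open>x\<close>, so the pointwise infimum of the chain is finite.\<close>
      have below: "- p (- x) \<le> q x" if "q \<in> C" for q x
      proof -
        have "q (- x) \<le> p (- x)" "sublinear q" using that C(1) by (auto simp: A_def le_fun_def)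
        then show ?thesis using sublinearD(4)[of q x] by linarith
      qed
      have le: "u x \<le> q x" if "q \<in> C" for q x
        unfolding u_def using that below
        by (intro cINF_lower[of _ _ q, OF bdd_belowI2[where m = "- p (- x)"]])
      have greatest: "c \<le> u x" if "\<And>q. q \<in> C \<Longrightarrow> c \<le> q x" for c x
        unfolding u_def using that False by (intro cINF_greatest)
      have sub: "sublinear q" if "q \<in> C" for q using that C(1) by (auto simp: A_def)
      have "sublinear u"
        unfolding sublinear_def
      proof (intro conjI allI impI)
        fix x y
        \<comment> \<open>Here the chain property enters: the smaller of \<open>q\<close> and
          \<open>r\<close> can be used at both arguments.\<close>
        have "u (x + y) \<le> q x + r y" if qr: "q \<in> C" "r \<in> C" for q r
          using C(2)[OF qr]
        proof
          assume "q \<le> r"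
          then have "q x + q y \<le> q x + r y" by (auto simp: le_fun_def)
          then show ?thesis
            using le[OF qr(1), of "x + y"] sublinearD(1)[OF sub[OF qr(1)], of x y] by linarith
        next
          assume "r \<le> q"
          then have "r x + r y \<le> q x + r y" by (auto simp: le_fun_def)
          then show ?thesis
            using le[OF qr(2), of "x + y"] sublinearD(1)[OF sub[OF qr(2)], of x y] by linarith
        qed
        then have "u (x + y) - r y \<le> u x" if "r \<in> C" for r
          using that by (intro greatest) (simp add: algebra_simps)
        then have "u (x + y) - u x \<le> u y"
          by (intro greatest) (simp add: algebra_simps)
        then show "u (x + y) \<le> u x + u y" by simp
      next
        fix x and c :: real
        have ge: "c * u x \<le> u (c *\<^sub>R x)" if c: "c > 0" for c x
        proof (rule greatest)
          fix q assume q: "q \<in> C"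
          show "c * u x \<le> q (c *\<^sub>R x)"
            using mult_left_mono[OF le[OF q, of x], of c] c sublinearD(2)[OF sub[OF q] c] by simp
        qed
        assume c: "c > 0"
        have "inverse c * u (c *\<^sub>R x) \<le> u (inverse c *\<^sub>R (c *\<^sub>R x))"
          using c by (intro ge) auto
        then have "u (c *\<^sub>R x) \<le> c * u x" using c by (simp add: field_simps)
        then show "u (c *\<^sub>R x) = c * u x" using ge[OF c, of x] by simp
      qed
      moreover have "u \<le> p"
      proof -
        obtain q where "q \<in> C" using False by auto
        then show ?thesis using le C(1) unfolding A_def le_fun_def by (blast intro: order_trans)
      qed
      ultimately show ?thesis using le by (intro bexI[of _ u]) (auto simp: A_def le_fun_def)
    qed
  qed
  then obtain m where m: "sublinear m" "m \<le> p" "\<And>q. sublinear q \<Longrightarrow> q \<le> p \<Longrightarrow> q \<le> m \<Longrightarrow> q = m"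
    by (auto simp: A_def)
  show thesis
    using m(3) order_trans[OF _ m(2)] by (intro that[OF m(1,2)]) auto
qed

text \<open>A minimal \<open>p\<close> equals \<open>lowered p y\<close> for every \<open>y\<close>.
  The parameter 1 then gives \<open>p x \<le> p (x + y) - p y\<close>, the missing half of
  additivity, and oddness extends homogeneity to negative scalars.\<close>

lemma minimal_sublinear_linear:
  assumes p: "sublinear p" and min: "\<And>q. sublinear q \<Longrightarrow> q \<le> p \<Longrightarrow> q = p"
  shows "linear p"
proof -
  have eq: "lowered p y = p" for y
    using lowered_le[OF p, of 0] by (intro min sublinear_lowered p) (auto simp: le_fun_def)
  have add: "p (x + y) = p x + p y" for x y
    using lowered_le[OF p, of 1 y x] sublinearD(1)[OF p, of x y] by (simp add: eq)
  have neg: "p (- x) = - p x" for x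
    using add[of x "- x"] sublinearD(3)[OF p] by simp
  have "p (c *\<^sub>R x) = c * p x" for c x
  proof (cases c "0 :: real" rule: linorder_cases)
    case less
    then show ?thesis using sublinearD(2)[OF p, of "- c" x] neg[of "c *\<^sub>R x"] by simp
  qed (auto simp: sublinearD[OF p])
  then show ?thesis using add by (intro linearI) auto
qed

text \<open>A consequence of Hahn-Banach, obtained from a minimal sublinear functional. Starting
  from \<open>lowered norm x\<close> instead of the norm fixes the sign at \<open>x\<close>: its
  value at \<open>- x\<close> is at most \<open>norm (- x + x) - norm x = - norm x\<close>.\<close>

theorem bounded_linear_functional_separating:
  fixes x :: "'a::real_normed_vector"
  assumes "x \<noteq> 0"
  obtains \<Lambda> :: "'a \<Rightarrow> real" where "bounded_linear \<Lambda>" "\<Lambda> x \<noteq> 0"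
proof -
  have norm: "sublinear (norm :: 'a \<Rightarrow> real)"
    by (auto simp: sublinear_def norm_triangle_ineq)
  obtain m where m: "sublinear m" "m \<le> lowered norm x" "\<And>q. sublinear q \<Longrightarrow> q \<le> m \<Longrightarrow> q = m"
    using minimal_sublinear_below[OF sublinear_lowered[OF norm]] by metis
  have lin: "linear m" by (rule minimal_sublinear_linear[OF m(1,3)])
  have le: "m y \<le> norm y" for y
    using lowered_le[OF norm, of 0 x y] m(2) by (auto simp: le_fun_def intro: order_trans)
  have "\<bar>m y\<bar> \<le> norm y * 1" for y
    using le[of y] le[of "- y"] linear_neg[OF lin, of y] by auto
  then have "bounded_linear m"
    using lin by (intro bounded_linear_intro[where K = 1]) (auto simp: linear_add linear_scale)
  moreover have "m (- x) \<le> - norm x"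
    using lowered_le[OF norm, of 1 x "- x"] m(2) by (fastforce simp: le_fun_def intro: order_trans)
  then have "m x \<noteq> 0" using assms linear_neg[OF lin, of x] by auto
  ultimately show thesis using that by blast
qed

section \<open>Holomorphic functions into a complexified Banach space\<close>

definition cx_scale :: "complex \<Rightarrow> 'a::real_vector \<times> 'a \<Rightarrow> 'a \<times> 'a" where
  "cx_scale w p = (Re w *\<^sub>R fst p - Im w *\<^sub>R snd p, Re w *\<^sub>R snd p + Im w *\<^sub>R fst p)"

definition cx_conj :: "'a::real_vector \<times> 'a \<Rightarrow> 'a \<times> 'a" where
  "cx_conj p = (fst p, - snd p)"

text \<open>The complex bilinear extension of a real bilinear \<open>m\<close>, with
  \<open>(a, b)\<close> standing for a + ib.\<close>

definition cx_bilinear :: "('a \<Rightarrow> 'b \<Rightarrow> 'c::real_vector) \<Rightarrow> 'a \<times> 'a \<Rightarrow> 'b \<times> 'b \<Rightarrow> 'c \<times> 'c" where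
  "cx_bilinear m p q = (m (fst p) (fst q) - m (snd p) (snd q), m (fst p) (snd q) + m (snd p) (fst q))"

lemma bounded_bilinear_zero: "bounded_bilinear (\<lambda>x y. 0)"
  by unfold_locales (auto intro: exI[of _ 0])

lemma bounded_bilinear_plus:
  assumes "bounded_bilinear f" "bounded_bilinear g"
  shows "bounded_bilinear (\<lambda>x y. f x y + g x y)"
proof -
  interpret f: bounded_bilinear f by fact
  interpret g: bounded_bilinear g by fact
  obtain K L where K: "\<And>x y. norm (f x y) \<le> norm x * norm y * K"
    and L: "\<And>x y. norm (g x y) \<le> norm x * norm y * L"
    using f.bounded g.bounded by metis
  show ?thesis
  proof
    have "norm (f x y + g x y) \<le> norm x * norm y * (K + L)" for x y
      using norm_triangle_ineq[of "f x y" "g x y"] K[of x y] L[of x y] by (simp add: algebra_simps)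
    then show "\<exists>K. \<forall>x y. norm (f x y + g x y) \<le> norm x * norm y * K" by blast
  qed (simp_all add: f.bilinear_simps g.bilinear_simps f.scaleR_left f.scaleR_right g.scaleR_left
        g.scaleR_right scaleR_add_right)
qed

lemma bounded_bilinear_linear_comp:
  assumes "bounded_linear h" "bounded_bilinear f"
  shows "bounded_bilinear (\<lambda>x y. h (f x y))"
proof -
  interpret f: bounded_bilinear f by fact
  interpret h: bounded_linear h by fact
  obtain K where K: "\<And>x. norm (h x) \<le> norm x * K" "0 \<le> K"
    using h.nonneg_bounded by metis
  obtain L where L: "\<And>x y. norm (f x y) \<le> norm x * norm y * L"
    using f.bounded by metis
  show ?thesis
  proof
    have "norm (h (f x y)) \<le> norm x * norm y * (L * K)" for x y
      using order_trans[OF K(1)[of "f x y"] mult_right_mono[OF L K(2)]] by (simp add: mult.assoc)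
    then show "\<exists>K. \<forall>x y. norm (h (f x y)) \<le> norm x * norm y * K" by blast
  qed (simp_all add: f.add_left f.add_right f.scaleR_left f.scaleR_right h.add h.scaleR)
qed

lemma bounded_bilinear_sum:
  "finite A \<Longrightarrow> (\<And>i. i \<in> A \<Longrightarrow> bounded_bilinear (f i)) \<Longrightarrow> bounded_bilinear (\<lambda>x y. \<Sum>i\<in>A. f i x y)"
  by (induction rule: finite_induct) (simp_all add: bounded_bilinear_zero bounded_bilinear_plus)

lemma bounded_bilinear_cx_scale: "bounded_bilinear (cx_scale :: complex \<Rightarrow> 'a::real_normed_vector \<times> 'a \<Rightarrow> _)"
proof -
  have 1: "bounded_bilinear (\<lambda>w (p :: 'a \<times> 'a). Re w *\<^sub>R p)"
    by (rule bounded_bilinear.comp1[OF bounded_bilinear_scaleR bounded_linear_Re])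
  have 2: "bounded_bilinear (\<lambda>w (p :: 'a \<times> 'a). (\<lambda>q. (- snd q, fst q)) (Im w *\<^sub>R p))"
    by (rule bounded_bilinear_linear_comp[OF _ bounded_bilinear.comp1[OF bounded_bilinear_scaleR bounded_linear_Im]])
       (intro bounded_linear_Pair bounded_linear_minus bounded_linear_fst bounded_linear_snd)
  have "cx_scale = (\<lambda>w (p :: 'a \<times> 'a). Re w *\<^sub>R p + (\<lambda>q. (- snd q, fst q)) (Im w *\<^sub>R p))"
    by (simp add: cx_scale_def fun_eq_iff prod_eq_iff)
  then show ?thesis
    using bounded_bilinear_plus[OF 1 2] by simp
qed

lemma bounded_bilinear_cx_bilinear:
  assumes "bounded_bilinear m"
  shows "bounded_bilinear (cx_bilinear m)"
proof -
  have comp: "bounded_bilinear (\<lambda>p q. h (m (f p) (g q)))"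
    if "bounded_linear h" "bounded_linear f" "bounded_linear g" for h f g
    by (rule bounded_bilinear_linear_comp[OF that(1) bounded_bilinear.comp[OF assms that(2,3)]])
  have l: "bounded_linear (\<lambda>x. (x, 0))" "bounded_linear (\<lambda>x. (0, x))" "bounded_linear (\<lambda>x. (- x, 0))"
    by (intro bounded_linear_Pair bounded_linear_ident bounded_linear_zero bounded_linear_minus)+
  show ?thesis
    using bounded_bilinear_plus[OF
        bounded_bilinear_plus[OF comp[OF l(1) bounded_linear_fst bounded_linear_fst]
          comp[OF l(3) bounded_linear_snd bounded_linear_snd]]
        bounded_bilinear_plus[OF comp[OF l(2) bounded_linear_fst bounded_linear_snd]
          comp[OF l(2) bounded_linear_snd bounded_linear_fst]]]
    by (simp add: cx_bilinear_def[abs_def])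
qed

lemma cx_scale_scale: "cx_scale w (cx_scale w' p) = cx_scale (w * w') p"
  by (simp add: cx_scale_def algebra_simps)

lemma cx_bilinear_scale:
  assumes "bounded_bilinear m"
  shows "cx_bilinear m (cx_scale w p) q = cx_scale w (cx_bilinear m p q)"
    "cx_bilinear m p (cx_scale w q) = cx_scale w (cx_bilinear m p q)"
  using assms
  by (simp_all add: cx_bilinear_def cx_scale_def bounded_bilinear.diff_left bounded_bilinear.diff_right
      bounded_bilinear.add_left bounded_bilinear.add_right bounded_bilinear.scaleR_left
      bounded_bilinear.scaleR_right algebra_simps)

lemma cx_bilinear_conj:
  assumes "bounded_bilinear m"
  shows "cx_bilinear m (cx_conj p) (cx_conj q) = cx_conj (cx_bilinear m p q)"
  using assms
  by (simp add: cx_bilinear_def cx_conj_def bounded_bilinear.minus_left bounded_bilinear.minus_right)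

text \<open>A pair \<open>(a, b)\<close> of functions into \<open>X\<close> is read as the function \<open>a + \<i>b\<close> into the
  complexification of \<open>X\<close>.\<close>

definition cx_holomorphic :: "complex set \<Rightarrow> (complex \<Rightarrow> 'a::real_normed_vector \<times> 'a) \<Rightarrow> bool" where
  "cx_holomorphic S f \<longleftrightarrow> (\<exists>f'. continuous_on S f' \<and>
     (\<forall>z\<in>S. (f has_derivative (\<lambda>h. cx_scale h (f' z))) (at z)))"

lemma cx_holomorphicI:
  "continuous_on S f' \<Longrightarrow> (\<And>z. z \<in> S \<Longrightarrow> (f has_derivative (\<lambda>h. cx_scale h (f' z))) (at z))
    \<Longrightarrow> cx_holomorphic S f"
  unfolding cx_holomorphic_def by blast

lemma cx_holomorphicE:
  assumes "cx_holomorphic S f"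
  obtains f' where "continuous_on S f'" "\<And>z. z \<in> S \<Longrightarrow> (f has_derivative (\<lambda>h. cx_scale h (f' z))) (at z)"
  using assms unfolding cx_holomorphic_def by blast

lemma cx_holomorphic_continuous:
  assumes "cx_holomorphic S f"
  shows "continuous_on S f"
proof -
  obtain f' where "\<And>z. z \<in> S \<Longrightarrow> (f has_derivative (\<lambda>h. cx_scale h (f' z))) (at z)"
    using cx_holomorphicE[OF assms] by blast
  then show ?thesis
    by (meson continuous_at_imp_continuous_on has_derivative_continuous)
qed

lemma cx_holomorphic_subset: "cx_holomorphic S f \<Longrightarrow> T \<subseteq> S \<Longrightarrow> cx_holomorphic T f"
  unfolding cx_holomorphic_def by (meson continuous_on_subset subsetD)

lemma cx_holomorphic_const: "cx_holomorphic S (\<lambda>z. p)"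
proof (rule cx_holomorphicI[where f' = "\<lambda>z. 0"])
  show "((\<lambda>z. p) has_derivative (\<lambda>h. cx_scale h 0)) (at z)" for z
    by (simp add: cx_scale_def flip: zero_prod_def)
qed auto

lemma cx_holomorphic_cx_scale: "cx_holomorphic S (\<lambda>z. cx_scale z p)"
proof (rule cx_holomorphicI[where f' = "\<lambda>z. p"])
  show "((\<lambda>z. cx_scale z p) has_derivative (\<lambda>h. cx_scale h p)) (at z)" for z
    by (intro bounded_linear_imp_has_derivative bounded_bilinear.bounded_linear_left
          bounded_bilinear_cx_scale)
qed auto

lemma cx_holomorphic_add:
  assumes "cx_holomorphic S f" "cx_holomorphic S g"
  shows "cx_holomorphic S (\<lambda>z. f z + g z)"
proof -
  obtain f' where f': "continuous_on S f'" "\<And>z. z \<in> S \<Longrightarrow> (f has_derivative (\<lambda>h. cx_scale h (f' z))) (at z)"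
    using cx_holomorphicE[OF assms(1)] by blast
  obtain g' where g': "continuous_on S g'" "\<And>z. z \<in> S \<Longrightarrow> (g has_derivative (\<lambda>h. cx_scale h (g' z))) (at z)"
    using cx_holomorphicE[OF assms(2)] by blast
  show ?thesis
  proof (rule cx_holomorphicI)
    show "continuous_on S (\<lambda>z. f' z + g' z)" by (intro continuous_intros f' g')
    show "((\<lambda>z. f z + g z) has_derivative (\<lambda>h. cx_scale h (f' z + g' z))) (at z)" if "z \<in> S" for z
      using has_derivative_add[OF f'(2) g'(2), OF that that]
      by (simp add: bounded_bilinear.add_right[OF bounded_bilinear_cx_scale])
  qed
qed

lemma cx_holomorphic_map:
  assumes "bounded_linear L" "cx_holomorphic S f"
  shows "cx_holomorphic S (\<lambda>z. map_prod L L (f z))"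
proof -
  obtain f' where f': "continuous_on S f'" "\<And>z. z \<in> S \<Longrightarrow> (f has_derivative (\<lambda>h. cx_scale h (f' z))) (at z)"
    using cx_holomorphicE[OF assms(2)] by blast
  have L: "bounded_linear (map_prod L L)"
    unfolding map_prod_def split_beta using assms(1)
    by (intro bounded_linear_Pair bounded_linear_compose[OF assms(1)] bounded_linear_fst bounded_linear_snd)
  show ?thesis
  proof (rule cx_holomorphicI)
    show "continuous_on S (\<lambda>z. map_prod L L (f' z))"
      by (intro bounded_linear.continuous_on[OF L] f')
    have "map_prod L L (cx_scale h p) = cx_scale h (map_prod L L p)" for h p
      using assms(1)[THEN bounded_linear.linear]
      by (simp add: cx_scale_def map_prod_def split_beta linear_add linear_diff linear_scale)
    then show "((\<lambda>z. map_prod L L (f z)) has_derivative (\<lambda>h. cx_scale h (map_prod L L (f' z)))) (at z)"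
      if "z \<in> S" for z
      using bounded_linear.has_derivative[OF L f'(2)[OF that]] by simp
  qed
qed

lemma cx_holomorphic_bilinear:
  assumes m: "bounded_bilinear m" and "cx_holomorphic S f" "cx_holomorphic S g"
  shows "cx_holomorphic S (\<lambda>z. cx_bilinear m (f z) (g z))"
proof -
  note B = bounded_bilinear_cx_bilinear[OF m]
  obtain f' where f': "continuous_on S f'" "\<And>z. z \<in> S \<Longrightarrow> (f has_derivative (\<lambda>h. cx_scale h (f' z))) (at z)"
    using cx_holomorphicE[OF assms(2)] by blast
  obtain g' where g': "continuous_on S g'" "\<And>z. z \<in> S \<Longrightarrow> (g has_derivative (\<lambda>h. cx_scale h (g' z))) (at z)"
    using cx_holomorphicE[OF assms(3)] by blast
  show ?thesis
  proof (rule cx_holomorphicI)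
    show "continuous_on S (\<lambda>z. cx_bilinear m (f z) (g' z) + cx_bilinear m (f' z) (g z))"
      by (intro continuous_on_add bounded_bilinear.continuous_on[OF B] f' g' cx_holomorphic_continuous assms)
    show "((\<lambda>z. cx_bilinear m (f z) (g z)) has_derivative
        (\<lambda>h. cx_scale h (cx_bilinear m (f z) (g' z) + cx_bilinear m (f' z) (g z)))) (at z)"
      if "z \<in> S" for z
      using bounded_bilinear.FDERIV[OF B f'(2) g'(2), OF that that]
      by (simp add: cx_bilinear_scale[OF m] bounded_bilinear.add_right[OF bounded_bilinear_cx_scale])
  qed
qed

lemma cx_holomorphic_imp_holomorphic:
  fixes f :: "complex \<Rightarrow> real \<times> real"
  assumes "cx_holomorphic S f"
  shows "(\<lambda>z. Complex (fst (f z)) (snd (f z))) holomorphic_on S"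
proof -
  obtain f' where f': "\<And>z. z \<in> S \<Longrightarrow> (f has_derivative (\<lambda>h. cx_scale h (f' z))) (at z)"
    using cx_holomorphicE[OF assms] by blast
  have L: "bounded_linear (\<lambda>p. Complex (fst p) (snd p))"
    unfolding Complex_eq
    by (intro bounded_linear_add bounded_linear_const_mult bounded_linear_compose[OF bounded_linear_of_real]
        bounded_linear_fst bounded_linear_snd)
  have "((\<lambda>z. Complex (fst (f z)) (snd (f z))) has_field_derivative Complex (fst (f' z)) (snd (f' z))) (at z)"
    if "z \<in> S" for z
    unfolding has_field_derivative_def
    using bounded_linear.has_derivative[OF L f'[OF that]]
    by (rule has_derivative_eq_rhs) (auto simp: cx_scale_def complex_eq_iff fun_eq_iff)
  then show ?thesis
    by (meson field_differentiable_at_within field_differentiable_def holomorphic_onI)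
qed

text \<open>The primitive is the integral of \<open>f\<close> along the segment from the centre.
  Because the derivative of \<open>f\<close> is continuous, it can be differentiated under the
  integral sign, without a Goursat argument for triangles.\<close>

lemma cx_holomorphic_primitive:
  fixes f :: "complex \<Rightarrow> 'a::banach \<times> 'a"
  assumes f: "cx_holomorphic (ball z0 r) f"
  obtains F where "\<And>z. z \<in> ball z0 r \<Longrightarrow> (F has_derivative (\<lambda>h. cx_scale h (f z))) (at z)"
proof -
  interpret cs: bounded_bilinear "cx_scale :: complex \<Rightarrow> 'a \<times> 'a \<Rightarrow> _"
    by (rule bounded_bilinear_cx_scale)
  obtain f' where f': "continuous_on (ball z0 r) f'"
    "\<And>z. z \<in> ball z0 r \<Longrightarrow> (f has_derivative (\<lambda>h. cx_scale h (f' z))) (at z)"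
    using cx_holomorphicE[OF f] by blast
  define q where "q z t = z0 + of_real t * (z - z0)" for z and t :: real
  have q_in: "q z t \<in> ball z0 r" if "z \<in> ball z0 r" "t \<in> {0..1}" for z t
  proof -
    have "norm (of_real t * (z - z0)) \<le> norm (z - z0)"
      using that(2) by (simp add: norm_mult mult_left_le_one_le)
    then show ?thesis using that(1) by (simp add: q_def dist_norm norm_minus_commute)
  qed
  define G where "G z t = cx_scale (z - z0) (f (q z t))" for z t
  \<comment> \<open>\<open>M z t\<close> plays two roles: it is the coefficient of \<open>h\<close>
    in the derivative of \<open>G z t\<close> with respect to \<open>z\<close>, and it is the
    derivative of \<open>t *\<^sub>R f (q z t)\<close> with respect to \<open>t\<close>. Its
    integral over the unit interval is therefore \<open>f z\<close>.\<close>
  define M where "M z t = f (q z t) + cx_scale (of_real t * (z - z0)) (f' (q z t))" for z t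
  have cont_q: "continuous_on (ball z0 r \<times> {0..1}) (\<lambda>p. q (fst p) (snd p))"
    unfolding q_def by (intro continuous_intros)
  have cont_comp: "continuous_on (ball z0 r \<times> {0..1}) (\<lambda>p. k (q (fst p) (snd p)))"
    if "continuous_on (ball z0 r) k" for k :: "complex \<Rightarrow> 'a \<times> 'a"
    by (rule continuous_on_compose2[OF that cont_q]) (auto intro!: q_in)
  have contM: "continuous_on (ball z0 r \<times> {0..1}) (\<lambda>p. M (fst p) (snd p))"
    unfolding M_def
    by (intro continuous_intros cs.continuous_on cont_comp cx_holomorphic_continuous f f')
  have cont_line: "continuous_on {0..1} (\<lambda>t. k (q z t))"
    if "continuous_on (ball z0 r) k" "z \<in> ball z0 r" for k :: "complex \<Rightarrow> 'a \<times> 'a" and z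
    by (rule continuous_on_compose2[OF that(1)])
       (use that(2) q_in in \<open>auto simp: q_def intro!: continuous_intros\<close>)
  have der: "((\<lambda>z. integral (cbox 0 1) (G z)) has_derivative (\<lambda>h. cx_scale h (f z))) (at z)"
    if z: "z \<in> ball z0 r" for z
  proof -
    have "((\<lambda>z. integral (cbox 0 1) (G z)) has_derivative integral (cbox 0 1) (\<lambda>t. cs.prod_left (M z t)))
        (at z within ball z0 r)"
    proof (rule leibniz_rule[OF _ _ _ z convex_ball])
      fix z t assume z: "z \<in> ball z0 r" and t: "t \<in> cbox (0::real) 1"
      have q': "((\<lambda>z. q z t) has_derivative (\<lambda>h. of_real t * h)) (at z)"
        unfolding q_def by (auto intro!: derivative_eq_intros)
      have "((\<lambda>z. f (q z t)) has_derivative (\<lambda>h. cx_scale (of_real t * h) (f' (q z t)))) (at z)"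
        using has_derivative_compose[OF q' f'(2)[OF q_in[OF z]]] t by simp
      moreover have "((\<lambda>z. z - z0) has_derivative (\<lambda>h. h)) (at z)"
        by (auto intro!: derivative_eq_intros)
      ultimately have "((\<lambda>z. G z t) has_derivative
          (\<lambda>h. cx_scale (z - z0) (cx_scale (of_real t * h) (f' (q z t))) + cx_scale h (f (q z t)))) (at z)"
        unfolding G_def by (intro cs.FDERIV)
      then have "((\<lambda>z. G z t) has_derivative cs.prod_left (M z t)) (at z)"
        by (rule has_derivative_eq_rhs)
           (simp add: fun_eq_iff M_def cs.add_right cx_scale_scale ac_simps)
      then show "((\<lambda>z. G z t) has_derivative cs.prod_left (M z t)) (at z within ball z0 r)"
        by (rule has_derivative_at_withinI)
    next
      fix z assume "z \<in> ball z0 r"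
      then have "continuous_on {0..1} (G z)"
        unfolding G_def by (intro cs.continuous_on continuous_intros cont_line cx_holomorphic_continuous f)
      then show "G z integrable_on cbox 0 1" by (simp add: integrable_continuous_interval)
    next
      have "continuous_on (ball z0 r \<times> {0..1}) (\<lambda>p. cs.prod_left (M (fst p) (snd p)))"
        by (intro bounded_linear.continuous_on[OF cs.bounded_linear_prod_left] contM)
      then show "continuous_on (ball z0 r \<times> cbox 0 1) (\<lambda>(z, t). cs.prod_left (M z t))"
        by (simp add: split_beta)
    qed
    moreover have "blinfun_apply (integral (cbox 0 1) (\<lambda>t. cs.prod_left (M z t))) h = cx_scale h (f z)" for h
    proof -
      have contMz: "continuous_on {0..1} (M z)"
        unfolding M_def using z
        by (intro continuous_intros cs.continuous_on cont_line cx_holomorphic_continuous f f')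
      then have "(\<lambda>t. cs.prod_left (M z t)) integrable_on cbox 0 1"
        by (intro integrable_continuous bounded_linear.continuous_on[OF cs.bounded_linear_prod_left]) simp
      then have "blinfun_apply (integral (cbox 0 1) (\<lambda>t. cs.prod_left (M z t))) h
          = integral (cbox 0 1) (\<lambda>t. cx_scale h (M z t))"
        by (simp add: blinfun_apply_integral)
      also have "((\<lambda>t. cx_scale h (M z t)) has_integral
          (cx_scale h (1 *\<^sub>R f (q z 1)) - cx_scale h (0 *\<^sub>R f (q z 0)))) {0..1}"
      proof (rule fundamental_theorem_of_calculus)
        fix t :: real assume t: "t \<in> {0..1}"
        have "((\<lambda>t. q z t) has_derivative (\<lambda>s. of_real s * (z - z0))) (at t)"
          unfolding q_def by (auto intro!: derivative_eq_intros)
        from has_derivative_compose[OF this f'(2)[OF q_in[OF z t]]]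
        have "((\<lambda>t. f (q z t)) has_derivative (\<lambda>s. cx_scale (of_real s * (z - z0)) (f' (q z t)))) (at t)"
          by simp
        then have "((\<lambda>t. f (q z t)) has_vector_derivative cx_scale (z - z0) (f' (q z t))) (at t)"
          unfolding has_vector_derivative_def
          by (rule has_derivative_eq_rhs) (simp add: fun_eq_iff cx_scale_def algebra_simps)
        then have "((\<lambda>t. t *\<^sub>R f (q z t)) has_vector_derivative M z t) (at t)"
          unfolding M_def
          by (rule has_vector_derivative_eq_rhs[OF has_vector_derivative_scaleR[OF DERIV_ident]])
             (simp add: cx_scale_def algebra_simps)
        then have "((\<lambda>t. cx_scale h (t *\<^sub>R f (q z t))) has_vector_derivative cx_scale h (M z t)) (at t)"
          by (rule bounded_linear.has_vector_derivative[OF cs.bounded_linear_right])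
        then show "((\<lambda>t. cx_scale h (t *\<^sub>R f (q z t))) has_vector_derivative cx_scale h (M z t))
            (at t within {0..1})"
          by (rule has_vector_derivative_at_within)
      qed simp
      then have "integral (cbox 0 1) (\<lambda>t. cx_scale h (M z t)) = cx_scale h (f z)"
        by (simp add: integral_unique q_def cs.zero_right)
      finally show ?thesis .
    qed
    then have "blinfun_apply (integral (cbox 0 1) (\<lambda>t. cs.prod_left (M z t))) = (\<lambda>h. cx_scale h (f z))"
      by (rule ext)
    ultimately show ?thesis
      using z by (simp add: at_within_open[of z "ball z0 r"])
  qed
  show thesis by (rule that) (rule der)
qed

section \<open>Contour integrals in a complexified Banach space\<close>

definition cx_contour_integral :: "(real \<Rightarrow> complex) \<Rightarrow> (complex \<Rightarrow> 'a::banach \<times> 'a) \<Rightarrow> 'a \<times> 'a" where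
  "cx_contour_integral g f =
     integral {0..1} (\<lambda>t. cx_scale (vector_derivative g (at t within {0..1})) (f (g t)))"

lemma valid_path_vector_derivativeE:
  assumes "valid_path g"
  obtains k where "finite k" "\<And>t. t \<in> {0..1} - k \<Longrightarrow>
    (g has_vector_derivative vector_derivative g (at t within {0..1})) (at t)"
proof -
  obtain k where k1: "finite k" "g C1_differentiable_on {0..1} - k"
    using assms by (auto simp: valid_path_def piecewise_C1_differentiable_on_def)
  then obtain D where "\<And>t. t \<in> {0..1} - k \<Longrightarrow> (g has_vector_derivative D t) (at t)"
    unfolding C1_differentiable_on_def by blast
  note k = k1(1) this
  have "vector_derivative g (at t within {0..1}) = D t" if "t \<in> {0..1} - k" for t
    using k(2)[OF that] that by (intro vector_derivative_at_within_ivl) auto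
  then show thesis using k by (intro that[of k]) auto
qed

text \<open>The derivative of a piecewise continuously differentiable path may be unbounded near the
  exceptional points, so continuity of the integrand along the path would not suffice.\<close>

lemma cx_contour_integrable:
  fixes f :: "complex \<Rightarrow> 'a::banach \<times> 'a"
  assumes S: "open S" and f: "cx_holomorphic S f" and g: "valid_path g" "path_image g \<subseteq> S"
  shows "(\<lambda>t. cx_scale (vector_derivative g (at t within {0..1})) (f (g t))) integrable_on {0..1}"
proof -
  obtain k where k: "finite k" "\<And>t. t \<in> {0..1} - k \<Longrightarrow>
      (g has_vector_derivative vector_derivative g (at t within {0..1})) (at t)"
    using valid_path_vector_derivativeE[OF g(1)] by blast
  have cont: "continuous_on {0..1} g"
    using g(1) by (simp add: valid_path_def piecewise_C1_differentiable_on_def)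
  have "\<exists>d>0. \<forall>u v. x \<in> cbox u v \<and> cbox u v \<subseteq> ball x d \<and> cbox u v \<subseteq> cbox 0 1 \<longrightarrow>
      (\<lambda>t. cx_scale (vector_derivative g (at t within {0..1})) (f (g t))) integrable_on cbox u v"
    if x: "x \<in> cbox 0 1" for x
  proof -
    have "g x \<in> S" using x g(2) by (auto simp: path_image_def)
    then obtain r where r: "r > 0" "ball (g x) r \<subseteq> S" using S open_contains_ball by blast
    obtain F where F: "\<And>z. z \<in> ball (g x) r \<Longrightarrow> (F has_derivative (\<lambda>h. cx_scale h (f z))) (at z)"
      using cx_holomorphic_primitive[OF cx_holomorphic_subset[OF f r(2)]] by blast
    obtain d where d: "d > 0" "\<And>t. t \<in> {0..1} \<Longrightarrow> dist t x < d \<Longrightarrow> dist (g t) (g x) < r"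
      using cont x r(1) unfolding continuous_on_iff by (metis box_real(2))
    show ?thesis
    proof (intro exI[of _ d] conjI allI impI d(1))
      fix u v assume uv: "x \<in> cbox u v \<and> cbox u v \<subseteq> ball x d \<and> cbox u v \<subseteq> cbox 0 1"
      then have uv': "u \<le> v" "{u..v} \<subseteq> {0..1}" by auto
      have in_ball: "g t \<in> ball (g x) r" if "t \<in> {u..v}" for t
        using d(2)[of t] uv that by (auto simp: dist_commute)
      \<comment> \<open>The primitive replaces a bound on the derivative of \<open>g\<close>: this
        form of the fundamental theorem asks for continuity of \<open>F\<close> along the path and
        for the derivative off a finite set.\<close>
      have "((\<lambda>t. cx_scale (vector_derivative g (at t within {0..1})) (f (g t))) has_integral
          (F (g v) - F (g u))) {u..v}"
      proof (rule fundamental_theorem_of_calculus_strong[OF k(1) uv'(1)])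
        fix t assume t: "t \<in> {u..v} - k"
        have "((F \<circ> g) has_vector_derivative
            (\<lambda>h. cx_scale h (f (g t))) (vector_derivative g (at t within {0..1}))) (at t)"
          using t uv'(2)
          by (intro vector_derivative_diff_chain_within[OF k(2) has_derivative_at_withinI[OF F[OF in_ball]]]) auto
        then show "((\<lambda>t. F (g t)) has_vector_derivative
            cx_scale (vector_derivative g (at t within {0..1})) (f (g t))) (at t)"
          by (simp add: o_def)
      next
        have "continuous_on (ball (g x) r) F"
          using F by (meson continuous_at_imp_continuous_on has_derivative_continuous)
        then show "continuous_on {u..v} (\<lambda>t. F (g t))"
          by (rule continuous_on_compose2) (use cont uv'(2) in_ball in \<open>auto intro: continuous_on_subset\<close>)
      qed
      then show "(\<lambda>t. cx_scale (vector_derivative g (at t within {0..1})) (f (g t))) integrable_on cbox u v"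
        by auto
    qed
  qed
  then have "(\<lambda>t. cx_scale (vector_derivative g (at t within {0..1})) (f (g t))) integrable_on cbox 0 1"
    by (intro integrable_on_little_subintervals ballI)
  then show ?thesis by simp
qed

text \<open>Applying a real functional to both components gives a complex linear map, which passes
  through multiplication by the derivative of the path. This is the bridge from scalar to
  vector-valued contour integrals.\<close>

lemma contour_integral_functional:
  fixes f :: "complex \<Rightarrow> 'a::banach \<times> 'a"
  assumes \<Lambda>: "bounded_linear \<Lambda>" and "open S" "cx_holomorphic S f" "valid_path g" "path_image g \<subseteq> S"
  shows "contour_integral g (\<lambda>z. Complex (\<Lambda> (fst (f z))) (\<Lambda> (snd (f z))))
       = Complex (\<Lambda> (fst (cx_contour_integral g f))) (\<Lambda> (snd (cx_contour_integral g f)))"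
proof -
  define L where "L p = Complex (\<Lambda> (fst p)) (\<Lambda> (snd p))" for p
  have L: "bounded_linear L"
    unfolding L_def Complex_eq
    by (intro bounded_linear_add bounded_linear_const_mult bounded_linear_compose[OF bounded_linear_of_real]
        bounded_linear_compose[OF \<Lambda>] bounded_linear_fst bounded_linear_snd)
  have "((L \<circ> (\<lambda>t. cx_scale (vector_derivative g (at t within {0..1})) (f (g t)))) has_integral
      L (cx_contour_integral g f)) {0..1}"
    unfolding cx_contour_integral_def
    by (rule has_integral_linear[OF integrable_integral[OF cx_contour_integrable[OF assms(2-5)]] L])
  moreover have "L (cx_scale w p) = L p * w" for w p
    using \<Lambda>[THEN bounded_linear.linear]
    by (simp add: L_def cx_scale_def complex_eq_iff linear_add linear_diff linear_scale)
  ultimately have "((\<lambda>z. L (f z)) has_contour_integral L (cx_contour_integral g f)) g"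
    by (simp add: has_contour_integral_def o_def)
  then show ?thesis
    unfolding L_def by (rule contour_integral_unique)
qed

theorem cx_Cauchy_theorem_homology_cycle:
  fixes f :: "complex \<Rightarrow> 'a::banach \<times> 'a" and c :: "'i \<Rightarrow> real"
  assumes S: "open S" and f: "cx_holomorphic S f" and "finite A"
    and g: "\<And>i. i \<in> A \<Longrightarrow> valid_path (g i)" "\<And>i. i \<in> A \<Longrightarrow> path_image (g i) \<subseteq> S"
      "\<And>i. i \<in> A \<Longrightarrow> pathfinish (g i) = pathstart (g i)"
    and zero: "\<And>w. w \<notin> S \<Longrightarrow> (\<Sum>i\<in>A. of_real (c i) * winding_number (g i) w) = 0"
  shows "(\<Sum>i\<in>A. c i *\<^sub>R cx_contour_integral (g i) f) = 0"
proof -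
  define J where "J = (\<Sum>i\<in>A. c i *\<^sub>R cx_contour_integral (g i) f)"
  have "\<Lambda> (fst J) = 0 \<and> \<Lambda> (snd J) = 0" if \<Lambda>: "bounded_linear \<Lambda>" for \<Lambda> :: "'a \<Rightarrow> real"
  proof -
    have "(\<lambda>z. Complex (\<Lambda> (fst (f z))) (\<Lambda> (snd (f z)))) holomorphic_on S"
      using cx_holomorphic_imp_holomorphic[OF cx_holomorphic_map[OF \<Lambda> f]]
      by (simp add: map_prod_def split_beta)
    then have "(\<Sum>i\<in>A. of_real (c i) * contour_integral (g i)
        (\<lambda>z. Complex (\<Lambda> (fst (f z))) (\<Lambda> (snd (f z))))) = 0"
      by (intro Cauchy_theorem_homology_cycle[OF S _ \<open>finite A\<close> g zero])
    then have "(\<Sum>i\<in>A. of_real (c i) * Complex (\<Lambda> (fst (cx_contour_integral (g i) f)))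
        (\<Lambda> (snd (cx_contour_integral (g i) f)))) = 0"
      using g by (simp add: contour_integral_functional[OF \<Lambda> S f])
    then show ?thesis
      using \<Lambda>[THEN bounded_linear.linear]
      by (simp add: J_def complex_eq_iff fst_sum snd_sum linear_sum linear_scale Re_sum Im_sum)
  qed
  then have "fst J = 0 \<and> snd J = 0"
    using bounded_linear_functional_separating by metis
  then show ?thesis
    by (simp add: J_def prod_eq_iff)
qed

lemma cx_contour_integral_cnj:
  fixes f :: "complex \<Rightarrow> 'a::banach \<times> 'a"
  assumes "open S" "cx_holomorphic S f" "valid_path g" "path_image g \<subseteq> S"
    and refl: "\<And>z. z \<in> S \<Longrightarrow> f (cnj z) = cx_conj (f z)"
  shows "cx_contour_integral (cnj \<circ> g) f = cx_conj (cx_contour_integral g f)"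
proof -
  obtain k where k: "finite k" "\<And>t. t \<in> {0..1} - k \<Longrightarrow>
      (g has_vector_derivative vector_derivative g (at t within {0..1})) (at t)"
    using valid_path_vector_derivativeE[OF assms(3)] by blast
  have conj: "bounded_linear (cx_conj :: 'a \<times> 'a \<Rightarrow> _)"
    unfolding cx_conj_def by (intro bounded_linear_Pair bounded_linear_minus bounded_linear_fst bounded_linear_snd)
  have "cx_scale (vector_derivative (cnj \<circ> g) (at t within {0..1})) (f ((cnj \<circ> g) t))
      = cx_conj (cx_scale (vector_derivative g (at t within {0..1})) (f (g t)))" if t: "t \<in> {0..1} - k" for t
  proof -
    have "((cnj \<circ> g) has_vector_derivative cnj (vector_derivative g (at t within {0..1}))) (at t)"
      unfolding o_def by (rule bounded_linear.has_vector_derivative[OF bounded_linear_cnj k(2)[OF t]])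
    then have "vector_derivative (cnj \<circ> g) (at t within {0..1}) = cnj (vector_derivative g (at t within {0..1}))"
      using t by (intro vector_derivative_at_within_ivl) auto
    moreover have "g t \<in> S" using t assms(4) by (auto simp: path_image_def)
    ultimately show ?thesis
      by (simp add: refl) (simp add: cx_scale_def cx_conj_def)
  qed
  then have "cx_contour_integral (cnj \<circ> g) f
      = integral {0..1} (cx_conj \<circ> (\<lambda>t. cx_scale (vector_derivative g (at t within {0..1})) (f (g t))))"
    unfolding cx_contour_integral_def
    by (intro integral_spike[OF negligible_finite[OF k(1)]]) simp
  also have "\<dots> = cx_conj (cx_contour_integral g f)"
    unfolding cx_contour_integral_def
    by (rule integral_linear[OF cx_contour_integrable[OF assms(1-4)] conj])
  finally show ?thesis .
qed

section \<open>Boundaries of plane domains as cycles\<close>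

lemma pos_oriented_boundaryD:
  assumes "pos_oriented_boundary W \<Gamma>"
  shows "finite \<Gamma>" "\<gamma> \<in> \<Gamma> \<Longrightarrow> valid_path \<gamma>" "\<gamma> \<in> \<Gamma> \<Longrightarrow> pathfinish \<gamma> = pathstart \<gamma>"
    "\<gamma> \<in> \<Gamma> \<Longrightarrow> path_image \<gamma> \<subseteq> frontier W"
    "z \<in> W \<Longrightarrow> (\<Sum>\<gamma>\<in>\<Gamma>. winding_number \<gamma> z) = 1"
    "z \<notin> closure W \<Longrightarrow> (\<Sum>\<gamma>\<in>\<Gamma>. winding_number \<gamma> z) = 0"
  using assms unfolding pos_oriented_boundary_def valid_path_def by auto

text \<open>The second contour enters with weight -1. A point outside \<open>S\<close> lies inside
  both domains or outside both closures, so the winding sums cancel. The disjoint sum keeps apart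
  curves that occur in both families.\<close>

lemma cx_contour_integral_boundary_eq:
  fixes f :: "complex \<Rightarrow> 'a::banach \<times> 'a"
  assumes S: "open S" and f: "cx_holomorphic S f"
    and \<Gamma>: "pos_oriented_boundary W \<Gamma>" "frontier W \<subseteq> S"
    and \<Gamma>': "pos_oriented_boundary W' \<Gamma>'" "frontier W' \<subseteq> S"
    and comp: "\<And>w. w \<notin> S \<Longrightarrow> w \<in> W \<and> w \<in> W' \<or> w \<notin> closure W \<and> w \<notin> closure W'"
  shows "(\<Sum>\<gamma>\<in>\<Gamma>. cx_contour_integral \<gamma> f) = (\<Sum>\<gamma>\<in>\<Gamma>'. cx_contour_integral \<gamma> f)"
proof -
  note D = pos_oriented_boundaryD[OF \<Gamma>(1)] and D' = pos_oriented_boundaryD[OF \<Gamma>'(1)]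
  have "(\<Sum>i\<in>\<Gamma> <+> \<Gamma>'. case_sum (\<lambda>_. 1) (\<lambda>_. - 1) i *\<^sub>R cx_contour_integral (case_sum id id i) f) = 0"
  proof (rule cx_Cauchy_theorem_homology_cycle[OF S f])
    fix w assume "w \<notin> S"
    with comp[OF this] show "(\<Sum>i\<in>\<Gamma> <+> \<Gamma>'. of_real (case_sum (\<lambda>_. 1) (\<lambda>_. - 1) i) *
        winding_number (case_sum id id i) w) = 0"
      by (auto simp: sum.Plus D(1) D'(1) sum_negf D(5,6) D'(5,6))
  next
    fix i assume "i \<in> \<Gamma> <+> \<Gamma>'"
    then show "path_image (case_sum id id i) \<subseteq> S"
      using order_trans[OF D(4) \<Gamma>(2)] order_trans[OF D'(4) \<Gamma>'(2)] by (elim PlusE) simp_all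
  qed (use D(1-3) D'(1-3) in auto)
  then show ?thesis
    by (simp add: sum.Plus D(1) D'(1) sum_negf)
qed

text \<open>Reflection maps \<open>W\<close> to itself but reverses orientation, so the contour
  together with its mirror image is null-homologous in \<open>S\<close>. By the symmetry of
  \<open>f\<close> the mirror image contributes the conjugate integral, and the sum of the two is
  twice the real part.\<close>

lemma fst_cx_contour_integral_symmetric_boundary:
  fixes f :: "complex \<Rightarrow> 'a::banach \<times> 'a"
  assumes S: "open S" and f: "cx_holomorphic S f"
    and \<Gamma>: "pos_oriented_boundary W \<Gamma>" "frontier W \<subseteq> S"
    and comp: "\<And>w. w \<notin> S \<Longrightarrow> w \<in> W \<or> w \<notin> closure W"
    and sym: "\<And>z. z \<in> S \<Longrightarrow> cnj z \<in> S" "\<And>z. z \<in> W \<Longrightarrow> cnj z \<in> W"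
    and refl: "\<And>z. z \<in> S \<Longrightarrow> f (cnj z) = cx_conj (f z)"
  shows "(\<Sum>\<gamma>\<in>\<Gamma>. fst (cx_contour_integral \<gamma> f)) = 0"
proof -
  note D = pos_oriented_boundaryD[OF \<Gamma>(1)]
  have D4: "path_image \<gamma> \<subseteq> S" if "\<gamma> \<in> \<Gamma>" for \<gamma> using D(4)[OF that] \<Gamma>(2) by auto
  have W: "cnj ` W = W"
    using sym(2) by (auto simp: image_iff) (metis complex_cnj_cnj)
  have clos: "cnj z \<in> closure W \<longleftrightarrow> z \<in> closure W" for z
  proof -
    have "closure (cnj ` W) = cnj ` closure W"
      by (intro closure_injective_linear_image[symmetric])
         (auto simp: bounded_linear.linear bounded_linear_cnj inj_on_def)
    then show ?thesis unfolding W by (metis complex_cnj_cnj image_iff)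
  qed
  have "(\<Sum>i\<in>\<Gamma> <+> \<Gamma>. (1 :: real) *\<^sub>R cx_contour_integral (case_sum id ((\<circ>) cnj) i) f) = 0"
  proof (rule cx_Cauchy_theorem_homology_cycle[OF S f])
    fix w assume w: "w \<notin> S"
    have "winding_number (cnj \<circ> \<gamma>) w = - cnj (winding_number \<gamma> (cnj w))" if "\<gamma> \<in> \<Gamma>" for \<gamma>
      using winding_number_cnj[of \<gamma> "cnj w"] D(2)[OF that] D4[OF that] w sym(1)[of "cnj w"]
      by (auto simp: valid_path_imp_path)
    then have "(\<Sum>i\<in>\<Gamma> <+> \<Gamma>. winding_number (case_sum id ((\<circ>) cnj) i) w)
        = (\<Sum>\<gamma>\<in>\<Gamma>. winding_number \<gamma> w) - cnj (\<Sum>\<gamma>\<in>\<Gamma>. winding_number \<gamma> (cnj w))"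
      by (simp add: sum.Plus D(1) sum_negf)
    also have "\<dots> = 0"
      using comp[OF w]
    proof
      assume "w \<in> W"
      then show ?thesis using sym(2)[of w] by (simp add: D(5) del: cnj_sum)
    next
      assume "w \<notin> closure W"
      then show ?thesis using clos[of w] by (simp add: D(6) del: cnj_sum)
    qed
    finally show "(\<Sum>i\<in>\<Gamma> <+> \<Gamma>. of_real 1 * winding_number (case_sum id ((\<circ>) cnj) i) w) = 0"
      by simp
  next
    fix i assume i: "i \<in> \<Gamma> <+> \<Gamma>"
    show "valid_path (case_sum id ((\<circ>) cnj) i)"
      using i D(2) by (elim PlusE) (simp_all add: valid_path_cnj)
    show "path_image (case_sum id ((\<circ>) cnj) i) \<subseteq> S"
      using i D4 sym(1) by (fastforce simp: path_image_compose)
    show "pathfinish (case_sum id ((\<circ>) cnj) i) = pathstart (case_sum id ((\<circ>) cnj) i)"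
      using i D(3) by (auto simp: pathfinish_compose pathstart_compose)
  qed (use D(1) in auto)
  then have "(\<Sum>\<gamma>\<in>\<Gamma>. cx_contour_integral \<gamma> f) + (\<Sum>\<gamma>\<in>\<Gamma>. cx_conj (cx_contour_integral \<gamma> f)) = 0"
    using D(2) D4 by (simp add: sum.Plus D(1) cx_contour_integral_cnj[OF S f _ _ refl])
  then have "fst ((\<Sum>\<gamma>\<in>\<Gamma>. cx_contour_integral \<gamma> f) + (\<Sum>\<gamma>\<in>\<Gamma>. cx_conj (cx_contour_integral \<gamma> f))) = 0"
    by (simp only: fst_zero)
  then have "2 *\<^sub>R (\<Sum>\<gamma>\<in>\<Gamma>. fst (cx_contour_integral \<gamma> f)) = 0"
    by (simp add: fst_sum cx_conj_def scaleR_2)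
  then show ?thesis by simp
qed

section \<open>The Clifford operator algebra\<close>

lemma linear_axis: "linear (axis k)"
  by (rule linearI) (auto simp: axis_def vec_eq_iff)

lemma bounded_linear_axis: "bounded_linear (axis k :: 'a::real_normed_vector \<Rightarrow> 'a ^ 'n::finite)"
proof (rule bounded_linear_intro[where K = 1])
  show "norm (axis k x :: 'a ^ 'n) \<le> norm x * 1" for x
  proof -
    have "norm (axis k x :: 'a ^ 'n) \<le> (\<Sum>i\<in>UNIV. norm ((axis k x :: 'a ^ 'n) $ i))"
      unfolding norm_vec_def by (rule L2_set_le_sum) simp
    also have "\<dots> = (\<Sum>i\<in>UNIV. if i = k then norm x else 0)"
      by (intro sum.cong) (auto simp: axis_def)
    finally show ?thesis by simp
  qed
qed (simp_all add: linear_axis linear_add linear_scale)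

lemma axis_expansion: "(\<Sum>A\<in>UNIV. axis A (x $ A)) = x"
proof -
  have "(\<Sum>A\<in>UNIV. axis A (x $ A) $ B) = (\<Sum>A\<in>UNIV. if A = B then x $ B else 0)" for B
    by (intro sum.cong) (auto simp: axis_def)
  then show ?thesis by (simp add: vec_eq_iff)
qed

lemma linear_eq_on_axes:
  assumes "linear f" "linear g" "\<And>A a. f (axis A a) = g (axis A a)"
  shows "f x = g x"
proof -
  have "f (\<Sum>A\<in>UNIV. axis A (x $ A)) = g (\<Sum>A\<in>UNIV. axis A (x $ A))"
    by (simp only: linear_sum[OF assms(1)] linear_sum[OF assms(2)] assms(3))
  then show ?thesis by (simp only: axis_expansion)
qed

lemma neg_one_card_sym_diff:
  assumes "finite P" "finite Q"
  shows "(- 1 :: real) ^ card ((P - Q) \<union> (Q - P)) = (- 1) ^ card P * (- 1) ^ card Q"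
proof -
  have "card P = card (P - Q) + card (P \<inter> Q)" "card Q = card (Q - P) + card (P \<inter> Q)"
    using assms by (metis card_Int_Diff add.commute inf_commute)+
  moreover have "card ((P - Q) \<union> (Q - P)) = card (P - Q) + card (Q - P)"
    using assms by (intro card_Un_disjoint) auto
  moreover have "(- 1 :: real) ^ card (P \<inter> Q) * (- 1) ^ card (P \<inter> Q) = 1"
    by (simp flip: power_mult_distrib)
  ultimately show ?thesis by (simp add: power_add)
qed

text \<open>The set of counted pairs is compatible with symmetric differences in either argument,
  and cardinalities add modulo 2. This bimultiplicativity is what makes the Clifford product
  associative.\<close>

lemma cl_sign_sym_diff:
  fixes A B C :: "'n::{finite,linorder} set"
  shows "cl_sign ((A - B) \<union> (B - A)) C = cl_sign A C * cl_sign B C"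
    "cl_sign C ((A - B) \<union> (B - A)) = cl_sign C A * cl_sign C B"
proof -
  define X where "X A B = {(a, b). a \<in> A \<and> b \<in> B \<and> b \<le> a}" for A B :: "'n set"
  have "X ((A - B) \<union> (B - A)) C = (X A C - X B C) \<union> (X B C - X A C)"
    "X C ((A - B) \<union> (B - A)) = (X C A - X C B) \<union> (X C B - X C A)"
    by (auto simp: X_def)
  then show "cl_sign ((A - B) \<union> (B - A)) C = cl_sign A C * cl_sign B C"
    "cl_sign C ((A - B) \<union> (B - A)) = cl_sign C A * cl_sign C B"
    unfolding cl_sign_def X_def[symmetric] by (simp_all add: neg_one_card_sym_diff)
qed

lemma cl_sign_empty [simp]: "cl_sign {} B = 1" "cl_sign A {} = 1"
  by (simp_all add: cl_sign_def)

lemma bounded_bilinear_cl_prod: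
  assumes "bounded_bilinear m"
  shows "bounded_bilinear (cl_prod m)"
proof -
  have "bounded_bilinear (\<lambda>x y. axis ((A - B) \<union> (B - A)) (cl_sign A B *\<^sub>R m (x $ A) (y $ B)))"
    for A B :: "'n::{finite,linorder} set"
    by (rule bounded_bilinear_linear_comp[OF bounded_linear_compose[OF bounded_linear_axis bounded_linear_scaleR_right]
          bounded_bilinear.comp[OF assms bounded_linear_vec_nth bounded_linear_vec_nth]])
  then show ?thesis
    unfolding cl_prod_def[abs_def] by (intro bounded_bilinear_sum) auto
qed

lemma bounded_bilinear_linear:
  assumes "bounded_bilinear m"
  shows "linear (\<lambda>x. m x y)" "linear (m x)"
  using assms by (auto intro: bounded_linear.linear bounded_bilinear.bounded_linear_left
      bounded_bilinear.bounded_linear_right)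

lemma cl_prod_axis_bilinear:
  assumes "bounded_bilinear m"
  shows "cl_prod m (axis A a) (axis B b) = axis ((A - B) \<union> (B - A)) (cl_sign A B *\<^sub>R m a b)"
  using assms by (intro cl_prod_axis bounded_bilinear.zero_left bounded_bilinear.zero_right)

text \<open>On blades the index sets agree by associativity of the symmetric difference, and the
  signs by bimultiplicativity. The three blades are then replaced by general elements one at a time,
  by linearity.\<close>

lemma cl_prod_assoc:
  fixes x :: "'a::real_normed_vector ^ 'n::{finite,linorder} set"
  assumes m: "bounded_bilinear m1" "bounded_bilinear m2" "bounded_bilinear m3" "bounded_bilinear m4"
    and assoc: "\<And>a b c. m1 (m2 a b) c = m3 a (m4 b c)"
  shows "cl_prod m1 (cl_prod m2 x y) z = cl_prod m3 x (cl_prod m4 y z)"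
proof -
  note B = m[THEN bounded_bilinear_cl_prod]
  note L = B[THEN bounded_bilinear_linear(1)] and R = B[THEN bounded_bilinear_linear(2)]
  have 1: "cl_prod m1 (cl_prod m2 (axis A a) (axis B b)) (axis C c)
      = cl_prod m3 (axis A a) (cl_prod m4 (axis B b) (axis C c))" for A B C a b c
    using assoc[of a b c]
    by (auto simp: m[THEN cl_prod_axis_bilinear] cl_sign_sym_diff bounded_bilinear.scaleR_left[OF m(1)]
        bounded_bilinear.scaleR_right[OF m(3)] intro!: arg_cong2[where f = axis])
  have 2: "cl_prod m1 (cl_prod m2 (axis A a) (axis B b)) z
      = cl_prod m3 (axis A a) (cl_prod m4 (axis B b) z)" for A B a b z
    by (rule linear_eq_on_axes[OF _ linear_compose[OF R(4) R(3), unfolded o_def]]) (auto simp: R 1)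
  have 3: "cl_prod m1 (cl_prod m2 (axis A a) y) z = cl_prod m3 (axis A a) (cl_prod m4 y z)" for A a y z
    by (rule linear_eq_on_axes[OF linear_compose[OF R(2) L(1), unfolded o_def]
          linear_compose[OF L(4) R(3), unfolded o_def]]) (simp add: 2)
  show ?thesis
    by (rule linear_eq_on_axes[OF linear_compose[OF L(2) L(1), unfolded o_def] L(3)]) (simp add: 3)
qed

lemma bounded_bilinear_op_mult: "bounded_bilinear (\<odot>)"
  unfolding op_mult_def[abs_def]
  by (intro bounded_bilinear_cl_prod bounded_bilinear_blinfun_compose)

interpretation op: bounded_bilinear "(\<odot>)"
  by (rule bounded_bilinear_op_mult)

lemmas op_linear = bounded_bilinear_linear[OF bounded_bilinear_op_mult]

lemma op_mult_axis: "axis A a \<odot> axis B b = axis ((A - B) \<union> (B - A)) (cl_sign A B *\<^sub>R (a o\<^sub>L b))"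
  unfolding op_mult_def by (rule cl_prod_axis_bilinear[OF bounded_bilinear_blinfun_compose])

lemma blinfun_compose_assoc: "(a o\<^sub>L b) o\<^sub>L c = a o\<^sub>L (b o\<^sub>L c)"
  by (rule blinfun_eqI) simp

lemma op_mult_assoc: "(x \<odot> y) \<odot> z = x \<odot> (y \<odot> z)"
  unfolding op_mult_def
  by (intro cl_prod_assoc bounded_bilinear_blinfun_compose blinfun_compose_assoc)

lemma op_one_mult [simp]: "op_one \<odot> x = x" "x \<odot> op_one = x"
proof -
  have id: "id_blinfun o\<^sub>L a = a" "a o\<^sub>L id_blinfun = a" for a :: "'a \<Rightarrow>\<^sub>L 'a"
    by (auto intro: blinfun_eqI)
  show "op_one \<odot> x = x"
    by (rule linear_eq_on_axes[OF op_linear(2) linear_ident]) (simp add: op_one_def op_mult_axis id)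
  show "x \<odot> op_one = x"
    by (rule linear_eq_on_axes[OF op_linear(1) linear_ident]) (simp add: op_one_def op_mult_axis id)
qed

lemma linear_op_of: "linear op_of"
  by (rule linearI) (auto simp: op_of_def vec_eq_iff scaleR_add_left)

lemma bounded_linear_op_of: "bounded_linear op_of"
  using linear_op_of by (simp add: linear_linear)

lemma op_of_axis: "op_of (axis A r) = axis A (r *\<^sub>R id_blinfun)"
  by (auto simp: op_of_def axis_def vec_eq_iff)

lemma op_of_mult:
  fixes x y :: "real ^ 'n::{finite,linorder} set"
  shows "(op_of (x \<star> y) :: ('v::real_normed_vector, 'n) clop) = op_of x \<odot> op_of y"
proof -
  note cl = bounded_bilinear_linear[OF bounded_bilinear_cl_prod[OF bounded_bilinear_mult]]
  have 1: "(op_of (axis A a \<star> axis B b) :: ('v, 'n) clop) = op_of (axis A a) \<odot> op_of (axis B b)"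
    for A B :: "'n set" and a b :: real
    by (auto simp: cl_mult_def cl_prod_axis op_of_axis op_mult_axis blinfun.bilinear_simps
        intro!: arg_cong2[where f = axis] blinfun_eqI)
  have 2: "(op_of (axis A a \<star> y) :: ('v, 'n) clop) = op_of (axis A a) \<odot> op_of y" for A :: "'n set" and a y
    unfolding cl_mult_def
    by (rule linear_eq_on_axes[OF linear_compose[OF cl(2) linear_op_of, unfolded o_def]
          linear_compose[OF linear_op_of op_linear(2), unfolded o_def]])
       (simp add: 1 flip: cl_mult_def)
  show ?thesis
    unfolding cl_mult_def
    by (rule linear_eq_on_axes[OF linear_compose[OF cl(1) linear_op_of, unfolded o_def]
          linear_compose[OF linear_op_of op_linear(1), unfolded o_def]])
       (simp add: 2 flip: cl_mult_def)
qed

lemma axis_empty_mult: "axis {} a \<odot> axis {} b = axis {} (a o\<^sub>L b)"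
  by (simp add: op_mult_axis)

lemma axis_empty_id: "axis {} id_blinfun = op_one"
  by (simp add: op_one_def)

interpretation compose: bounded_bilinear "(o\<^sub>L)"
  by (rule bounded_bilinear_blinfun_compose)

text \<open>Multiplication by a real operator acts coefficientwise; the coefficient at
  \<open>{}\<close> thus turns an inverse in the Clifford algebra into an inverse in B(V).\<close>

lemma axis_empty_mult_nth: "(axis {} a \<odot> x) $ A = a o\<^sub>L (x $ A)" "(x \<odot> axis {} a) $ A = (x $ A) o\<^sub>L a"
proof -
  have "axis {} a \<odot> x = (\<chi> A. a o\<^sub>L (x $ A))"
  proof (rule linear_eq_on_axes[OF op_linear(2)])
    show "linear (\<lambda>x. \<chi> A. a o\<^sub>L (x $ A))"
      by (rule linearI) (auto simp: vec_eq_iff compose.bilinear_simps compose.scaleR_left compose.scaleR_right)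
  qed (unfold op_mult_axis, auto simp: vec_eq_iff axis_def compose.zero_left compose.zero_right)
  then show "(axis {} a \<odot> x) $ A = a o\<^sub>L (x $ A)" by simp
  have "x \<odot> axis {} a = (\<chi> A. (x $ A) o\<^sub>L a)"
  proof (rule linear_eq_on_axes[OF op_linear(1)])
    show "linear (\<lambda>x. \<chi> A. (x $ A) o\<^sub>L a)"
      by (rule linearI) (auto simp: vec_eq_iff compose.bilinear_simps compose.scaleR_left compose.scaleR_right)
  qed (unfold op_mult_axis, auto simp: vec_eq_iff axis_def compose.zero_left compose.zero_right)
  then show "(x \<odot> axis {} a) $ A = (x $ A) o\<^sub>L a" by simp
qed

lemma axis_empty_commute_op_of: "axis {} a \<odot> op_of c = op_of c \<odot> axis {} a"
  by (rule linear_eq_on_axes[OF linear_compose[OF linear_op_of op_linear(2), unfolded o_def]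
        linear_compose[OF linear_op_of op_linear(1), unfolded o_def]])
     (auto simp: op_of_axis op_mult_axis intro!: arg_cong2[where f = axis] blinfun_eqI simp: blinfun.bilinear_simps)

text \<open>In the double sum added to its transpose, the off-diagonal terms cancel because the
  generators anticommute and the coefficients commute. The lemma serves both the imaginary units and
  the vector part of \<open>T\<close>.\<close>

lemma vector_part_square:
  fixes t :: "'n::{finite,linorder} \<Rightarrow> 'v::real_normed_vector \<Rightarrow>\<^sub>L 'v"
  assumes comm: "\<And>i j. t i o\<^sub>L t j = t j o\<^sub>L t i"
  shows "(\<Sum>j\<in>UNIV. axis {j} (t j)) \<odot> (\<Sum>j\<in>UNIV. axis {j} (t j)) = - axis {} (\<Sum>j\<in>UNIV. t j o\<^sub>L t j)"
proof -
  define P where "P i j = axis {i} (t i) \<odot> axis {j} (t j)" for i j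
  have sgn: "cl_sign {i} {j} = (if j \<le> i then - 1 else 1)" for i j :: 'n
  proof -
    have "{(a, b). a \<in> {i} \<and> b \<in> {j} \<and> b \<le> a} = (if j \<le> i then {(i, j)} else {})" by auto
    then show ?thesis by (simp add: cl_sign_def)
  qed
  have P_axis: "P i j = axis (({i} - {j}) \<union> ({j} - {i})) ((if j \<le> i then - 1 else 1) *\<^sub>R (t i o\<^sub>L t j))" for i j
    unfolding P_def op_mult_axis sgn ..
  have P: "P i j + P j i = (if i = j then - 2 *\<^sub>R axis {} (t i o\<^sub>L t i) else 0)" for i j
    by (cases i j rule: linorder_cases)
       (auto simp: P_axis comm[of i j] axis_def vec_eq_iff insert_Diff_if insert_commute scaleR_2)
  define Z where "Z = (\<Sum>j\<in>UNIV. axis {j} (t j)) \<odot> (\<Sum>j\<in>UNIV. axis {j} (t j))"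
  have Z: "Z = (\<Sum>i\<in>UNIV. \<Sum>j\<in>UNIV. P i j)"
    unfolding Z_def P_def op.sum_left by (simp only: op.sum_right)
  have "2 *\<^sub>R Z = Z + (\<Sum>i\<in>UNIV. \<Sum>j\<in>UNIV. P j i)"
    unfolding scaleR_2 Z by (subst (3) sum.swap) (rule refl)
  also have "\<dots> = (\<Sum>i\<in>UNIV. \<Sum>j\<in>UNIV. P i j + P j i)"
    by (simp add: Z sum.distrib)
  also have "\<dots> = (\<Sum>i\<in>UNIV. - 2 *\<^sub>R axis {} (t i o\<^sub>L t i))"
    unfolding P by simp
  also have "\<dots> = 2 *\<^sub>R - axis {} (\<Sum>j\<in>UNIV. t j o\<^sub>L t j)"
    by (simp add: linear_sum[OF linear_axis] sum_negf scaleR_sum_right)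
  finally show ?thesis unfolding Z_def scaleR_cancel_left by simp
qed

section \<open>The grade involution\<close>

definition grade_inv :: "('v::real_normed_vector, 'n::{finite,linorder}) clop \<Rightarrow> ('v, 'n) clop" where
  "grade_inv x = (\<chi> A. (- 1) ^ card A *\<^sub>R x $ A)"

lemma linear_grade_inv: "linear grade_inv"
  by (rule linearI) (auto simp: grade_inv_def vec_eq_iff scaleR_add_right)

lemma grade_inv_axis: "grade_inv (axis A a) = axis A ((- 1) ^ card A *\<^sub>R a)"
  by (auto simp: grade_inv_def axis_def vec_eq_iff)

text \<open>The parity of a symmetric difference is the sum of the parities. On paravector operators
  \<open>grade_inv\<close> agrees with \<open>op_conj\<close>, but being multiplicative on the whole
  algebra it also carries inverses to inverses.\<close>

lemma grade_inv_mult: "grade_inv (x \<odot> y) = grade_inv x \<odot> grade_inv y"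
proof -
  have 1: "grade_inv (axis A a \<odot> axis B b) = grade_inv (axis A a) \<odot> grade_inv (axis B b)"
    for A B :: "'b set" and a b :: "'a \<Rightarrow>\<^sub>L 'a"
    by (auto simp: op_mult_axis grade_inv_axis neg_one_card_sym_diff
        intro!: arg_cong2[where f = axis] blinfun_eqI simp: blinfun.bilinear_simps)
  have 2: "grade_inv (axis A a \<odot> y) = grade_inv (axis A a) \<odot> grade_inv y"
    for A :: "'b set" and a :: "'a \<Rightarrow>\<^sub>L 'a" and y
    by (rule linear_eq_on_axes[OF linear_compose[OF op_linear(2) linear_grade_inv, unfolded o_def]
          linear_compose[OF linear_grade_inv op_linear(2), unfolded o_def]]) (simp add: 1)
  show ?thesis
    by (rule linear_eq_on_axes[OF linear_compose[OF op_linear(1) linear_grade_inv, unfolded o_def]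
          linear_compose[OF linear_grade_inv op_linear(1), unfolded o_def]]) (simp add: 2)
qed

lemma grade_inv_one [simp]: "grade_inv op_one = op_one"
  by (simp add: op_one_def grade_inv_axis)

section \<open>Inversion in Banach algebras\<close>

text \<open>The right inverse is the fixed point of \<open>y \<mapsto> b + b (a - x) y\<close>, a
  contraction for \<open>x\<close> near \<open>a\<close>; multiplying the fixed point equation by
  \<open>a\<close> gives \<open>a y = e + (a - x) y\<close>. The product only has to be
  submultiplicative up to a constant.\<close>

lemma right_inverse_perturbation:
  fixes m :: "'a::banach \<Rightarrow> 'a \<Rightarrow> 'a"
  assumes m: "bounded_bilinear m" and assoc: "\<And>x y z. m (m x y) z = m x (m y z)"
    and unit: "\<And>x. m e x = x" "\<And>x. m x e = x" and inv: "m a b = e"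
  obtains d where "d > 0" "\<And>x. norm (x - a) < d \<Longrightarrow> \<exists>y. m x y = e"
proof -
  interpret m: bounded_bilinear m by fact
  obtain K where K: "K > 0" "\<And>x y. norm (m x y) \<le> norm x * norm y * K"
    using m.pos_bounded by blast
  define c where "c x = norm b * K * K * norm (x - a)" for x
  \<comment> \<open>The added 1 keeps the denominator positive and makes the contraction constant
    strictly smaller than 1.\<close>
  define d where "d = 1 / (norm b * K * K + 1)"
  have bK: "0 \<le> norm b * K * K" using K(1) by simp
  have "d > 0" using bK by (simp add: d_def add_nonneg_pos)
  moreover have "\<exists>y. m x y = e" if x: "norm (x - a) < d" for x
  proof -
    have "c x \<le> norm b * K * K * d"
      unfolding c_def using bK x by (intro mult_left_mono) auto
    also have "\<dots> < 1" unfolding d_def using bK by (simp add: divide_less_eq)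
    finally have "c x < 1" .
    have contr: "dist (b + m b (m (a - x) y)) (b + m b (m (a - x) z)) \<le> c x * dist y z" for y z
    proof -
      have "dist (b + m b (m (a - x) y)) (b + m b (m (a - x) z)) = norm (m b (m (a - x) (y - z)))"
        by (simp add: dist_norm m.diff_right)
      also have "\<dots> \<le> norm b * (norm (a - x) * norm (y - z) * K) * K"
        using K by (intro order_trans[OF K(2)] mult_right_mono mult_left_mono) auto
      also have "\<dots> = c x * dist y z"
        by (simp add: c_def dist_norm norm_minus_commute)
      finally show ?thesis .
    qed
    have "\<exists>!y. y \<in> UNIV \<and> b + m b (m (a - x) y) = y"
      using \<open>c x < 1\<close> contr bK
      by (intro Banach_fix[where c = "c x"]) (auto simp: c_def complete_UNIV)
    then obtain y where y: "b + m b (m (a - x) y) = y" by blast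
    have "m a y = m a b + m (m a b) (m (a - x) y)"
      by (subst y[symmetric]) (simp add: m.add_right assoc)
    then have "m x y = e" by (simp add: inv unit m.diff_left)
    then show ?thesis ..
  qed
  ultimately show thesis by (rule that)
qed

lemma inverse_perturbation:
  fixes m :: "'a::banach \<Rightarrow> 'a \<Rightarrow> 'a"
  assumes m: "bounded_bilinear m" and assoc: "\<And>x y z. m (m x y) z = m x (m y z)"
    and unit: "\<And>x. m e x = x" "\<And>x. m x e = x" and inv: "m a b = e" "m b a = e"
  obtains d where "d > 0" "\<And>x. norm (x - a) < d \<Longrightarrow> \<exists>y. m x y = e \<and> m y x = e"
proof -
  obtain d1 where d1: "d1 > 0" "\<And>x. norm (x - a) < d1 \<Longrightarrow> \<exists>y. m x y = e"
    using right_inverse_perturbation[OF m assoc unit inv(1)] by blast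
  \<comment> \<open>A left inverse is a right inverse for the opposite product.\<close>
  obtain d2 where d2: "d2 > 0" "\<And>x. norm (x - a) < d2 \<Longrightarrow> \<exists>y. m y x = e"
    using right_inverse_perturbation[OF bounded_bilinear.flip[OF m], where e = e and a = a and b = b]
      assoc unit inv(2) by auto
  have "\<exists>y. m x y = e \<and> m y x = e" if x: "norm (x - a) < min d1 d2" for x
  proof -
    obtain y z where y: "m x y = e" and z: "m z x = e"
      using d1(2)[of x] d2(2)[of x] x by auto
    have "z = y"
      using assoc[of z x y] by (simp add: y z unit)
    then show ?thesis using y z by auto
  qed
  then show thesis using that[of "min d1 d2"] d1(1) d2(1) by auto
qed

text \<open>No continuity of \<open>g\<close> is assumed. Applying
  \<open>g w = g z - g w k(w)\<close> twice, with \<open>k(w) = (f w - f z) g z\<close>, gives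
  \<open>g w = g z - g z k(w) + g w k(w) k(w)\<close>. The linear term has the asserted derivative,
  and the last term is of second order once \<open>g\<close> is known to be bounded near
  \<open>z\<close>.\<close>

lemma has_derivative_inverse_bilinear:
  fixes m :: "'a::real_normed_vector \<Rightarrow> 'a \<Rightarrow> 'a" and f :: "'b::real_normed_vector \<Rightarrow> 'a"
  assumes m: "bounded_bilinear m" and assoc: "\<And>x y z. m (m x y) z = m x (m y z)"
    and unit: "\<And>x. m e x = x" "\<And>x. m x e = x"
    and "open S" "z \<in> S" and inv: "\<And>w. w \<in> S \<Longrightarrow> m (f w) (g w) = e" "\<And>w. w \<in> S \<Longrightarrow> m (g w) (f w) = e"
    and f': "(f has_derivative f') (at z)"
  shows "(g has_derivative (\<lambda>h. - m (g z) (m (f' h) (g z)))) (at z)"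
proof -
  interpret m: bounded_bilinear m by fact
  obtain K where K: "K > 0" "\<And>x y. norm (m x y) \<le> norm x * norm y * K"
    using m.pos_bounded by blast
  define k where "k w = m (f w - f z) (g z)" for w
  have nk: "norm (k w) \<le> norm (f w - f z) * norm (g z) * K" for w
    unfolding k_def by (rule K(2))
  have eq: "g w = g z - m (g w) (k w)" if "w \<in> S" for w
    using inv(2)[OF that] inv(1)[OF \<open>z \<in> S\<close>] assoc[of "g w" "f w" "g z"]
    by (simp add: k_def m.diff_left m.diff_right unit)
  have k': "(k has_derivative (\<lambda>h. m (f' h) (g z))) (at z)"
    unfolding k_def
    by (rule bounded_linear.has_derivative[OF m.bounded_linear_left])
       (auto intro!: derivative_eq_intros f')
  have kz: "k z = 0" by (simp add: k_def m.zero_left)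
  have k_cont: "(k \<longlongrightarrow> 0) (at z)"
    using has_derivative_continuous[OF k'] by (simp add: continuous_at kz flip: kz)
  have S: "\<forall>\<^sub>F w in at z. w \<in> S"
    using \<open>open S\<close> \<open>z \<in> S\<close> by (rule eventually_at_in_open')
  \<comment> \<open>With this threshold \<open>m (g w) (k w)\<close> has norm at most half of
    \<open>norm (g w)\<close>, which is absorbed on the left.\<close>
  have "\<forall>\<^sub>F w in at z. norm (k w) < 1 / (2 * K)"
    using k_cont K(1) by (auto simp: tendsto_iff)
  with S have bound: "\<forall>\<^sub>F w in at z. norm (g w) \<le> 2 * norm (g z)"
  proof eventually_elim
    case (elim w)
    have "norm (g w) \<le> norm (g z) + norm (m (g w) (k w))"
      using eq[OF elim(1)] norm_triangle_ineq4[of "g z" "m (g w) (k w)"] by simp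
    also have "norm (m (g w) (k w)) \<le> norm (g w) * norm (k w) * K" by (rule K(2))
    also have "\<dots> \<le> norm (g w) * (1 / (2 * K)) * K"
      using elim K(1) by (intro mult_right_mono mult_left_mono) auto
    also have "\<dots> = norm (g w) / 2" using K(1) by simp
    finally show ?case by simp
  qed
  obtain B where B: "B > 0" "\<And>h. norm (m (f' h) (g z)) \<le> norm h * B"
    using bounded_linear.pos_bounded[OF has_derivative_bounded_linear[OF k']] by blast
  have "\<forall>\<^sub>F w in at z. norm (k w - k z - m (f' (w - z)) (g z)) \<le> 1 * norm (w - z)"
    using k' zero_less_one unfolding has_derivative_within_alt2 by blast
  then have lip: "\<forall>\<^sub>F w in at z. norm (k w) \<le> (1 + B) * norm (w - z)"
  proof eventually_elim
    case (elim w)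
    have "norm (k w) \<le> norm (k w - m (f' (w - z)) (g z)) + norm (m (f' (w - z)) (g z))"
      using norm_triangle_ineq[of "k w - m (f' (w - z)) (g z)" "m (f' (w - z)) (g z)"] by simp
    then show ?case using elim B(2)[of "w - z"] by (simp add: kz algebra_simps)
  qed
  define r where "r w = m (m (g w) (k w)) (k w)" for w
  have r': "(r has_derivative (\<lambda>h. 0)) (at z)"
  proof (rule has_derivativeI)
    have "((\<lambda>w. 2 * norm (g z) * K * K * (1 + B) * norm (k w)) \<longlongrightarrow> 0) (at z)"
      using k_cont by (intro tendsto_mult_right_zero tendsto_norm_zero)
    moreover have "\<forall>\<^sub>F w in at z. norm ((r w - r z - 0) /\<^sub>R norm (w - z))
        \<le> 2 * norm (g z) * K * K * (1 + B) * norm (k w)"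
      using bound lip
    proof eventually_elim
      case (elim w)
      have "norm (r w) \<le> norm (g w) * norm (k w) * K * norm (k w) * K"
        unfolding r_def using K by (intro order_trans[OF K(2)] mult_right_mono) auto
      also have "\<dots> \<le> (2 * norm (g z)) * ((1 + B) * norm (w - z)) * K * norm (k w) * K"
        using elim K(1) B(1) by (intro mult_right_mono mult_mono) auto
      finally show ?case
        by (cases "w = z") (auto simp: r_def kz m.zero_right field_simps)
    qed
    ultimately show "((\<lambda>w. (r w - r z - 0) /\<^sub>R norm (w - z)) \<longlongrightarrow> 0) (at z)"
      by (rule Lim_null_comparison[rotated])
  qed simp
  have "((\<lambda>w. g z - m (g z) (k w) + r w) has_derivative (\<lambda>h. 0 - m (g z) (m (f' h) (g z)) + 0)) (at z)"
    by (intro has_derivative_add has_derivative_diff has_derivative_const r'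
        bounded_linear.has_derivative[OF m.bounded_linear_right] k')
  then have "((\<lambda>w. g z - m (g z) (k w) + r w) has_derivative (\<lambda>h. - m (g z) (m (f' h) (g z)))) (at z)"
    by simp
  then show ?thesis
  proof (rule has_derivative_transform_within_open[OF _ \<open>open S\<close> \<open>z \<in> S\<close>])
    fix w assume w: "w \<in> S"
    have "g w = g z - m (g z - m (g w) (k w)) (k w)"
      using eq[OF w] by metis
    then have "g w = g z - (m (g z) (k w) - r w)"
      by (simp only: m.diff_left r_def)
    then show "g z - m (g z) (k w) + r w = g w"
      unfolding diff_diff_eq2 diff_add_eq by (rule sym)
  qed
qed

lemma cx_holomorphic_inverse:
  fixes b :: "'a::real_normed_vector \<Rightarrow> 'a \<Rightarrow> 'a"
  assumes b: "bounded_bilinear b" and assoc: "\<And>x y z. b (b x y) z = b x (b y z)"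
    and unit: "\<And>x. b e x = x" "\<And>x. b x e = x"
    and "open S" and f: "cx_holomorphic S f"
    and inv: "\<And>z. z \<in> S \<Longrightarrow> cx_bilinear b (f z) (g z) = (e, 0)"
      "\<And>z. z \<in> S \<Longrightarrow> cx_bilinear b (g z) (f z) = (e, 0)"
  shows "cx_holomorphic S g"
proof -
  let ?m = "cx_bilinear b"
  note m = bounded_bilinear_cx_bilinear[OF b]
  have m_assoc: "?m (?m x y) z = ?m x (?m y z)" for x y z
    by (simp add: cx_bilinear_def assoc b[THEN bounded_bilinear.add_left] b[THEN bounded_bilinear.add_right]
        b[THEN bounded_bilinear.diff_left] b[THEN bounded_bilinear.diff_right])
  have m_unit: "?m (e, 0) x = x" "?m x (e, 0) = x" for x
    by (simp_all add: cx_bilinear_def unit b[THEN bounded_bilinear.zero_left] b[THEN bounded_bilinear.zero_right])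
  obtain f' where f': "continuous_on S f'" "\<And>z. z \<in> S \<Longrightarrow> (f has_derivative (\<lambda>h. cx_scale h (f' z))) (at z)"
    using cx_holomorphicE[OF f] by blast
  have g': "(g has_derivative (\<lambda>h. cx_scale h (- ?m (g z) (?m (f' z) (g z))))) (at z)" if "z \<in> S" for z
    using has_derivative_inverse_bilinear[OF m m_assoc m_unit \<open>open S\<close> that inv f'(2)[OF that]]
    by (simp add: cx_bilinear_scale[OF b] bounded_bilinear.minus_right[OF bounded_bilinear_cx_scale])
  \<comment> \<open>Differentiability gives continuity of \<open>g\<close>, and then the formula for
    the derivative gives continuity of the derivative.\<close>
  then have "continuous_on S g"
    by (meson continuous_at_imp_continuous_on has_derivative_continuous)
  then show ?thesis
    by (intro cx_holomorphicI[OF _ g'] continuous_on_minus bounded_bilinear.continuous_on[OF m] f')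
qed

section \<open>Powers and inverses in the complexified operators\<close>

abbreviation cx_comp ::
  "('v::real_normed_vector \<Rightarrow>\<^sub>L 'v) \<times> ('v \<Rightarrow>\<^sub>L 'v) \<Rightarrow> ('v \<Rightarrow>\<^sub>L 'v) \<times> ('v \<Rightarrow>\<^sub>L 'v) \<Rightarrow>
    ('v \<Rightarrow>\<^sub>L 'v) \<times> ('v \<Rightarrow>\<^sub>L 'v)" (infixl "\<otimes>\<^sub>c" 70) where
  "p \<otimes>\<^sub>c q \<equiv> cx_bilinear (o\<^sub>L) p q"

interpretation cxc: bounded_bilinear "(\<otimes>\<^sub>c)"
  by (intro bounded_bilinear_cx_bilinear bounded_bilinear_blinfun_compose)

lemma id_blinfun_compose [simp]: "id_blinfun o\<^sub>L a = a" "a o\<^sub>L id_blinfun = a"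
  by (auto intro: blinfun_eqI)

lemma cx_comp_assoc: "(p \<otimes>\<^sub>c q) \<otimes>\<^sub>c r = p \<otimes>\<^sub>c (q \<otimes>\<^sub>c r)"
  by (simp add: cx_bilinear_def blinfun_compose_assoc compose.add_left compose.add_right
      compose.diff_left compose.diff_right)

lemma cx_comp_id [simp]: "(id_blinfun, 0) \<otimes>\<^sub>c p = p" "p \<otimes>\<^sub>c (id_blinfun, 0) = p"
  by (simp_all add: cx_bilinear_def compose.zero_left compose.zero_right)

primrec cx_power ::
  "('v::real_normed_vector \<Rightarrow>\<^sub>L 'v) \<times> ('v \<Rightarrow>\<^sub>L 'v) \<Rightarrow> nat \<Rightarrow> ('v \<Rightarrow>\<^sub>L 'v) \<times> ('v \<Rightarrow>\<^sub>L 'v)" where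
  "cx_power p 0 = (id_blinfun, 0)"
| "cx_power p (Suc k) = p \<otimes>\<^sub>c cx_power p k"

lemma cx_power_conj: "cx_power (cx_conj p) k = cx_conj (cx_power p k)"
  by (induction k) (simp_all add: cx_bilinear_conj[OF bounded_bilinear_blinfun_compose], simp add: cx_conj_def)

lemma cx_holomorphic_power:
  "cx_holomorphic S f \<Longrightarrow> cx_holomorphic S (\<lambda>z. cx_power (f z) k)"
  by (induction k)
     (simp_all add: cx_holomorphic_const cx_holomorphic_bilinear[OF bounded_bilinear_blinfun_compose])

lemma op_inv_eq:
  assumes "op_inverse_of S T"
  shows "op_inv T = S"
  unfolding op_inv_def
proof (rule the_equality)
  show "op_inverse_of S T" by fact
  fix S' assume "op_inverse_of S' T"
  then have "S' = S' \<odot> (T \<odot> S)" using assms by (simp add: op_inverse_of_def)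
  also have "\<dots> = S" using \<open>op_inverse_of S' T\<close> by (simp add: op_inverse_of_def flip: op_mult_assoc)
  finally show "S' = S" .
qed

section \<open>The imaginary units\<close>

definition unit_op :: "real ^ 'n::{finite,linorder} \<Rightarrow> ('v::real_normed_vector, 'n) clop" where
  "unit_op I = op_of (paravector (0, I))"

lemma paravector_0: "paravector (0, I) = (\<Sum>j\<in>UNIV. axis {j} (I $ j))"
  by (simp add: paravector_def linear_0[OF linear_axis])

lemma paravector_slice_point: "paravector (slice_point I z) = Re z *\<^sub>R axis {} 1 + Im z *\<^sub>R paravector (0, I)"
  by (simp add: paravector_def slice_point_def scaleR_sum_right linear_0[OF linear_axis]
      flip: linear_scale[OF linear_axis])

lemma unit_op_square:
  fixes I :: "real ^ 'n::{finite,linorder}"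
  assumes "I \<in> unit_sphere"
  shows "unit_op I \<odot> unit_op I = - (op_one :: ('v::real_normed_vector, 'n) clop)"
proof -
  define t where "t j = (I $ j) *\<^sub>R (id_blinfun :: 'v \<Rightarrow>\<^sub>L 'v)" for j
  have "(unit_op I :: ('v, 'n) clop) = (\<Sum>j\<in>UNIV. axis {j} (t j))"
    by (simp add: unit_op_def paravector_0 linear_sum[OF linear_op_of] op_of_axis t_def)
  moreover have comm: "t i o\<^sub>L t j = t j o\<^sub>L t i" for i j
    by (simp add: t_def compose.scaleR_left compose.scaleR_right mult.commute)
  have "(\<Sum>j\<in>UNIV. t j o\<^sub>L t j) = (\<Sum>j\<in>UNIV. (I $ j)\<^sup>2) *\<^sub>R id_blinfun"
    by (simp add: t_def compose.scaleR_left compose.scaleR_right power2_eq_square scaleR_sum_left)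
  moreover have "(\<Sum>j\<in>UNIV. (I $ j)\<^sup>2) = 1"
    using assms by (simp add: unit_sphere_def norm_vec_def L2_set_def real_sqrt_eq_1_iff)
  ultimately show ?thesis
    using vector_part_square[of t, OF comm] by (simp add: axis_empty_id)
qed

text \<open>For a unit \<open>I\<close> this is the algebra homomorphism from the complexification
  of B(V) that sends i to \<open>I\<close>; it is multiplicative because \<open>I\<close> commutes
  with real operators and squares to -1.\<close>

definition cx_op :: "real ^ 'n::{finite,linorder} \<Rightarrow> ('v::real_normed_vector \<Rightarrow>\<^sub>L 'v) \<times> ('v \<Rightarrow>\<^sub>L 'v) \<Rightarrow> ('v, 'n) clop" where
  "cx_op I p = axis {} (fst p) + axis {} (snd p) \<odot> unit_op I"

lemma unit_op_commute:
  "unit_op I \<odot> axis {} a = axis {} a \<odot> unit_op I"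
  "unit_op I \<odot> (axis {} a \<odot> x) = axis {} a \<odot> (unit_op I \<odot> x)"
  by (simp_all add: unit_op_def axis_empty_commute_op_of flip: op_mult_assoc)

lemma linear_cx_op: "linear (cx_op I)"
  by (rule linearI)
     (simp_all add: cx_op_def linear_add[OF linear_axis] linear_scale[OF linear_axis] op.add_left
       op.scaleR_left scaleR_add_right)

lemma unit_op_mult_left:
  assumes "I \<in> unit_sphere"
  shows "unit_op I \<odot> (unit_op I \<odot> x) = - x"
  using unit_op_square[OF assms] by (metis op_mult_assoc op.minus_left op_one_mult(1))

lemma cx_op_mult:
  fixes I :: "real ^ 'n::{finite,linorder}" and p q :: "('v::real_normed_vector \<Rightarrow>\<^sub>L 'v) \<times> ('v \<Rightarrow>\<^sub>L 'v)"
  assumes "I \<in> unit_sphere"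
  shows "cx_op I (p \<otimes>\<^sub>c q) = cx_op I p \<odot> cx_op I q"
  by (simp add: cx_op_def cx_bilinear_def linear_add[OF linear_axis] linear_diff[OF linear_axis]
      op.add_left op.add_right op.diff_left op_mult_assoc unit_op_commute unit_op_mult_left[OF assms]
      unit_op_square[OF assms] op.minus_right flip: axis_empty_mult)

lemma cx_op_id [simp]: "cx_op I (id_blinfun, 0) = op_one"
  by (simp add: cx_op_def axis_empty_id linear_0[OF linear_axis] op.zero_left)

lemma cx_op_power:
  "I \<in> unit_sphere \<Longrightarrow> cx_op I (cx_power p k) = op_pow (cx_op I p) k"
  by (induction k) (simp_all add: cx_op_mult)

lemma cx_op_scale_id: "cx_op I (cx_scale z (id_blinfun, 0)) = op_of (paravector (slice_point I z))"
  by (simp add: cx_op_def cx_scale_def paravector_slice_point linear_add[OF linear_op_of]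
      linear_scale[OF linear_op_of] op_of_axis linear_scale[OF linear_axis] axis_empty_id op.scaleR_left
      unit_op_def)

section \<open>Commuting components\<close>

locale commuting_components =
  fixes T0 :: "'v::banach \<Rightarrow>\<^sub>L 'v" and T1 :: "'n::{finite,linorder} \<Rightarrow> 'v \<Rightarrow>\<^sub>L 'v"
  assumes comm0: "T0 o\<^sub>L T1 j = T1 j o\<^sub>L T0" and comm1: "T1 i o\<^sub>L T1 j = T1 j o\<^sub>L T1 i"
begin

abbreviation T :: "('v, 'n) clop" where "T \<equiv> op_paravector T0 T1"

definition vec_part :: "('v, 'n) clop" where "vec_part = (\<Sum>j\<in>UNIV. axis {j} (T1 j))"

definition M :: "'v \<Rightarrow>\<^sub>L 'v" where "M = (\<Sum>j\<in>UNIV. T1 j o\<^sub>L T1 j)"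

lemma T_eq: "T = axis {} T0 + vec_part"
  by (simp add: op_paravector_def vec_part_def)

lemma op_paravector_nth: "op_paravector a b $ {} = a" "op_paravector a b $ {j} = b j"
proof -
  have "(\<Sum>i\<in>UNIV. axis {i} (b i) $ {j}) = (\<Sum>i\<in>UNIV. if i = j then b j else 0)"
    by (intro sum.cong) (auto simp: axis_def)
  then show "op_paravector a b $ {j} = b j" by (simp add: op_paravector_def axis_def)
  show "op_paravector a b $ {} = a" by (simp add: op_paravector_def axis_def)
qed

lemma op_conj_T: "op_conj T = axis {} T0 - vec_part"
  unfolding op_conj_def op_paravector_nth
  by (simp add: op_paravector_def vec_part_def linear_neg[OF linear_axis] sum_negf)

lemma vec_part_commute:
  assumes "\<And>j. a o\<^sub>L T1 j = T1 j o\<^sub>L a"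
  shows "vec_part \<odot> axis {} a = axis {} a \<odot> vec_part"
  by (simp add: vec_part_def op.sum_left op.sum_right op_mult_axis assms)

lemma vec_part_square: "vec_part \<odot> vec_part = - axis {} M"
  unfolding vec_part_def M_def by (rule vector_part_square[OF comm1])

lemma M_commute: "M o\<^sub>L T1 j = T1 j o\<^sub>L M" "T0 o\<^sub>L M = M o\<^sub>L T0"
proof -
  have "(T1 i o\<^sub>L T1 i) o\<^sub>L T1 j = T1 j o\<^sub>L (T1 i o\<^sub>L T1 i)" for i
    by (metis blinfun_compose_assoc comm1)
  then show "M o\<^sub>L T1 j = T1 j o\<^sub>L M"
    by (simp add: M_def compose.sum_left compose.sum_right)
  have "T0 o\<^sub>L (T1 i o\<^sub>L T1 i) = (T1 i o\<^sub>L T1 i) o\<^sub>L T0" for i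
    by (metis blinfun_compose_assoc comm0)
  then show "T0 o\<^sub>L M = M o\<^sub>L T0"
    by (simp add: M_def compose.sum_left compose.sum_right)
qed

lemma T_mult_conj: "T \<odot> op_conj T = axis {} ((T0 o\<^sub>L T0) + M)"
  unfolding op_conj_T unfolding T_eq
  by (simp add: op.add_left op.diff_right axis_empty_mult vec_part_commute comm0 vec_part_square
      linear_add[OF linear_axis])

text \<open>\<open>z - T\<^sub>0\<close> and \<open>Q(z) = (z - T\<^sub>0)\<^sup>2 + \<Sum>\<^sub>j T\<^sub>j\<^sup>2\<close> in the complexification of \<open>\<B>(V)\<close>; on \<open>\<complex>\<^sub>I\<close> the
  latter is \<open>\<Q>\<^sub>c(s, T)\<close>.\<close>

definition Y :: "complex \<Rightarrow> ('v \<Rightarrow>\<^sub>L 'v) \<times> ('v \<Rightarrow>\<^sub>L 'v)" where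
  "Y z = cx_scale z (id_blinfun, 0) - (T0, 0)"

definition Q :: "complex \<Rightarrow> ('v \<Rightarrow>\<^sub>L 'v) \<times> ('v \<Rightarrow>\<^sub>L 'v)" where
  "Q z = Y z \<otimes>\<^sub>c Y z + (M, 0)"

lemma cx_op_real: "cx_op I (a, 0) = axis {} a"
  by (simp add: cx_op_def linear_0[OF linear_axis] op.zero_left)

lemma cx_op_Y: "cx_op I (Y z) = op_of (paravector (slice_point I z)) - axis {} T0"
  by (simp add: Y_def linear_diff[OF linear_cx_op] cx_op_scale_id cx_op_real)

text \<open>The sum of \<open>T\<close> and its conjugate is twice \<open>T0\<close> and their
  product is the real operator \<open>T0\<^sup>2 + M\<close>. Both commute with s, so the quadratic
  in s completes to a square plus \<open>M\<close>.\<close>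

lemma Qc_eq:
  assumes "I \<in> unit_sphere"
  shows "Qc (slice_point I z) T = cx_op I (Q z)"
proof -
  have sum: "T + op_conj T = axis {} T0 + axis {} T0"
    unfolding op_conj_T by (simp add: T_eq)
  show ?thesis
    unfolding Qc_def sum T_mult_conj op_of_mult
    by (simp add: Q_def linear_add[OF linear_cx_op] cx_op_mult[OF assms] cx_op_Y cx_op_real
        op.diff_left op.diff_right op.add_right axis_empty_mult axis_empty_commute_op_of
        linear_add[OF linear_axis])
qed

text \<open>Invertibility is meant in the complexification of B(V), so no imaginary unit is involved
  and one open set serves all slices.\<close>

definition regular :: "complex set" where
  "regular = {z. \<exists>S. Q z \<otimes>\<^sub>c S = (id_blinfun, 0) \<and> S \<otimes>\<^sub>c Q z = (id_blinfun, 0)}"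

definition R :: "complex \<Rightarrow> ('v \<Rightarrow>\<^sub>L 'v) \<times> ('v \<Rightarrow>\<^sub>L 'v)" where
  "R z = (SOME S. Q z \<otimes>\<^sub>c S = (id_blinfun, 0) \<and> S \<otimes>\<^sub>c Q z = (id_blinfun, 0))"

lemma Q_R:
  assumes "z \<in> regular"
  shows "Q z \<otimes>\<^sub>c R z = (id_blinfun, 0)" "R z \<otimes>\<^sub>c Q z = (id_blinfun, 0)"
  using someI_ex[of "\<lambda>S. Q z \<otimes>\<^sub>c S = (id_blinfun, 0) \<and> S \<otimes>\<^sub>c Q z = (id_blinfun, 0)"] assms
  by (auto simp: regular_def R_def)

lemma R_unique:
  assumes "z \<in> regular" "Q z \<otimes>\<^sub>c S = (id_blinfun, 0)"
  shows "S = R z"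
  using cx_comp_assoc[of "R z" "Q z" S] by (simp add: assms(2) Q_R[OF assms(1)])

lemma op_inv_Qc:
  assumes "I \<in> unit_sphere" "z \<in> regular"
  shows "op_inv (Qc (slice_point I z) T) = cx_op I (R z)"
  by (rule op_inv_eq)
     (simp add: op_inverse_of_def Qc_eq[OF assms(1)] Q_R[OF assms(2)] flip: cx_op_mult[OF assms(1)])

lemma Y_cnj: "Y (cnj z) = cx_conj (Y z)"
  by (simp add: Y_def cx_scale_def cx_conj_def)

lemma Q_cnj: "Q (cnj z) = cx_conj (Q z)"
  by (simp add: Q_def Y_cnj cx_bilinear_conj[OF bounded_bilinear_blinfun_compose])
     (simp add: cx_conj_def)

lemma R_cnj:
  assumes "z \<in> regular"
  shows "cnj z \<in> regular" "R (cnj z) = cx_conj (R z)"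
proof -
  have id: "cx_conj (id_blinfun, 0) = (id_blinfun, 0 :: 'v \<Rightarrow>\<^sub>L 'v)" by (simp add: cx_conj_def)
  have eq: "Q (cnj z) \<otimes>\<^sub>c cx_conj (R z) = (id_blinfun, 0)" "cx_conj (R z) \<otimes>\<^sub>c Q (cnj z) = (id_blinfun, 0)"
    by (simp_all add: Q_cnj Q_R[OF assms] id cx_bilinear_conj[OF bounded_bilinear_blinfun_compose])
  then show reg: "cnj z \<in> regular" unfolding regular_def by blast
  show "R (cnj z) = cx_conj (R z)" using R_unique[OF reg eq(1)] by simp
qed

lemma cx_holomorphic_Y: "cx_holomorphic S Y"
proof -
  have "cx_holomorphic S (\<lambda>z. cx_scale z (id_blinfun, 0) + (- T0, 0))"
    by (intro cx_holomorphic_add cx_holomorphic_cx_scale cx_holomorphic_const)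
  moreover have "cx_scale z (id_blinfun, 0) + (- T0, 0) = Y z" for z
    by (simp add: Y_def prod_eq_iff)
  ultimately show ?thesis by (simp del: plus_prod_def)
qed

lemma cx_holomorphic_Q: "cx_holomorphic S Q"
  unfolding Q_def[abs_def]
  by (intro cx_holomorphic_add cx_holomorphic_const cx_holomorphic_Y
      cx_holomorphic_bilinear[OF bounded_bilinear_blinfun_compose])

lemma open_regular: "open regular"
proof (rule openI)
  fix z assume z: "z \<in> regular"
  obtain d where d: "d > 0" "\<And>x. norm (x - Q z) < d \<Longrightarrow>
      \<exists>y. x \<otimes>\<^sub>c y = (id_blinfun, 0) \<and> y \<otimes>\<^sub>c x = (id_blinfun, 0)"
    using inverse_perturbation[OF cxc.bounded_bilinear_axioms cx_comp_assoc cx_comp_id Q_R[OF z]] by blast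
  have "isCont Q z"
    using cx_holomorphic_continuous[OF cx_holomorphic_Q[of UNIV]] by (simp add: continuous_on_eq_continuous_at)
  then obtain e where "e > 0" "\<And>w. dist w z < e \<Longrightarrow> dist (Q w) (Q z) < d"
    using d(1) unfolding continuous_at_eps_delta by blast
  then show "\<exists>e>0. ball z e \<subseteq> regular"
    using d(2) unfolding regular_def subset_eq by (intro exI[of _ e]) (simp add: dist_norm norm_minus_commute del: split_paired_Ex split_paired_All)
qed

lemma cx_holomorphic_R: "cx_holomorphic regular R"
  by (rule cx_holomorphic_inverse[OF bounded_bilinear_blinfun_compose blinfun_compose_assoc
        id_blinfun_compose open_regular cx_holomorphic_Q]) (simp_all add: Q_R)

text \<open>The grade involution maps \<open>T\<^sup>2 - 2 s\<^sub>0 T + |s|\<^sup>2\<close> to the same polynomial in the conjugate of \<open>T\<close>, and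
  the product of the two is the real operator \<open>Q(z) Q(cnj z)\<close>.\<close>

lemma regular_outside_spectrum:
  assumes I: "I \<in> unit_sphere" and s: "slice_point I z \<notin> S_spectrum T"
  shows "z \<in> regular"
proof -
  define u v where "u = Re z" and "v = Im z"
  \<comment> \<open>With \<open>W = T0 - u\<close> the polynomial \<open>p\<close> becomes
    \<open>A + B vec_part\<close>, where \<open>A = W\<^sup>2 + v\<^sup>2 - M\<close> and
    \<open>B = 2 W\<close>. All operators involved commute, so \<open>p\<close> times its grade
    involution is \<open>A\<^sup>2 + B\<^sup>2 M\<close>.\<close>
  define W where "W = T0 - u *\<^sub>R id_blinfun"
  define P where "P = W o\<^sub>L W"
  define N where "N = (v * v) *\<^sub>R id_blinfun - M"
  define A where "A = P + N"
  define B where "B = W + W"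
  define p where "p = T \<odot> T - (2 * u) *\<^sub>R T + (u\<^sup>2 + v\<^sup>2) *\<^sub>R op_one"
  have "(norm (slice_point I z))\<^sup>2 = u\<^sup>2 + v\<^sup>2"
    using I by (simp add: slice_point_def norm_Pair unit_sphere_def u_def v_def)
  then obtain S where S: "S \<odot> p = op_one" "p \<odot> S = op_one"
    using s by (auto simp: S_spectrum_def op_invertible_def op_inverse_of_def p_def slice_point_def u_def)
  have WM: "W o\<^sub>L M = M o\<^sub>L W" and WT: "W o\<^sub>L T1 j = T1 j o\<^sub>L W" for j
    by (simp_all add: W_def compose.diff_left compose.diff_right compose.scaleR_left
        compose.scaleR_right M_commute comm0)
  have PM: "P o\<^sub>L M = M o\<^sub>L P" and PT: "P o\<^sub>L T1 j = T1 j o\<^sub>L P" for j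
    unfolding P_def by (metis blinfun_compose_assoc WM, metis blinfun_compose_assoc WT)
  have WN: "W o\<^sub>L N = N o\<^sub>L W" and NT: "N o\<^sub>L T1 j = T1 j o\<^sub>L N" for j
    by (simp_all add: N_def compose.diff_left compose.diff_right compose.scaleR_left
        compose.scaleR_right M_commute WM)
  have AT: "A o\<^sub>L T1 j = T1 j o\<^sub>L A" and BT: "B o\<^sub>L T1 j = T1 j o\<^sub>L B" for j
    by (simp_all add: A_def B_def compose.add_left compose.add_right PT NT WT)
  have PN: "P o\<^sub>L N = N o\<^sub>L P"
    unfolding P_def by (metis blinfun_compose_assoc WN)
  have AB: "A o\<^sub>L B = B o\<^sub>L A"
    by (simp add: A_def B_def compose.add_left compose.add_right WN) (simp add: P_def blinfun_compose_assoc)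
  have p: "p = axis {} A + axis {} B \<odot> vec_part"
  proof -
    have "T \<odot> T = axis {} ((T0 o\<^sub>L T0) - M) + axis {} (T0 + T0) \<odot> vec_part"
      by (simp add: T_eq op.add_left op.add_right axis_empty_mult vec_part_commute comm0 vec_part_square
          linear_add[OF linear_axis] linear_diff[OF linear_axis])
    moreover have "A = ((T0 o\<^sub>L T0) - M) - (u *\<^sub>R T0 + u *\<^sub>R T0) + ((u * u) *\<^sub>R id_blinfun + (v * v) *\<^sub>R id_blinfun)"
      by (simp add: A_def P_def N_def W_def compose.diff_left compose.diff_right compose.scaleR_left
          compose.scaleR_right scaleR_diff_right)
    moreover have "B = (T0 + T0) - (u *\<^sub>R id_blinfun + u *\<^sub>R id_blinfun)"
      by (simp add: B_def W_def)
    moreover have "p = T \<odot> T - (u *\<^sub>R T + u *\<^sub>R T) + ((u * u) *\<^sub>R op_one + (v * v) *\<^sub>R op_one)"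
      unfolding p_def power2_eq_square mult_2 scaleR_add_left ..
    ultimately show ?thesis
      by (simp add: T_eq linear_add[OF linear_axis] linear_diff[OF linear_axis]
          linear_scale[OF linear_axis] axis_empty_id op.add_left op.diff_left op.scaleR_left
          scaleR_add_right)
  qed
  have grade: "grade_inv p = axis {} A - axis {} B \<odot> vec_part"
    by (simp add: p linear_add[OF linear_grade_inv] grade_inv_mult grade_inv_axis vec_part_def
        linear_sum[OF linear_grade_inv] linear_neg[OF linear_axis] sum_negf op.minus_right)
  define r where "r = (A o\<^sub>L A) + ((B o\<^sub>L B) o\<^sub>L M)"
  have pp: "p \<odot> grade_inv p = axis {} r"
  proof -
    have "(axis {} B \<odot> vec_part) \<odot> (axis {} B \<odot> vec_part) = - axis {} ((B o\<^sub>L B) o\<^sub>L M)"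
    proof -
      have "(axis {} B \<odot> vec_part) \<odot> (axis {} B \<odot> vec_part)
          = axis {} B \<odot> (vec_part \<odot> axis {} B) \<odot> vec_part"
        by (simp add: op_mult_assoc)
      also have "\<dots> = (axis {} B \<odot> axis {} B) \<odot> (vec_part \<odot> vec_part)"
        by (simp only: vec_part_commute[OF BT] op_mult_assoc)
      finally show ?thesis
        by (simp add: vec_part_square axis_empty_mult op.minus_right)
    qed
    moreover have "axis {} B \<odot> vec_part \<odot> axis {} A = axis {} A \<odot> (axis {} B \<odot> vec_part)"
      by (simp only: op_mult_assoc vec_part_commute[OF AT])
         (simp only: axis_empty_mult AB flip: op_mult_assoc)
    ultimately show ?thesis
      unfolding grade
      by (simp add: p op.add_left op.diff_right axis_empty_mult r_def linear_add[OF linear_axis])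
  qed
  define X where "X = grade_inv S \<odot> S"
  have "X \<odot> axis {} r = op_one" "axis {} r \<odot> X = op_one"
  proof -
    have "grade_inv S \<odot> grade_inv p = op_one" "grade_inv p \<odot> grade_inv S = op_one"
      by (simp_all add: S flip: grade_inv_mult)
    then show "X \<odot> axis {} r = op_one" "axis {} r \<odot> X = op_one"
      unfolding X_def pp[symmetric] using S
      by (metis op_mult_assoc op_one_mult(1))+
  qed
  \<comment> \<open>Comparing the coefficients at \<open>{}\<close> moves the invertibility of
    \<open>r\<close> from the Clifford algebra to B(V).\<close>
  then have "(X \<odot> axis {} r) $ {} = (op_one :: ('v, 'n) clop) $ {}" "(axis {} r \<odot> X) $ {} = (op_one :: ('v, 'n) clop) $ {}" by simp_all
  then have x: "(X $ {}) o\<^sub>L r = id_blinfun" "r o\<^sub>L (X $ {}) = id_blinfun"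
    unfolding axis_empty_mult_nth by (simp_all add: op_one_def axis_def)
  define C where "C = P - N"
  define E where "E = v *\<^sub>R B"
  have Y: "Y z = (- W, v *\<^sub>R id_blinfun)"
    by (simp add: Y_def W_def cx_scale_def u_def v_def)
  have Q: "Q z = (C, - E)"
    by (simp add: Q_def Y cx_bilinear_def C_def E_def B_def P_def N_def compose.minus_left
        compose.minus_right compose.scaleR_left compose.scaleR_right scaleR_add_right)
  have CE: "C o\<^sub>L E = E o\<^sub>L C"
  proof -
    have "C o\<^sub>L B = B o\<^sub>L C"
      by (simp add: C_def B_def compose.diff_left compose.diff_right compose.add_left compose.add_right WN)
         (simp add: P_def blinfun_compose_assoc)
    then show ?thesis by (simp add: E_def compose.scaleR_left compose.scaleR_right)
  qed
  \<comment> \<open>The identity is \<open>(P + N)\<^sup>2 = (P - N)\<^sup>2 + 4 P N\<close>,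
    together with \<open>E\<^sup>2 = 4 v\<^sup>2 P\<close> and
    \<open>v\<^sup>2 = M + N\<close>.\<close>
  have r: "r = (C o\<^sub>L C) + (E o\<^sub>L E)"
  proof -
    have "E o\<^sub>L E = (v * v) *\<^sub>R (B o\<^sub>L B)"
      by (simp add: E_def compose.scaleR_left compose.scaleR_right)
    also have "\<dots> = ((B o\<^sub>L B) o\<^sub>L M) + ((B o\<^sub>L B) o\<^sub>L N)"
      by (simp add: N_def compose.diff_right compose.scaleR_right)
    also have "(B o\<^sub>L B) o\<^sub>L N = (P o\<^sub>L N) + (P o\<^sub>L N) + ((P o\<^sub>L N) + (P o\<^sub>L N))"
      by (simp add: B_def P_def compose.add_left compose.add_right)
    finally show ?thesis
      by (simp add: r_def A_def C_def compose.add_left compose.add_right compose.diff_left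
          compose.diff_right PN)
  qed
  \<comment> \<open>This is the conjugate of \<open>Q z\<close>, so the product with
    \<open>Q z\<close> is the sum of squares \<open>r\<close>, whose inverse is now available in
    B(V).\<close>
  define Qr :: "('v \<Rightarrow>\<^sub>L 'v) \<times> ('v \<Rightarrow>\<^sub>L 'v)" where "Qr = (C, E)"
  have QQ: "Q z \<otimes>\<^sub>c Qr = (r, 0)" "Qr \<otimes>\<^sub>c Q z = (r, 0)"
    by (simp_all add: Qr_def Q cx_bilinear_def r CE compose.minus_left compose.minus_right)
  have "Q z \<otimes>\<^sub>c (Qr \<otimes>\<^sub>c (X $ {}, 0)) = (id_blinfun, 0)"
    by (simp add: QQ flip: cx_comp_assoc) (simp add: cx_bilinear_def x compose.zero_left compose.zero_right)
  moreover have "((X $ {}, 0) \<otimes>\<^sub>c Qr) \<otimes>\<^sub>c Q z = (id_blinfun, 0)"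
    by (simp add: QQ cx_comp_assoc) (simp add: cx_bilinear_def x compose.zero_left compose.zero_right)
  ultimately have "(X $ {}, 0) \<otimes>\<^sub>c Qr = Qr \<otimes>\<^sub>c (X $ {}, 0)"
    by (metis cx_comp_assoc cx_comp_id)
  then show ?thesis
    using \<open>Q z \<otimes>\<^sub>c (Qr \<otimes>\<^sub>c (X $ {}, 0)) = (id_blinfun, 0)\<close>
      \<open>((X $ {}, 0) \<otimes>\<^sub>c Qr) \<otimes>\<^sub>c Q z = (id_blinfun, 0)\<close>
    unfolding regular_def by (intro CollectI exI[of _ "Qr \<otimes>\<^sub>c (X $ {}, 0)"]) simp
qed

end

section \<open>Slices\<close>

lemma axially_symmetric_slice:
  assumes "axially_symmetric U" "I \<in> unit_sphere" "J \<in> unit_sphere" "(u, v *\<^sub>R I) \<in> U" "\<bar>w\<bar> = \<bar>v\<bar>"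
  shows "(u, w *\<^sub>R J) \<in> U"
proof -
  \<comment> \<open>Axial symmetry only reaches nonnegative multiples of a unit, so a negative
    \<open>w\<close> is absorbed into the unit.\<close>
  define K where "K = (if w < 0 then - J else J)"
  have "K \<in> unit_sphere" using assms(3) by (simp add: K_def unit_sphere_def)
  then have "(u, norm (v *\<^sub>R I) *\<^sub>R K) \<in> U"
    using assms(1,4) unfolding axially_symmetric_def by fastforce
  moreover have "norm (v *\<^sub>R I) *\<^sub>R K = w *\<^sub>R J"
    using assms(2,5) by (auto simp: K_def unit_sphere_def abs_if split: if_splits)
  ultimately show ?thesis by simp
qed

lemma slice_of_independent:
  assumes "axially_symmetric U" "I \<in> unit_sphere" "J \<in> unit_sphere"
  shows "slice_of I U = slice_of J U"
proof -
  have "(Re z, Im z *\<^sub>R I) \<in> U \<longleftrightarrow> (Re z, Im z *\<^sub>R J) \<in> U" for z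
    by (intro iffI) (erule axially_symmetric_slice[OF assms(1,2,3) _ refl] axially_symmetric_slice[OF assms(1,3,2) _ refl])+
  then show ?thesis by (simp add: slice_of_def slice_point_def)
qed

lemma slice_of_cnj:
  assumes "axially_symmetric U" "I \<in> unit_sphere" "z \<in> slice_of I U"
  shows "cnj z \<in> slice_of I U"
  using axially_symmetric_slice[OF assms(1,2,2), of "Re z" "Im z" "- Im z"] assms(3)
  by (simp add: slice_of_def slice_point_def)

lemma slice_params_iff:
  assumes "axially_symmetric U" "I \<in> unit_sphere"
  shows "(Re z, Im z) \<in> slice_params U \<longleftrightarrow> z \<in> slice_of I U"
proof -
  have "(\<forall>J\<in>unit_sphere. (Re z, Im z *\<^sub>R J) \<in> U) \<longleftrightarrow> (Re z, Im z *\<^sub>R I) \<in> U"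
    using axially_symmetric_slice[OF assms(1,2) _ _ refl] assms(2) by blast
  then show ?thesis by (simp add: slice_params_def slice_of_def slice_point_def)
qed

lemma continuous_slice_point: "continuous_on A (slice_point I)"
  unfolding slice_point_def by (intro continuous_intros)

lemma open_slice_of:
  assumes "open U"
  shows "open (slice_of I U)"
  unfolding slice_of_def using open_vimage[OF assms continuous_slice_point[of UNIV I]] by (simp add: vimage_def)

lemma closure_slice_of: "closure (slice_of I U) \<subseteq> slice_of I (closure U)"
proof (rule closure_minimal)
  show "slice_of I U \<subseteq> slice_of I (closure U)"
    using closure_subset by (auto simp: slice_of_def)
  show "closed (slice_of I (closure U))"
    unfolding slice_of_def using closed_vimage[OF closed_closure continuous_slice_point[of UNIV I]]
    by (simp add: vimage_def)
qed

section \<open>Stem functions\<close>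

text \<open>In finite dimension continuity of the derivative is automatic: every coordinate is a
  scalar holomorphic function. This covers stem functions, which are only assumed
  differentiable.\<close>

lemma cx_holomorphic_vec:
  fixes F :: "complex \<Rightarrow> (real ^ 'm::finite) \<times> (real ^ 'm)"
  assumes S: "open S" and F: "\<And>z. z \<in> S \<Longrightarrow> (F has_derivative (\<lambda>h. cx_scale h (F' z))) (at z)"
  shows "cx_holomorphic S F"
proof (rule cx_holomorphicI[OF _ F])
  define k where "k A z = Complex (fst (F z) $ A) (snd (F z) $ A)" for A z
  have k: "(k A has_field_derivative Complex (fst (F' z) $ A) (snd (F' z) $ A)) (at z)" if "z \<in> S" for A z
  proof -
    have L: "bounded_linear (\<lambda>p :: (real ^ 'm) \<times> (real ^ 'm). Complex (fst p $ A) (snd p $ A))"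
      unfolding Complex_eq
      by (intro bounded_linear_add bounded_linear_const_mult bounded_linear_compose[OF bounded_linear_of_real]
          bounded_linear_compose[OF bounded_linear_vec_nth] bounded_linear_fst bounded_linear_snd)
    show ?thesis
      unfolding has_field_derivative_def k_def
      using bounded_linear.has_derivative[OF L F[OF that]]
      by (rule has_derivative_eq_rhs) (auto simp: cx_scale_def complex_eq_iff fun_eq_iff)
  qed
  have "continuous_on S (deriv (k A))" for A
  proof (intro holomorphic_on_imp_continuous_on holomorphic_deriv S)
    show "k A holomorphic_on S"
      using k by (meson field_differentiable_at_within field_differentiable_def holomorphic_onI)
  qed
  then have "continuous_on S (\<lambda>z. (\<chi> A. Re (deriv (k A) z), \<chi> A. Im (deriv (k A) z)))"
    by (intro continuous_on_Pair continuous_on_vec_lambda continuous_on_Re continuous_on_Im)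
  moreover have "(\<chi> A. Re (deriv (k A) z), \<chi> A. Im (deriv (k A) z)) = F' z" if "z \<in> S" for z
    using DERIV_imp_deriv[OF k[OF that]] by (simp add: prod_eq_iff vec_eq_iff)
  ultimately show "continuous_on S F'"
    by (simp cong: continuous_on_cong)
qed

text \<open>The Cauchy-Riemann equations say that the real derivative of the pair is complex
  multiplication, by the pair of partial derivatives in the direction \<open>(1, 0)\<close>.\<close>

lemma cx_holomorphic_stem:
  fixes \<alpha> \<beta> :: "real \<times> real \<Rightarrow> real ^ 'm::finite"
  assumes D: "open D" "axially_symmetric D" "I \<in> unit_sphere" and stem: "stem_pair (slice_params D) \<alpha> \<beta>"
  shows "cx_holomorphic (slice_of I D) (\<lambda>z. (\<alpha> (Re z, Im z), \<beta> (Re z, Im z)))"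
proof -
  have "\<exists>d. ((\<lambda>z. (\<alpha> (Re z, Im z), \<beta> (Re z, Im z))) has_derivative (\<lambda>h. cx_scale h d)) (at z)"
    if z: "z \<in> slice_of I D" for z
  proof -
    have "(Re z, Im z) \<in> slice_params D"
      using slice_params_iff[OF D(2,3)] z by simp
    then obtain A B where AB: "(\<alpha> has_derivative A) (at (Re z, Im z))" "(\<beta> has_derivative B) (at (Re z, Im z))"
      "A (1, 0) = B (0, 1)" "A (0, 1) = - B (1, 0)"
      using stem unfolding stem_pair_def by blast
    have split: "(Re h, Im h) = Re h *\<^sub>R (1, 0) + Im h *\<^sub>R (0, 1)" for h by simp
    have A: "A (Re h, Im h) = Re h *\<^sub>R A (1, 0) - Im h *\<^sub>R B (1, 0)" for h
      unfolding split[of h] using AB(4) has_derivative_linear[OF AB(1)]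
      by (simp only: linear_add linear_scale) simp
    have B: "B (Re h, Im h) = Re h *\<^sub>R B (1, 0) + Im h *\<^sub>R A (1, 0)" for h
      unfolding split[of h] using AB(3) has_derivative_linear[OF AB(2)]
      by (simp only: linear_add linear_scale)
    have P: "((\<lambda>z. (Re z, Im z)) has_derivative (\<lambda>h. (Re h, Im h))) (at z)"
      by (intro has_derivative_Pair has_derivative_Re has_derivative_Im has_derivative_ident)
    have "((\<lambda>z. (\<alpha> (Re z, Im z), \<beta> (Re z, Im z))) has_derivative (\<lambda>h. (A (Re h, Im h), B (Re h, Im h)))) (at z)"
      by (intro has_derivative_Pair has_derivative_compose[OF P] AB)
    then show ?thesis
      by (intro exI[of _ "(A (1, 0), B (1, 0))"]) (simp add: A B cx_scale_def)
  qed
  then have "\<forall>z\<in>slice_of I D. \<exists>d.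
      ((\<lambda>z. (\<alpha> (Re z, Im z), \<beta> (Re z, Im z))) has_derivative (\<lambda>h. cx_scale h d)) (at z)"
    by blast
  from bchoice[OF this] obtain F' where "\<And>z. z \<in> slice_of I D \<Longrightarrow>
      ((\<lambda>z. (\<alpha> (Re z, Im z), \<beta> (Re z, Im z))) has_derivative (\<lambda>h. cx_scale h (F' z))) (at z)"
    by blast
  then show ?thesis
    by (rule cx_holomorphic_vec[OF open_slice_of[OF D(1)]])
qed

lemma stem_cnj:
  assumes "axially_symmetric D" "I \<in> unit_sphere" "stem_pair (slice_params D) \<alpha> \<beta>" "z \<in> slice_of I D"
  shows "(\<alpha> (Re (cnj z), Im (cnj z)), \<beta> (Re (cnj z), Im (cnj z)))
       = cx_conj (\<alpha> (Re z, Im z), \<beta> (Re z, Im z))"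
proof -
  have "(Re z, Im z) \<in> slice_params D" using slice_params_iff assms by blast
  then show ?thesis using assms(3) by (auto simp: stem_pair_def cx_conj_def)
qed

section \<open>The integral as a contour integral in the complexification\<close>

lemma op_of_ds_slice:
  assumes "I \<in> unit_sphere"
  shows "op_of (ds_slice I \<gamma> t) =
    Im (vector_derivative \<gamma> (at t within {0..1})) *\<^sub>R op_one
    - Re (vector_derivative \<gamma> (at t within {0..1})) *\<^sub>R unit_op I"
  unfolding ds_slice_def op_of_mult paravector_slice_point
  by (simp add: linear_add[OF linear_op_of] linear_scale[OF linear_op_of] linear_neg[OF linear_op_of]
      op_of_axis axis_empty_id op.minus_right op.add_left op.scaleR_left unit_op_square[OF assms]
      flip: unit_op_def)

text \<open>The eight terms are sorted by the number of factors \<open>I\<close>. An even number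
  reduces to a sign and gives the first summand; an odd number leaves one \<open>I\<close> between
  the outer factors and gives the second. The middle factor is \<open>- w I\<close> on the
  slice.\<close>

lemma left_product_expand:
  fixes w :: complex
  assumes I: "I \<in> unit_sphere"
  shows "(a + b \<odot> unit_op I) \<odot> (Im w *\<^sub>R op_one - Re w *\<^sub>R unit_op I) \<odot> (c + unit_op I \<odot> d)
    = snd (cx_scale w (cx_bilinear (\<odot>) (a, b) (c, d)))
      - fst (cx_scale w (cx_bilinear (\<lambda>x y. x \<odot> unit_op I \<odot> y) (a, b) (c, d)))"
  by (simp add: cx_scale_def cx_bilinear_def op.add_left op.add_right op.diff_left op.diff_right
      op.minus_left op.minus_right op.scaleR_left op.scaleR_right op_mult_assoc
      unit_op_mult_left[OF I] unit_op_square[OF I] scaleR_add_right scaleR_diff_right)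

text \<open>The kernel is now the right factor. The bilinear maps are written with swapped
  arguments, so the kernel pair comes first as in the left case.\<close>

lemma right_product_expand:
  fixes w :: complex
  assumes I: "I \<in> unit_sphere"
  shows "(c + d \<odot> unit_op I) \<odot> (Im w *\<^sub>R op_one - Re w *\<^sub>R unit_op I) \<odot> (a + unit_op I \<odot> b)
    = snd (cx_scale w (cx_bilinear (\<lambda>x y. y \<odot> x) (a, b) (c, d)))
      - fst (cx_scale w (cx_bilinear (\<lambda>x y. y \<odot> unit_op I \<odot> x) (a, b) (c, d)))"
  by (simp add: cx_scale_def cx_bilinear_def op.add_left op.add_right op.diff_left op.diff_right
      op.minus_left op.minus_right op.scaleR_left op.scaleR_right op_mult_assoc
      unit_op_mult_left[OF I] unit_op_square[OF I] scaleR_add_right scaleR_diff_right)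

context commuting_components
begin

text \<open>Components of the left kernel with respect to 1 and \<open>I\<close>. The conjugate of
  \<open>T\<close> contains generators and does not commute with \<open>I\<close>, so it stays a
  left multiplier of both components, while the factor s is absorbed into the complexified
  operators.\<close>

definition left_pair :: "nat \<Rightarrow> nat \<Rightarrow> real \<Rightarrow> complex \<Rightarrow> ('v, 'n) clop \<times> ('v, 'n) clop" where
  "left_pair m k c z = (let G = cx_power (R z) m \<otimes>\<^sub>c cx_power (Y z) k in
     map_prod (\<lambda>x. c *\<^sub>R axis {} x) (\<lambda>x. c *\<^sub>R axis {} x) (cx_scale z (id_blinfun, 0) \<otimes>\<^sub>c G)
     + map_prod (\<lambda>x. - c *\<^sub>R (op_conj T \<odot> axis {} x)) (\<lambda>x. - c *\<^sub>R (op_conj T \<odot> axis {} x)) G)"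

definition right_pair :: "nat \<Rightarrow> nat \<Rightarrow> real \<Rightarrow> complex \<Rightarrow> ('v, 'n) clop \<times> ('v, 'n) clop" where
  "right_pair m k c z = (let G = cx_power (Y z) k \<otimes>\<^sub>c cx_power (R z) m in
     map_prod (\<lambda>x. c *\<^sub>R axis {} x) (\<lambda>x. c *\<^sub>R axis {} x) (G \<otimes>\<^sub>c cx_scale z (id_blinfun, 0))
     + map_prod (\<lambda>x. - c *\<^sub>R (axis {} x \<odot> op_conj T)) (\<lambda>x. - c *\<^sub>R (axis {} x \<odot> op_conj T)) G)"

lemma cx_op_left_pair:
  assumes I: "I \<in> unit_sphere" and z: "z \<in> regular"
  shows "c *\<^sub>R (((op_of (paravector (slice_point I z)) - op_conj T) \<odot> op_pow (op_inv (Qc (slice_point I z) T)) m)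
      \<odot> op_pow (op_of (paravector (slice_point I z)) - axis {} T0) k)
    = fst (left_pair m k c z) + snd (left_pair m k c z) \<odot> unit_op I"
proof -
  define G where "G = cx_power (R z) m \<otimes>\<^sub>c cx_power (Y z) k"
  have "op_pow (op_inv (Qc (slice_point I z) T)) m
      \<odot> op_pow (op_of (paravector (slice_point I z)) - axis {} T0) k = cx_op I G"
    by (simp add: G_def op_inv_Qc[OF I z] cx_op_mult[OF I] cx_op_power[OF I] flip: cx_op_Y)
  then have "((op_of (paravector (slice_point I z)) - op_conj T) \<odot> op_pow (op_inv (Qc (slice_point I z) T)) m)
      \<odot> op_pow (op_of (paravector (slice_point I z)) - axis {} T0) k
    = cx_op I (cx_scale z (id_blinfun, 0) \<otimes>\<^sub>c G) - op_conj T \<odot> cx_op I G"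
    by (simp add: op_mult_assoc op.diff_left cx_op_mult[OF I] cx_op_scale_id)
  then show ?thesis
    unfolding left_pair_def G_def[symmetric] Let_def
    by (simp add: cx_op_def op.add_left op.add_right op.diff_left op.minus_left op.scaleR_left scaleR_diff_right
        scaleR_add_right op_mult_assoc)
qed

lemma cx_op_right_pair:
  assumes I: "I \<in> unit_sphere" and z: "z \<in> regular"
  shows "c *\<^sub>R (op_pow (op_of (paravector (slice_point I z)) - axis {} T0) k
      \<odot> (op_pow (op_inv (Qc (slice_point I z) T)) m \<odot> (op_of (paravector (slice_point I z)) - op_conj T)))
    = fst (right_pair m k c z) + unit_op I \<odot> snd (right_pair m k c z)"
proof -
  define G where "G = cx_power (Y z) k \<otimes>\<^sub>c cx_power (R z) m"
  have "op_pow (op_of (paravector (slice_point I z)) - axis {} T0) k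
      \<odot> op_pow (op_inv (Qc (slice_point I z) T)) m = cx_op I G"
    by (simp add: G_def op_inv_Qc[OF I z] cx_op_mult[OF I] cx_op_power[OF I] flip: cx_op_Y)
  then have "op_pow (op_of (paravector (slice_point I z)) - axis {} T0) k
      \<odot> (op_pow (op_inv (Qc (slice_point I z) T)) m \<odot> (op_of (paravector (slice_point I z)) - op_conj T))
    = cx_op I (G \<otimes>\<^sub>c cx_scale z (id_blinfun, 0)) - cx_op I G \<odot> op_conj T"
    by (simp add: op.diff_right cx_op_mult[OF I] cx_op_scale_id flip: op_mult_assoc)
  then show ?thesis
    unfolding right_pair_def G_def[symmetric] Let_def
    by (simp add: cx_op_def op.add_left op.add_right op.diff_right op.minus_right op.scaleR_right scaleR_diff_right
        scaleR_add_right op_mult_assoc flip: unit_op_commute)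
qed

section \<open>Holomorphy and reflection symmetry of the kernel pairs\<close>

lemma bounded_linear_scaled_axis: "bounded_linear (\<lambda>x :: 'v \<Rightarrow>\<^sub>L 'v. c *\<^sub>R (axis {} x :: ('v, 'n) clop))"
  by (rule bounded_linear_compose[OF bounded_linear_scaleR_right bounded_linear_axis])

lemma cx_holomorphic_left_pair: "cx_holomorphic regular (left_pair m k c)"
  unfolding left_pair_def[abs_def] Let_def
  by (intro cx_holomorphic_add cx_holomorphic_map cx_holomorphic_bilinear[OF bounded_bilinear_blinfun_compose]
      cx_holomorphic_power cx_holomorphic_R cx_holomorphic_Y cx_holomorphic_cx_scale
      bounded_linear_scaled_axis bounded_linear_compose[OF bounded_linear_scaleR_right]
      bounded_linear_compose[OF op.bounded_linear_right] bounded_linear_axis)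

lemma cx_holomorphic_right_pair: "cx_holomorphic regular (right_pair m k c)"
  unfolding right_pair_def[abs_def] Let_def
  by (intro cx_holomorphic_add cx_holomorphic_map cx_holomorphic_bilinear[OF bounded_bilinear_blinfun_compose]
      cx_holomorphic_power cx_holomorphic_R cx_holomorphic_Y cx_holomorphic_cx_scale
      bounded_linear_scaled_axis bounded_linear_compose[OF bounded_linear_scaleR_right]
      bounded_linear_compose[OF op.bounded_linear_left] bounded_linear_axis)

lemma map_prod_cx_conj: "linear L \<Longrightarrow> map_prod L L (cx_conj p) = cx_conj (map_prod L L p)"
  by (simp add: cx_conj_def map_prod_def split_beta linear_neg)

lemma cx_conj_add: "cx_conj (p + q) = cx_conj p + cx_conj q"
  by (simp add: cx_conj_def)

lemma pair_linear:
  "linear (\<lambda>x. c *\<^sub>R (axis {} x :: ('v, 'n) clop))"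
  "linear (\<lambda>x. c *\<^sub>R (b \<odot> (axis {} x :: ('v, 'n) clop)))"
  "linear (\<lambda>x. c *\<^sub>R ((axis {} x :: ('v, 'n) clop) \<odot> b))"
  by (auto intro!: linearI simp: linear_add[OF linear_axis] linear_scale[OF linear_axis] op.add_left
      op.add_right op.scaleR_left op.scaleR_right scaleR_add_right)

lemma cx_scale_cnj_id: "cx_scale (cnj z) (id_blinfun, 0) = cx_conj (cx_scale z (id_blinfun, 0))"
  by (simp add: cx_scale_def cx_conj_def)

lemma left_pair_cnj:
  assumes "z \<in> regular"
  shows "left_pair m k c (cnj z) = cx_conj (left_pair m k c z)"
  unfolding left_pair_def Let_def R_cnj(2)[OF assms] Y_cnj cx_power_conj cx_scale_cnj_id
  by (simp only: cx_bilinear_conj[OF bounded_bilinear_blinfun_compose] map_prod_cx_conj[OF pair_linear(1)]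
      map_prod_cx_conj[OF pair_linear(2)] cx_conj_add)

lemma right_pair_cnj:
  assumes "z \<in> regular"
  shows "right_pair m k c (cnj z) = cx_conj (right_pair m k c z)"
  unfolding right_pair_def Let_def R_cnj(2)[OF assms] Y_cnj cx_power_conj cx_scale_cnj_id
  by (simp only: cx_bilinear_conj[OF bounded_bilinear_blinfun_compose] map_prod_cx_conj[OF pair_linear(1)]
      map_prod_cx_conj[OF pair_linear(3)] cx_conj_add)

text \<open>By axial symmetry the slices of \<open>U\<close> are the same complex set for every
  unit, so a contour that belongs to \<open>I\<close> can be used in the slice of any
  \<open>J\<close>. This allows contours for different units and domains to be compared in one open
  set.\<close>

lemma admissible_contour_slice:
  assumes adm: "admissible_contour D T U I \<Gamma>" and D: "axially_symmetric D" and J: "J \<in> unit_sphere"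
  defines "S \<equiv> regular \<inter> slice_of J D" and "W \<equiv> slice_of J U"
  shows "I \<in> unit_sphere" "pos_oriented_boundary W \<Gamma>" "frontier W \<subseteq> S"
    "\<And>w. w \<notin> S \<Longrightarrow> w \<in> W \<or> w \<notin> slice_of J D \<and> w \<notin> closure W"
    "\<And>w. w \<notin> regular \<Longrightarrow> w \<in> W" "closure W \<subseteq> slice_of J D"
    "\<And>z. z \<in> W \<Longrightarrow> cnj z \<in> W"
proof -
  have U: "open U" "axially_symmetric U" "S_spectrum T \<subseteq> U" "closure U \<subseteq> D"
    and I: "I \<in> unit_sphere" and \<Gamma>: "pos_oriented_boundary (slice_of I U) \<Gamma>"
    using adm by (auto simp: admissible_contour_def bounded_slice_cauchy_domain_def)
  show "I \<in> unit_sphere" by (rule I)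
  show "pos_oriented_boundary W \<Gamma>"
    using \<Gamma> slice_of_independent[OF U(2) I J] by (simp add: W_def)
  show reg: "w \<in> W" if "w \<notin> regular" for w
    using regular_outside_spectrum[OF J] U(3) that by (auto simp: W_def slice_of_def)
  show clos: "closure W \<subseteq> slice_of J D"
    using closure_slice_of[of J U] U(4) by (auto simp: W_def slice_of_def)
  have "open W" unfolding W_def by (rule open_slice_of[OF U(1)])
  then have "frontier W = closure W - W" by (simp add: frontier_def interior_open)
  then show "frontier W \<subseteq> S" using reg clos by (auto simp: S_def)
  \<comment> \<open>A point leaves \<open>S\<close> for one of two reasons: it is not regular, hence
    inside \<open>W\<close>, or it lies outside the slice of \<open>D\<close>, hence outside the
    closure of \<open>W\<close>.\<close>
  show "w \<in> W \<or> w \<notin> slice_of J D \<and> w \<notin> closure W" if "w \<notin> S" for w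
    using that reg[of w] clos by (auto simp: S_def)
  show "cnj z \<in> W" if "z \<in> W" for z
    using slice_of_cnj[OF U(2) J] that by (simp add: W_def)
qed

text \<open>Covers the left and the right integral: \<open>B\<close> multiplies kernel and function,
  and \<open>C I\<close> does the same with \<open>I\<close> in between. The symmetry of
  \<open>P\<close> and \<open>F\<close> under conjugation is what removes the \<open>C I\<close>
  part.\<close>

theorem slice_integral_well_defined:
  fixes B :: "('v, 'n) clop \<Rightarrow> 'c::real_normed_vector \<Rightarrow> ('v, 'n) clop"
  assumes D: "open D" "axially_symmetric D"
    and B: "bounded_bilinear B" and C: "\<And>I. bounded_bilinear (C I)"
    and P: "cx_holomorphic regular P" "\<And>z. z \<in> regular \<Longrightarrow> P (cnj z) = cx_conj (P z)"
    and F: "\<And>I. I \<in> unit_sphere \<Longrightarrow> cx_holomorphic (slice_of I D) F"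
      "\<And>I z. I \<in> unit_sphere \<Longrightarrow> z \<in> slice_of I D \<Longrightarrow> F (cnj z) = cx_conj (F z)"
    and G: "\<And>I \<gamma> t. I \<in> unit_sphere \<Longrightarrow> \<gamma> t \<in> regular \<Longrightarrow> \<gamma> t \<in> slice_of I D \<Longrightarrow> G I \<gamma> t
      = snd (cx_scale (vector_derivative \<gamma> (at t within {0..1})) (cx_bilinear B (P (\<gamma> t)) (F (\<gamma> t))))
        - fst (cx_scale (vector_derivative \<gamma> (at t within {0..1})) (cx_bilinear (C I) (P (\<gamma> t)) (F (\<gamma> t))))"
  shows "(\<forall>U I \<Gamma>. admissible_contour D T U I \<Gamma> \<longrightarrow> (\<forall>\<gamma>\<in>\<Gamma>. G I \<gamma> integrable_on {0..1})) \<and>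
    (\<forall>U I \<Gamma> U' I' \<Gamma>'. admissible_contour D T U I \<Gamma> \<longrightarrow> admissible_contour D T U' I' \<Gamma>' \<longrightarrow>
       (\<Sum>\<gamma>\<in>\<Gamma>. integral {0..1} (G I \<gamma>)) = (\<Sum>\<gamma>\<in>\<Gamma>'. integral {0..1} (G I' \<gamma>)))"
proof -
  define K0 where "K0 z = cx_bilinear B (P z) (F z)" for z
  define K1 where "K1 I z = cx_bilinear (C I) (P z) (F z)" for I z
  have holo: "cx_holomorphic (regular \<inter> slice_of I D) K0" "cx_holomorphic (regular \<inter> slice_of I D) (K1 J)"
    if "I \<in> unit_sphere" for I J
    unfolding K0_def[abs_def] K1_def[abs_def]
    by (intro cx_holomorphic_bilinear B C cx_holomorphic_subset[OF P(1)] cx_holomorphic_subset[OF F(1)[OF that]]; blast)+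
  have openS: "open (regular \<inter> slice_of I D)" for I
    by (intro open_Int open_regular open_slice_of D)
  have step: "(\<forall>\<gamma>\<in>\<Gamma>. G I \<gamma> integrable_on {0..1}) \<and>
      (\<Sum>\<gamma>\<in>\<Gamma>. integral {0..1} (G I \<gamma>)) = (\<Sum>\<gamma>\<in>\<Gamma>. snd (cx_contour_integral \<gamma> K0))"
    if adm: "admissible_contour D T U I \<Gamma>" for U I \<Gamma>
  proof -
    have I: "I \<in> unit_sphere" using adm by (simp add: admissible_contour_def)
    note A = admissible_contour_slice[OF adm D(2) I]
    note \<Gamma> = pos_oriented_boundaryD[OF A(2)]
    let ?S = "regular \<inter> slice_of I D"
    have img: "path_image \<gamma> \<subseteq> ?S" if "\<gamma> \<in> \<Gamma>" for \<gamma> using \<Gamma>(4)[OF that] A(3) by blast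
    have int: "(G I \<gamma> has_integral snd (cx_contour_integral \<gamma> K0) - fst (cx_contour_integral \<gamma> (K1 I))) {0..1}"
      if \<gamma>: "\<gamma> \<in> \<Gamma>" for \<gamma>
    proof -
      let ?v = "\<lambda>t. vector_derivative \<gamma> (at t within {0..1})"
      have "((\<lambda>t. cx_scale (?v t) (k (\<gamma> t))) has_integral cx_contour_integral \<gamma> k) {0..1}"
        if "cx_holomorphic ?S k" for k :: "complex \<Rightarrow> ('v, 'n) clop \<times> ('v, 'n) clop"
        unfolding cx_contour_integral_def
        by (intro integrable_integral cx_contour_integrable[OF openS that \<Gamma>(2)[OF \<gamma>] img[OF \<gamma>]])
      note h = this[OF holo(1)[OF I]] this[OF holo(2)[OF I]]
      have "((\<lambda>t. snd (cx_scale (?v t) (K0 (\<gamma> t))) - fst (cx_scale (?v t) (K1 I (\<gamma> t)))) has_integral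
          snd (cx_contour_integral \<gamma> K0) - fst (cx_contour_integral \<gamma> (K1 I))) {0..1}"
        using has_integral_diff[OF has_integral_linear[OF h(1) bounded_linear_snd]
            has_integral_linear[OF h(2) bounded_linear_fst]] by (simp add: o_def)
      moreover have "G I \<gamma> t = snd (cx_scale (?v t) (K0 (\<gamma> t))) - fst (cx_scale (?v t) (K1 I (\<gamma> t)))"
        if "t \<in> {0..1}" for t
      proof -
        have "\<gamma> t \<in> ?S" using that img[OF \<gamma>] by (auto simp: path_image_def)
        then show ?thesis unfolding K0_def K1_def by (intro G I) auto
      qed
      ultimately show ?thesis
        by (subst has_integral_cong) auto
    qed
    have "(\<Sum>\<gamma>\<in>\<Gamma>. fst (cx_contour_integral \<gamma> (K1 I))) = 0"
    proof (rule fst_cx_contour_integral_symmetric_boundary[OF openS holo(2)[OF I] A(2,3)])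
      show "w \<in> slice_of I U \<or> w \<notin> closure (slice_of I U)" if "w \<notin> ?S" for w
        using A(4)[OF that] by blast
      show "cnj z \<in> ?S" if "z \<in> ?S" for z
        using that R_cnj(1) slice_of_cnj[OF D(2) I] by blast
      show "cnj z \<in> slice_of I U" if "z \<in> slice_of I U" for z by (rule A(7)[OF that])
      show "K1 I (cnj z) = cx_conj (K1 I z)" if "z \<in> ?S" for z
        using that P(2) F(2)[OF I] by (simp add: K1_def cx_bilinear_conj[OF C])
    qed
    then have "(\<Sum>\<gamma>\<in>\<Gamma>. integral {0..1} (G I \<gamma>)) = (\<Sum>\<gamma>\<in>\<Gamma>. snd (cx_contour_integral \<gamma> K0))"
      using sum.cong[OF refl integral_unique[OF int], of \<Gamma>] by (simp add: sum_subtractf)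
    then show ?thesis using int by auto
  qed
  moreover have "(\<Sum>\<gamma>\<in>\<Gamma>. snd (cx_contour_integral \<gamma> K0)) = (\<Sum>\<gamma>\<in>\<Gamma>'. snd (cx_contour_integral \<gamma> K0))"
    if adm: "admissible_contour D T U I \<Gamma>" and adm': "admissible_contour D T U' I' \<Gamma>'" for U I \<Gamma> U' I' \<Gamma>'
  proof -
    have I: "I \<in> unit_sphere" using adm by (simp add: admissible_contour_def)
    \<comment> \<open>Both contours are placed in the slice of the first unit; \<open>I'\<close> no
      longer occurs after this.\<close>
    note A = admissible_contour_slice[OF adm D(2) I] and A' = admissible_contour_slice[OF adm' D(2) I]
    have "(\<Sum>\<gamma>\<in>\<Gamma>. cx_contour_integral \<gamma> K0) = (\<Sum>\<gamma>\<in>\<Gamma>'. cx_contour_integral \<gamma> K0)"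
      using A(5,6) A'(5,6)
      by (intro cx_contour_integral_boundary_eq[OF openS holo(1)[OF I] A(2,3) A'(2,3)]) blast
    then show ?thesis by (simp flip: snd_sum)
  qed
  ultimately show ?thesis by metis
qed

section \<open>The left and right integrals as instances of the slice integral\<close>

theorem left_slice_integral_well_defined:
  assumes "left_slice_hyperholomorphic D f"
  shows "(\<forall>U I \<Gamma>. admissible_contour D T U I \<Gamma> \<longrightarrow>
      (\<forall>\<gamma>\<in>\<Gamma>. left_integrand l f T I \<gamma> integrable_on {0..1})) \<and>
    (\<forall>U I \<Gamma> U' I' \<Gamma>'. admissible_contour D T U I \<Gamma> \<longrightarrow> admissible_contour D T U' I' \<Gamma>' \<longrightarrow>
       (\<Sum>\<gamma>\<in>\<Gamma>. integral {0..1} (left_integrand l f T I \<gamma>))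
       = (\<Sum>\<gamma>\<in>\<Gamma>'. integral {0..1} (left_integrand l f T I' \<gamma>)))"
proof -
  obtain \<alpha> \<beta> where D: "open D" "axially_symmetric D" and stem: "stem_pair (slice_params D) \<alpha> \<beta>"
    and f: "\<And>I u v. I \<in> unit_sphere \<Longrightarrow> (u, v) \<in> slice_params D \<Longrightarrow>
      f (u, v *\<^sub>R I) = \<alpha> (u, v) + paravector (0, I) \<star> \<beta> (u, v)"
    using assms unfolding left_slice_hyperholomorphic_def by blast
  define F where "F z = (\<alpha> (Re z, Im z), \<beta> (Re z, Im z))" for z
  define k where "k = h_of CARD('n) - l"
  define c where "c = (- 1) ^ k / fact k * gamma_const CARD('n)"
  define P where "P = left_pair ((CARD('n) + 1) div 2) k c"
  have P_left: "P_left l (slice_point I z) T = fst (P z) + snd (P z) \<odot> unit_op I"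
    if "I \<in> unit_sphere" "z \<in> regular" for I z
    using cx_op_left_pair[OF that, of c "(CARD('n) + 1) div 2" k]
    by (simp add: P_def P_left_def F_left_def Let_def c_def op_paravector_nth op.scaleR_left flip: k_def)
  have F_op: "op_of (f (slice_point I z)) = op_of (fst (F z)) + unit_op I \<odot> op_of (snd (F z))"
    if I: "I \<in> unit_sphere" and z: "z \<in> slice_of I D" for I z
  proof -
    have "f (slice_point I z) = fst (F z) + paravector (0, I) \<star> snd (F z)"
      using f[OF I, of "Re z" "Im z"] slice_params_iff[OF D(2) I] z by (simp add: slice_point_def F_def)
    then show ?thesis by (simp add: linear_add[OF linear_op_of] op_of_mult unit_op_def)
  qed
  show ?thesis
  proof (rule slice_integral_well_defined[where P = P and F = F and B = "\<lambda>x c. x \<odot> op_of c"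
        and C = "\<lambda>I x c. x \<odot> unit_op I \<odot> op_of c"])
    show "bounded_bilinear (\<lambda>x c. x \<odot> op_of c)"
      by (rule bounded_bilinear.comp[OF bounded_bilinear_op_mult bounded_linear_ident bounded_linear_op_of])
    show "bounded_bilinear (\<lambda>x c. x \<odot> unit_op I \<odot> op_of c)" for I :: "(real, 'n) vec"
      by (rule bounded_bilinear.comp[OF bounded_bilinear_op_mult op.bounded_linear_left bounded_linear_op_of])
    fix I :: "(real, 'n) vec" assume I: "I \<in> unit_sphere"
    show "cx_holomorphic (slice_of I D) F"
      unfolding F_def[abs_def] by (rule cx_holomorphic_stem[OF D I stem])
    show "F (cnj z) = cx_conj (F z)" if "z \<in> slice_of I D" for z
      unfolding F_def by (rule stem_cnj[OF D(2) I stem that])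
    fix \<gamma> :: "real \<Rightarrow> complex" and t
    assume "\<gamma> t \<in> regular" "\<gamma> t \<in> slice_of I D"
    then show "left_integrand l f T I \<gamma> t
      = snd (cx_scale (vector_derivative \<gamma> (at t within {0..1}))
          (cx_bilinear (\<lambda>x c. x \<odot> op_of c) (P (\<gamma> t)) (F (\<gamma> t))))
        - fst (cx_scale (vector_derivative \<gamma> (at t within {0..1}))
          (cx_bilinear (\<lambda>x c. x \<odot> unit_op I \<odot> op_of c) (P (\<gamma> t)) (F (\<gamma> t))))"
      unfolding left_integrand_def
      by (simp add: P_left[OF I] F_op[OF I] op_of_ds_slice[OF I] left_product_expand[OF I])
         (simp add: cx_bilinear_def)
  qed (use D in \<open>simp_all add: P_def cx_holomorphic_left_pair left_pair_cnj\<close>)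
qed

theorem right_slice_integral_well_defined:
  assumes "right_slice_hyperholomorphic D f"
  shows "(\<forall>U I \<Gamma>. admissible_contour D T U I \<Gamma> \<longrightarrow>
      (\<forall>\<gamma>\<in>\<Gamma>. right_integrand l f T I \<gamma> integrable_on {0..1})) \<and>
    (\<forall>U I \<Gamma> U' I' \<Gamma>'. admissible_contour D T U I \<Gamma> \<longrightarrow> admissible_contour D T U' I' \<Gamma>' \<longrightarrow>
       (\<Sum>\<gamma>\<in>\<Gamma>. integral {0..1} (right_integrand l f T I \<gamma>))
       = (\<Sum>\<gamma>\<in>\<Gamma>'. integral {0..1} (right_integrand l f T I' \<gamma>)))"
proof -
  obtain \<alpha> \<beta> where D: "open D" "axially_symmetric D" and stem: "stem_pair (slice_params D) \<alpha> \<beta>"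
    and f: "\<And>I u v. I \<in> unit_sphere \<Longrightarrow> (u, v) \<in> slice_params D \<Longrightarrow>
      f (u, v *\<^sub>R I) = \<alpha> (u, v) + \<beta> (u, v) \<star> paravector (0, I)"
    using assms unfolding right_slice_hyperholomorphic_def by blast
  define F where "F z = (\<alpha> (Re z, Im z), \<beta> (Re z, Im z))" for z
  define k where "k = h_of CARD('n) - l"
  define c where "c = (- 1) ^ k / fact k * gamma_const CARD('n)"
  define P where "P = right_pair ((CARD('n) + 1) div 2) k c"
  have P_right: "P_right l (slice_point I z) T = fst (P z) + unit_op I \<odot> snd (P z)"
    if "I \<in> unit_sphere" "z \<in> regular" for I z
    using cx_op_right_pair[OF that, of c k "(CARD('n) + 1) div 2"]
    by (simp add: P_def P_right_def F_right_def Let_def c_def op_paravector_nth op.scaleR_right flip: k_def)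
  have F_op: "op_of (f (slice_point I z)) = op_of (fst (F z)) + op_of (snd (F z)) \<odot> unit_op I"
    if I: "I \<in> unit_sphere" and z: "z \<in> slice_of I D" for I z
  proof -
    have "f (slice_point I z) = fst (F z) + snd (F z) \<star> paravector (0, I)"
      using f[OF I, of "Re z" "Im z"] slice_params_iff[OF D(2) I] z by (simp add: slice_point_def F_def)
    then show ?thesis by (simp add: linear_add[OF linear_op_of] op_of_mult unit_op_def)
  qed
  show ?thesis
  proof (rule slice_integral_well_defined[where P = P and F = F and B = "\<lambda>x c. op_of c \<odot> x"
        and C = "\<lambda>I x c. op_of c \<odot> unit_op I \<odot> x"])
    show "bounded_bilinear (\<lambda>x c. op_of c \<odot> x)"
      by (rule bounded_bilinear.flip[OF bounded_bilinear.comp1[OF bounded_bilinear_op_mult bounded_linear_op_of]])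
    show "bounded_bilinear (\<lambda>x c. op_of c \<odot> unit_op I \<odot> x)" for I :: "(real, 'n) vec"
      by (rule bounded_bilinear.flip[OF bounded_bilinear.comp1[OF bounded_bilinear_op_mult
            bounded_linear_compose[OF op.bounded_linear_left bounded_linear_op_of]]])
    fix I :: "(real, 'n) vec" assume I: "I \<in> unit_sphere"
    show "cx_holomorphic (slice_of I D) F"
      unfolding F_def[abs_def] by (rule cx_holomorphic_stem[OF D I stem])
    show "F (cnj z) = cx_conj (F z)" if "z \<in> slice_of I D" for z
      unfolding F_def by (rule stem_cnj[OF D(2) I stem that])
    fix \<gamma> :: "real \<Rightarrow> complex" and t
    assume "\<gamma> t \<in> regular" "\<gamma> t \<in> slice_of I D"
    then show "right_integrand l f T I \<gamma> t
      = snd (cx_scale (vector_derivative \<gamma> (at t within {0..1}))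
          (cx_bilinear (\<lambda>x c. op_of c \<odot> x) (P (\<gamma> t)) (F (\<gamma> t))))
        - fst (cx_scale (vector_derivative \<gamma> (at t within {0..1}))
          (cx_bilinear (\<lambda>x c. op_of c \<odot> unit_op I \<odot> x) (P (\<gamma> t)) (F (\<gamma> t))))"
      unfolding right_integrand_def
      by (simp add: P_right[OF I] F_op[OF I] op_of_ds_slice[OF I] right_product_expand[OF I])
         (simp add: cx_bilinear_def)
  qed (use D in \<open>simp_all add: P_def cx_holomorphic_right_pair right_pair_cnj\<close>)
qed

end

theorem proposition9p6:
  fixes T :: "('v::banach, 'n::{finite,linorder}) clop"
    and l :: nat
  assumes "odd CARD('n)"
    and "int l \<le> int (h_of CARD('n)) - 1"
    and "T \<in> BC01"
    and "cx_spectrum (T $ {}) \<subseteq> \<real>"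
    and "\<And>j. j \<noteq> Max UNIV \<Longrightarrow> cx_spectrum (T $ {j}) \<subseteq> \<real>"
    and "T $ {Max UNIV} = 0"
  shows
    "(\<forall>D f. left_slice_hyperholomorphic D f \<longrightarrow>
        (\<forall>U I \<Gamma>. admissible_contour D T U I \<Gamma> \<longrightarrow>
           (\<forall>\<gamma>\<in>\<Gamma>. left_integrand l f T I \<gamma> integrable_on {0..1})) \<and>
        (\<forall>U I \<Gamma> U' I' \<Gamma>'. admissible_contour D T U I \<Gamma> \<longrightarrow> admissible_contour D T U' I' \<Gamma>' \<longrightarrow>
           left_calculus l f T I \<Gamma> = left_calculus l f T I' \<Gamma>')) \<and>
     (\<forall>D f. right_slice_hyperholomorphic D f \<longrightarrow>
        (\<forall>U I \<Gamma>. admissible_contour D T U I \<Gamma> \<longrightarrow>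
           (\<forall>\<gamma>\<in>\<Gamma>. right_integrand l f T I \<gamma> integrable_on {0..1})) \<and>
        (\<forall>U I \<Gamma> U' I' \<Gamma>'. admissible_contour D T U I \<Gamma> \<longrightarrow> admissible_contour D T U' I' \<Gamma>' \<longrightarrow>
           right_calculus l f T I \<Gamma> = right_calculus l f T I' \<Gamma>'))"
proof -
  obtain T0 T1 where T: "T = op_paravector T0 T1"
    and comm: "\<And>j. T0 o\<^sub>L T1 j = T1 j o\<^sub>L T0" "\<And>i j. T1 i o\<^sub>L T1 j = T1 j o\<^sub>L T1 i"
    using assms(3) unfolding BC01_def by blast
  interpret commuting_components T0 T1 by unfold_locales (fact comm)+
  show ?thesis
    unfolding T left_calculus_def right_calculus_def
  proof (intro conjI allI impI)
    fix D :: "'n pvec set" and f U I \<Gamma>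
    assume f: "left_slice_hyperholomorphic D f"
    note wd = left_slice_integral_well_defined[OF f, of l]
    assume adm: "admissible_contour D (op_paravector T0 T1) U I \<Gamma>"
    then show "\<forall>\<gamma>\<in>\<Gamma>. left_integrand l f (op_paravector T0 T1) I \<gamma> integrable_on {0..1}"
      using wd by blast
    fix U' I' \<Gamma>' assume "admissible_contour D (op_paravector T0 T1) U' I' \<Gamma>'"
    then show "(1 / (2 * pi)) *\<^sub>R (\<Sum>\<gamma>\<in>\<Gamma>. integral {0..1} (left_integrand l f (op_paravector T0 T1) I \<gamma>))
        = (1 / (2 * pi)) *\<^sub>R (\<Sum>\<gamma>\<in>\<Gamma>'. integral {0..1} (left_integrand l f (op_paravector T0 T1) I' \<gamma>))"
      using wd adm by (intro arg_cong[where f = "scaleR (1 / (2 * pi))"]) blast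
  next
    fix D :: "'n pvec set" and f U I \<Gamma>
    assume f: "right_slice_hyperholomorphic D f"
    note wd = right_slice_integral_well_defined[OF f, of l]
    assume adm: "admissible_contour D (op_paravector T0 T1) U I \<Gamma>"
    then show "\<forall>\<gamma>\<in>\<Gamma>. right_integrand l f (op_paravector T0 T1) I \<gamma> integrable_on {0..1}"
      using wd by blast
    fix U' I' \<Gamma>' assume "admissible_contour D (op_paravector T0 T1) U' I' \<Gamma>'"
    then show "(1 / (2 * pi)) *\<^sub>R (\<Sum>\<gamma>\<in>\<Gamma>. integral {0..1} (right_integrand l f (op_paravector T0 T1) I \<gamma>))
        = (1 / (2 * pi)) *\<^sub>R (\<Sum>\<gamma>\<in>\<Gamma>'. integral {0..1} (right_integrand l f (op_paravector T0 T1) I' \<gamma>))"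
      using wd adm by (intro arg_cong[where f = "scaleR (1 / (2 * pi))"]) blast
  qed
qed

end
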